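(* Let $N\ge 1$, $m\geq 2$, let $T_1,\dots,T_m:\mathbb{R}^N\to\mathbb{R}^N$ be non-singular linear maps with $\|T_i\|<1$ for all $1\le i\le m$, and let $\mu$ be the Bernoulli measure on $I_\infty=\{1,\dots,m\}^{\mathbb{N}}$ with probabilities $p_1,\dots,p_m>0$, $\sum_{i=1}^m p_i=1$. Let $D$ be a bounded region in $\mathbb{R}^N$ and let $\mathsf{P}$ be a probability measure on the space $\Omega$ of families $\omega=\{\omega_{\mathbf{i}}:\mathbf{i}\in I\}$ such that the $\omega_{\mathbf{i}}$ $(\mathbf{i}\in I)$ are independent identically distributed random vectors in $D$ with a distribution that is absolutely continuous with respect to $N$-dimensional Lebesgue measure. Let $E^\omega$ be the almost self-affine set and $\mu^\omega$ the almost self-affine measure on $E^\omega$ (the projection of $\mu$) determined by $T_1,\dots,T_m$ and $\omega$. Then, for $\mathsf{P}$-almost all $\omega\in\Omega$, the measure $\mu^\omega$ is exact dimensional, with $$\lim_{r\to0}\frac{\log\mu^\omega(B(x,r))}{\log r}=D^1(\mu^\omega)=\min\{d_1,N\}$$ for $\mu^\omega$-almost all $x$ (in particular the limit exists).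
   Context: $\|\cdot\|$ is the operator norm for the Euclidean norm. $B(x,r)$ is the closed ball with centre $x$ and radius $r$. Code space: $I_k=\{1,\dots,m\}^k$, $I=\bigcup_{k\ge0}I_k$, $I_\infty=\{1,\dots,m\}^{\mathbb{N}}$; for $\mathbf{i}\in I$, $|\mathbf{i}|$ is its length and $C_{\mathbf{i}}\subset I_\infty$ is the cylinder of all infinite sequences beginning with $\mathbf{i}$. The Bernoulli measure $\mu$ is the Borel probability measure on $I_\infty$ with $\mu(C_{\mathbf{i}})=p_{i_1}\cdots p_{i_k}$ for $\mathbf{i}=(i_1,\dots,i_k)$. For $\mathbf{i}=(i_1,\dots,i_k)\in I$ write $T_{\mathbf{i}}=T_{i_1}\cdots T_{i_k}$. Almost self-affine sets and measures: given translation vectors $\omega_{\mathbf{i}}=\omega_{i_1,\dots,i_k}\in\mathbb{R}^N$ (here uniformly bounded), for $\mathbf{i}=(i_1,i_2,\dots)\in I_\infty$ let $$x^\omega(\mathbf{i})=\omega_{i_1}+T_{i_1}\omega_{i_1,i_2}+T_{i_1}T_{i_2}\omega_{i_1,i_2,i_3}+\cdots.$$ Then $E^\omega=\{x^\omega(\mathbf{i}):\mathbf{i}\in I_\infty\}$, a compact set, and $\mu^\omega(A)=\mu\{\mathbf{i}:x^\omega(\mathbf{i})\in A\}$. Singular value function: for a non-singular linear contraction $T$ with singular values $1>\alpha_1\ge\cdots\ge\alpha_N>0$ and $0<s\le N$, $\phi^s(T)=\alpha_1\cdots\alpha_{l-1}\alpha_l^{\,s-l+1}$ where $l$ is the integer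 with $l-1<s\le l$; $\phi^0(T)=1$; and $\phi^s(T)=(\alpha_1\cdots\alpha_N)^{s/N}$ for $s\ge N$. For $s\ge0$ let $$P(s,1)=\lim_{k\to\infty}\frac1k\sum_{|\mathbf{i}|=k}\mu(C_{\mathbf{i}})\log\big(\phi^s(T_{\mathbf{i}})^{-1}\mu(C_{\mathbf{i}})\big).$$ This limit exists, $P(\cdot,1)$ is continuous and strictly increasing in $s$, and $d_1>0$ is the unique number with $P(d_1,1)=0$. A Borel probability measure $\nu$ on $\mathbb{R}^N$ is exact dimensional (of dimension $s$) if $\lim_{r\to0}\log\nu(B(x,r))/\log r$ exists and equals $s$ for $\nu$-almost all $x$. The information dimension $D^1(\nu)$ is $\lim_{r\to0}\frac{\sum_{C}\nu(C)\log\nu(C)}{\log r}$ when this limit exists (the claim includes its existence), the sum being over the $r$-mesh cubes $[j_1r,(j_1+1)r)\times\cdots\times[j_Nr,(j_N+1)r)$, $j_1,\dots,j_N\in\mathbb{Z}$, with $\nu(C)>0$. *)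

theory Defs
  imports "HOL-Probability.Probability"
begin

subsection \<open>Code space and the Bernoulli measure\<close>

text \<open>Letters are \<open>1,\<dots>,m\<close>, finite words are lists, and an infinite sequence is a function
  \<open>i :: nat \<Rightarrow> nat\<close> indexed from 0, so that \<open>i 0\<close> is its first letter.\<close>

definition words :: "nat \<Rightarrow> nat list set" where
  "words m = lists {1..m}"

definition words_of_length :: "nat \<Rightarrow> nat \<Rightarrow> nat list set" where
  "words_of_length m k = {w \<in> words m. length w = k}"

definition code_space :: "nat \<Rightarrow> (nat \<Rightarrow> nat) set" where
  "code_space m = UNIV \<rightarrow>\<^sub>E {1..m}"

definition prefix_word :: "(nat \<Rightarrow> nat) \<Rightarrow> nat \<Rightarrow> nat list" where
  "prefix_word i k = map i [0..<k]"

definition cylinder :: "nat \<Rightarrow> nat list \<Rightarrow> (nat \<Rightarrow> nat) set" where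
  "cylinder m w = {i \<in> code_space m. prefix_word i (length w) = w}"

text \<open>The product sigma-algebra of the countably many finite discrete factors is the Borel
  sigma-algebra of the code space; \<open>measure_bernoulli_cylinder\<close> below gives the values on cylinders.\<close>

definition bernoulli_measure :: "nat \<Rightarrow> (nat \<Rightarrow> real) \<Rightarrow> (nat \<Rightarrow> nat) measure" where
  "bernoulli_measure m p = (\<Pi>\<^sub>M j\<in>UNIV. point_measure {1..m} (\<lambda>a. ennreal (p a)))"

lemma space_bernoulli_measure [simp]: "space (bernoulli_measure m p) = code_space m"
  by (simp add: bernoulli_measure_def code_space_def space_PiM space_point_measure)

lemma prob_space_letters:
  fixes m :: nat
  assumes "\<And>a. a \<in> {1..m} \<Longrightarrow> 0 \<le> p a" and "(\<Sum>a=1..m. p a) = 1"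
  shows "prob_space (point_measure {1..m} (\<lambda>a. ennreal (p a)))"
proof
  show "emeasure (point_measure {1..m} (\<lambda>a. ennreal (p a)))
      (space (point_measure {1..m} (\<lambda>a. ennreal (p a)))) = 1"
    unfolding space_point_measure
    by (subst emeasure_point_measure_finite) (use assms in \<open>auto simp del: atLeastAtMost_iff\<close>)
qed

lemma prob_space_bernoulli_measure:
  assumes "\<And>a. a \<in> {1..m} \<Longrightarrow> 0 \<le> p a" and "(\<Sum>a=1..m. p a) = 1"
  shows "prob_space (bernoulli_measure m p)"
  unfolding bernoulli_measure_def
  by (intro prob_space_PiM prob_space_letters assms)

lemma measure_bernoulli_cylinder:
  assumes p: "\<And>a. a \<in> {1..m} \<Longrightarrow> 0 \<le> p a" "(\<Sum>a=1..m. p a) = 1" and w: "w \<in> words m"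
  shows "measure (bernoulli_measure m p) (cylinder m w) = prod_list (map p w)"
proof -
  let ?M = "\<lambda>j::nat. point_measure {1..m} (\<lambda>a. ennreal (p a))"
  interpret product_prob_space ?M UNIV
    by (intro product_prob_spaceI prob_space_letters p)
  have wm: "w ! j \<in> {1..m}" if "j < length w" for j
    using w nth_mem[OF that] unfolding words_def lists_eq_set by blast
  have nn: "0 \<le> p (w ! j)" if "j < length w" for j
    using p(1)[OF wm[OF that]] .
  have pref: "prefix_word x (length w) = w \<longleftrightarrow> (\<forall>j\<in>{..<length w}. x j \<in> {w ! j})" for x
    unfolding prefix_word_def list_eq_iff_nth_eq by auto
  have sp: "space (Pi\<^sub>M UNIV ?M) = code_space m"
    unfolding space_PiM space_point_measure code_space_def ..
  have single: "emeasure (?M j) {w ! j} = ennreal (p (w ! j))" if "j < length w" for j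
    using wm[OF that] by (subst emeasure_point_measure_finite) simp_all
  have "emeasure (Pi\<^sub>M UNIV ?M) (cylinder m w) = (\<Prod>j<length w. emeasure (?M j) {w ! j})"
    unfolding cylinder_def pref sp[symmetric]
  proof (rule emeasure_PiM_Collect)
    show "{w ! j} \<in> sets (?M j)" if "j \<in> {..<length w}" for j
      using wm[of j] that by (simp add: sets_point_measure)
  qed simp_all
  also have "\<dots> = (\<Prod>j<length w. ennreal (p (w ! j)))"
    using single by (intro prod.cong) simp_all
  also have "\<dots> = ennreal (\<Prod>j<length w. p (w ! j))"
    using nn by (intro prod_ennreal) simp
  also have "(\<Prod>j<length w. p (w ! j)) = prod_list (map p w)"
    by (simp add: prod.list_conv_set_nth atLeast0LessThan)
  finally have "emeasure (bernoulli_measure m p) (cylinder m w) = ennreal (prod_list (map p w))"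
    unfolding bernoulli_measure_def .
  moreover have "0 \<le> prod_list (map p w)"
    using nn by (auto simp: prod.list_conv_set_nth intro!: prod_nonneg)
  ultimately show ?thesis
    by (simp add: measure_def)
qed


subsection \<open>Almost self-affine sets and measures\<close>

fun word_map :: "(nat \<Rightarrow> 'a \<Rightarrow> 'a) \<Rightarrow> nat list \<Rightarrow> 'a \<Rightarrow> 'a" where
  "word_map T [] = id"
| "word_map T (a # w) = T a \<circ> word_map T w"

definition code_point ::
    "(nat \<Rightarrow> real^'n \<Rightarrow> real^'n) \<Rightarrow> (nat list \<Rightarrow> real^'n) \<Rightarrow> (nat \<Rightarrow> nat) \<Rightarrow> real^'n" where
  "code_point T \<omega> i = (\<Sum>k. word_map T (prefix_word i k) (\<omega> (prefix_word i (Suc k))))"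

definition almost_self_affine_set ::
    "nat \<Rightarrow> (nat \<Rightarrow> real^'n \<Rightarrow> real^'n) \<Rightarrow> (nat list \<Rightarrow> real^'n) \<Rightarrow> (real^'n) set" where
  "almost_self_affine_set m T \<omega> = code_point T \<omega> ` code_space m"

definition almost_self_affine_measure ::
    "nat \<Rightarrow> (nat \<Rightarrow> real) \<Rightarrow> (nat \<Rightarrow> real^'n \<Rightarrow> real^'n) \<Rightarrow> (nat list \<Rightarrow> real^'n) \<Rightarrow> (real^'n) measure" where
  "almost_self_affine_measure m p T \<omega> = distr (bernoulli_measure m p) borel (code_point T \<omega>)"

text \<open>The measure is carried by the almost self-affine set.\<close>

lemma measure_almost_self_affine_measure_eq_1:
  assumes p: "\<And>a. a \<in> {1..m} \<Longrightarrow> 0 \<le> p a" "(\<Sum>a=1..m. p a) = 1"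
    and meas: "code_point T \<omega> \<in> borel_measurable (bernoulli_measure m p)"
    and A: "A \<in> sets borel" "almost_self_affine_set m T \<omega> \<subseteq> A"
  shows "measure (almost_self_affine_measure m p T \<omega>) A = 1"
proof -
  interpret prob_space "bernoulli_measure m p"
    by (rule prob_space_bernoulli_measure[OF p])
  have "code_point T \<omega> -` A \<inter> space (bernoulli_measure m p) = space (bernoulli_measure m p)"
    using A(2) by (auto simp: almost_self_affine_set_def)
  then show ?thesis
    using prob_space by (simp only: almost_self_affine_measure_def measure_distr[OF meas A(1)])
qed


subsection \<open>Singular values and the singular value function\<close>

text \<open>The singular values of \<open>T\<close> are the non-negative square roots of the eigenvalues of \<open>T\<^sup>* T\<close>.
  They are listed in decreasing order, each one repeated according to the dimension of its
  eigenspace (which is its algebraic multiplicity, as \<open>T\<^sup>* T\<close> is self-adjoint).\<close>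

definition singular_value_set :: "(real^'n \<Rightarrow> real^'n) \<Rightarrow> real set" where
  "singular_value_set T = {a. 0 \<le> a \<and> (\<exists>v. v \<noteq> 0 \<and> adjoint T (T v) = a\<^sup>2 *\<^sub>R v)}"

definition singular_values :: "(real^'n \<Rightarrow> real^'n) \<Rightarrow> real list" where
  "singular_values T =
     concat (map (\<lambda>a. replicate (dim {v. adjoint T (T v) = a\<^sup>2 *\<^sub>R v}) a)
       (rev (sorted_list_of_set (singular_value_set T))))"

definition singular_value :: "(real^'n \<Rightarrow> real^'n) \<Rightarrow> nat \<Rightarrow> real" where
  "singular_value T j = singular_values T ! (j - 1)"

text \<open>For \<open>0 < s\<close>, the integer \<open>l\<close> with \<open>l - 1 < s \<le> l\<close> is the ceiling of \<open>s\<close>. Only \<open>s \<ge> 0\<close> is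
  meaningful.\<close>

definition sv_function :: "real \<Rightarrow> (real^'n \<Rightarrow> real^'n) \<Rightarrow> real" where
  "sv_function s T =
     (if s \<le> 0 then 1
      else if s \<le> real CARD('n) then
        (let l = nat \<lceil>s\<rceil>
         in (\<Prod>j=1..l-1. singular_value T j) * singular_value T l powr (s - real l + 1))
      else (\<Prod>j=1..CARD('n). singular_value T j) powr (s / real CARD('n)))"

definition pressure1 :: "nat \<Rightarrow> (nat \<Rightarrow> real) \<Rightarrow> (nat \<Rightarrow> real^'n \<Rightarrow> real^'n) \<Rightarrow> real \<Rightarrow> real" where
  "pressure1 m p T s =
     lim (\<lambda>k. 1 / real k *
       (\<Sum>w\<in>words_of_length m k.
          measure (bernoulli_measure m p) (cylinder m w) *
          ln (inverse (sv_function s (word_map T w)) *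
              measure (bernoulli_measure m p) (cylinder m w))))"

definition d1 :: "nat \<Rightarrow> (nat \<Rightarrow> real) \<Rightarrow> (nat \<Rightarrow> real^'n \<Rightarrow> real^'n) \<Rightarrow> real" where
  "d1 m p T = (THE d. 0 < d \<and> pressure1 m p T d = 0)"


subsection \<open>Dimensions of measures\<close>

definition exact_dimensional :: "(real^'n) measure \<Rightarrow> real \<Rightarrow> bool" where
  "exact_dimensional \<nu> s \<longleftrightarrow> prob_space \<nu> \<and> sets \<nu> = sets borel \<and>
     (AE x in \<nu>. ((\<lambda>r. ln (measure \<nu> (cball x r)) / ln r) \<longlongrightarrow> s) (at_right 0))"

definition mesh_cube :: "real \<Rightarrow> int^'n \<Rightarrow> (real^'n) set" where
  "mesh_cube r j = {x. \<forall>i. of_int (j $ i) * r \<le> x $ i \<and> x $ i < (of_int (j $ i) + 1) * r}"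

definition charged_mesh_cubes :: "(real^'n) measure \<Rightarrow> real \<Rightarrow> (real^'n) set set" where
  "charged_mesh_cubes \<nu> r = {C \<in> range (mesh_cube r). measure \<nu> C > 0}"

text \<open>The summability clause is needed because \<open>infsum\<close> is 0 for a divergent sum; it is automatic
  for measures with bounded support.\<close>

definition has_information_dimension :: "(real^'n) measure \<Rightarrow> real \<Rightarrow> bool" where
  "has_information_dimension \<nu> D \<longleftrightarrow>
     (\<forall>r>0. (\<lambda>C. measure \<nu> C * ln (measure \<nu> C)) summable_on charged_mesh_cubes \<nu> r) \<and>
     ((\<lambda>r. (\<Sum>\<^sub>\<infinity>C\<in>charged_mesh_cubes \<nu> r. measure \<nu> C * ln (measure \<nu> C)) / ln r) \<longlongrightarrow> D)
       (at_right 0)"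

end

theory Submission
  imports Defs "HOL-Real_Asymp.Real_Asymp"
begin

text \<open>
  Along \<open>\<mu>\<close>-almost every code \<open>i\<close> the subadditive ergodic theorem gives
  \<open>ln (\<phi>\<^sup>s(T\<^sub>i\<^sub>|\<^sub>k) / \<mu>(C\<^sub>i\<^sub>|\<^sub>k)) / k \<longlonglongrightarrow> - P(s,1)\<close>, which is positive for \<open>s < d\<^sub>1\<close> and negative for
  \<open>s > d\<^sub>1\<close>.

  If \<open>d\<^sub>1 < s \<le> N\<close> and \<open>r\<close> is the singular value of \<open>T\<^sub>i\<^sub>|\<^sub>k\<close> with index \<open>\<lceil>s\<rceil>\<close>, the piece \<open>x\<^sup>\<omega>(C\<^sub>i\<^sub>|\<^sub>k)\<close> meets at
  most a constant times \<open>\<phi>\<^sup>s(T\<^sub>i\<^sub>|\<^sub>k) r\<^sup>-\<^sup>s\<close> mesh cubes of side \<open>r\<close>. By Borel-Cantelli a typical point lies in a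
  cube whose measure is at least the average over these cubes up to a factor \<open>k\<^sup>-\<^sup>2\<close>, hence at least
  \<open>r\<^sup>s\<close>. This bounds the local dimension from above, for every bounded \<open>\<omega>\<close>.

  For \<open>s < min {d\<^sub>1, N}\<close>, fix \<open>i\<close>, and let \<open>j\<close> branch off from \<open>i\<close> at level \<open>k\<close>. The density of the translations may be
  unbounded, so call a vector good if it lies where the density is at most \<open>M\<close>, with \<open>M\<close> so large that
  the other vectors have probability \<open>\<delta> \<le> q / 2\<close> for \<open>q = min p\<^sub>a\<close>. Splitting according to the first good vector
  \<open>\<omega>\<^sub>i\<^sub>|\<^sub>k\<^sub>'\<^sub>+\<^sub>1\<close> with \<open>k' \<ge> k\<close>, and conditioning on all other vectors, the probability of \<open>|x\<^sup>\<omega>(i) - x\<^sup>\<omega>(j)| \<le> r\<close> is at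
  most a constant times the sum of \<open>\<delta>\<^sup>k\<^sup>'\<^sup>-\<^sup>k r\<^sup>s / \<phi>\<^sup>s(T\<^sub>i\<^sub>|\<^sub>k\<^sub>')\<close> over \<open>k'\<close>. The loss \<open>\<delta>\<^sup>k\<^sup>'\<^sup>-\<^sup>k\<close> compensates
  \<open>\<mu>(C\<^sub>i\<^sub>|\<^sub>k) \<le> q\<^sup>k\<^sup>-\<^sup>k\<^sup>' \<mu>(C\<^sub>i\<^sub>|\<^sub>k\<^sub>')\<close>, so the expectation of \<open>\<mu>\<^sup>\<omega>(B(x\<^sup>\<omega>(i), r))\<close> is \<open>O(r\<^sup>s)\<close>, and Fubini's theorem gives the
  lower bound for almost every \<open>\<omega>\<close>.
\<close>

subsection \<open>Singular value decomposition\<close>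

text \<open>Singular values enter through volumes. The r-neighbourhood of the ellipsoid T(B(0,1))
  has volume comparable to the product of the max(alpha_j, r), and for 0 < s \<le> N the minimum
  over r of this product times r^(s-N) is phi^s(T). So covering and volume comparison yield both the
  cube counts and the submultiplicativity that the ergodic theorem requires. The upper bound sees
  the measure only at the critical singular values along a code, which need not decrease
  monotonically. They suffice because each is at least a fixed fraction of the preceding one. If d_1
  \<ge> N, there is no exponent s with d_1 < s \<le> N, and counting cubes in a bounded set takes
  over. In the lower bound a vector helps only if it enters x(i) but not x(j), that is, if its index
  is a prefix of i longer than the branching level; hence the search for a good vector runs along i.
  Taking \<delta> \<le> q / 2 leaves a factor 2^-n for a delay n of the first good vector, which
  controls the sum over n.\<close>

lemma self_adjoint_eigenvector_exists:
  fixes f :: "'a::euclidean_space \<Rightarrow> 'a"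
  assumes f: "linear f" and sa: "\<And>x y. f x \<bullet> y = x \<bullet> f y"
    and S: "subspace S" "S \<noteq> {0}" and inv: "\<And>x. x \<in> S \<Longrightarrow> f x \<in> S"
  obtains v c where "v \<in> S" "v \<noteq> 0" "f v = c *\<^sub>R v"
proof -
  let ?K = "S \<inter> sphere 0 1"
  obtain u where u: "u \<in> S" "u \<noteq> 0"
    using S subspace_0 by blast
  have "compact ?K"
    by (intro closed_Int_compact closed_subspace S compact_sphere)
  moreover have "u /\<^sub>R norm u \<in> ?K"
    using u S by (auto intro: subspace_scale)
  moreover have "continuous_on ?K (\<lambda>x. f x \<bullet> x)"
    by (intro continuous_intros linear_continuous_on linear_conv_bounded_linear[THEN iffD1] f)
  ultimately obtain v where v: "v \<in> ?K" "\<And>x. x \<in> ?K \<Longrightarrow> f x \<bullet> x \<le> f v \<bullet> v"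
    using continuous_attains_sup[of ?K "\<lambda>x. f x \<bullet> x"] by blast
  \<comment> \<open>v maximises the Rayleigh quotient on S and c is the maximum, so g = c - f is
    positive semidefinite on S and its quadratic form vanishes at v.\<close>
  define c where "c = f v \<bullet> v"
  define g where "g x = c *\<^sub>R x - f x" for x
  have nv: "norm v = 1" and vS: "v \<in> S"
    using v(1) by auto
  have gpos: "0 \<le> g x \<bullet> x" if "x \<in> S" for x
  proof (cases "x = 0")
    case False
    have "x /\<^sub>R norm x \<in> ?K"
      using that S False by (auto intro: subspace_scale)
    then have "f (x /\<^sub>R norm x) \<bullet> (x /\<^sub>R norm x) \<le> c"
      using v(2)[of "x /\<^sub>R norm x"] unfolding c_def by blast
    moreover have "f (x /\<^sub>R norm x) \<bullet> (x /\<^sub>R norm x) = (f x \<bullet> x) / (norm x)\<^sup>2"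
      by (simp add: linear_cmul[OF f] power2_eq_square field_simps)
    ultimately have "f x \<bullet> x \<le> c * (norm x)\<^sup>2"
      using False by (simp only: divide_le_eq) simp
    then show ?thesis
      by (simp add: g_def inner_diff_left power2_norm_eq_inner)
  qed (simp add: g_def)
  have glin: "g (x + t *\<^sub>R y) = g x + t *\<^sub>R g y" for x y t
    by (simp add: g_def linear_add[OF f] linear_cmul[OF f] algebra_simps)
  have gv: "g v \<bullet> v = 0"
    using nv by (simp add: g_def c_def inner_diff_left flip: power2_norm_eq_inner)
  have gS: "g v \<in> S"
    using S vS inv by (auto simp: g_def intro!: subspace_diff subspace_scale)
  have gsa: "g x \<bullet> y = x \<bullet> g y" for x y
    by (simp add: g_def inner_diff_left inner_diff_right sa)
  define a b where "a = g v \<bullet> g v" and "b = g (g v) \<bullet> g v"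
  \<comment> \<open>Positivity of g at v + t g v is a quadratic in t without constant term, so the
    linear coefficient 2 |g v|^2 has to vanish. Below, t = - a / b is the minimiser.\<close>
  have q: "0 \<le> 2 * t * a + t\<^sup>2 * b" for t
  proof -
    have "v + t *\<^sub>R g v \<in> S"
      using S vS gS by (auto intro!: subspace_add subspace_scale)
    from gpos[OF this] have "0 \<le> (g v + t *\<^sub>R g (g v)) \<bullet> (v + t *\<^sub>R g v)"
      by (simp add: glin)
    also have "\<dots> = g v \<bullet> v + t * (g (g v) \<bullet> v) + t * a + t\<^sup>2 * b"
      by (simp add: a_def b_def inner_add_left inner_add_right algebra_simps power2_eq_square)
    also have "g (g v) \<bullet> v = a"
      by (simp add: gsa[of "g v"] a_def)
    finally show ?thesis
      using gv by (simp add: mult_ac)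
  qed
  have "a \<le> 0"
  proof (rule ccontr)
    assume "\<not> a \<le> 0"
    then have a: "a > 0" by simp
    show False
    proof (cases "b \<le> 0")
      case True
      then show False using q[of "-1"] a by simp
    next
      case False
      have "2 * (- (a / b)) * a + (- (a / b))\<^sup>2 * b = - (a\<^sup>2 / b)"
        using False by (simp add: field_simps power2_eq_square)
      with q[of "- (a / b)"] a False show False
        by (smt (verit) divide_pos_pos zero_less_power)
    qed
  qed
  then have "g v = 0"
    by (metis a_def inner_gt_zero_iff not_le)
  then have "f v = c *\<^sub>R v"
    by (simp add: g_def)
  then show thesis
    using that vS nv by force
qed

lemma norm_eigenvector_adjoint:
  fixes T :: "real^'n \<Rightarrow> real^'n"
  assumes "linear T" "adjoint T (T v) = a\<^sup>2 *\<^sub>R v" "0 \<le> a"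
  shows "norm (T v) = a * norm v"
proof -
  have "(norm (T v))\<^sup>2 = (a * norm v)\<^sup>2"
    using adjoint_works[OF assms(1), of v "T v"] assms(2)
    by (simp add: power2_norm_eq_inner inner_commute power_mult_distrib)
  then show ?thesis
    using assms(3) by (simp add: power2_eq_iff_nonneg)
qed

definition eigenspace_adjoint :: "(real^'n \<Rightarrow> real^'n) \<Rightarrow> real \<Rightarrow> (real^'n) set" where
  "eigenspace_adjoint T a = {v. adjoint T (T v) = a\<^sup>2 *\<^sub>R v}"

lemma linear_adjoint_comp:
  fixes T :: "real^'n \<Rightarrow> real^'n"
  assumes "linear T"
  shows "linear (\<lambda>v. adjoint T (T v))"
  using linear_compose[OF assms adjoint_linear[OF assms]] by (simp add: o_def)

lemma adjoint_comp_self_adjoint: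
  fixes T :: "real^'n \<Rightarrow> real^'n"
  assumes "linear T"
  shows "adjoint T (T x) \<bullet> y = x \<bullet> adjoint T (T y)"
  by (metis adjoint_works[OF assms] inner_commute)

lemma subspace_eigenspace_adjoint:
  fixes T :: "real^'n \<Rightarrow> real^'n"
  assumes "linear T"
  shows "subspace (eigenspace_adjoint T a)"
  unfolding eigenspace_adjoint_def subspace_def
  using linear_0[OF linear_adjoint_comp[OF assms]] linear_add[OF linear_adjoint_comp[OF assms]]
    linear_cmul[OF linear_adjoint_comp[OF assms]]
  by (auto simp: scaleR_add_right)

lemma eigenspaces_adjoint_orthogonal:
  fixes T :: "real^'n \<Rightarrow> real^'n"
  assumes T: "linear T" and ab: "a \<noteq> b" "0 \<le> a" "0 \<le> b"
    and u: "u \<in> eigenspace_adjoint T a" and v: "v \<in> eigenspace_adjoint T b"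
  shows "u \<bullet> v = 0"
proof -
  have "a\<^sup>2 * (u \<bullet> v) = b\<^sup>2 * (u \<bullet> v)"
    using adjoint_comp_self_adjoint[OF T, of u v] u v by (simp add: eigenspace_adjoint_def)
  moreover have "a\<^sup>2 \<noteq> b\<^sup>2"
    using ab by (simp add: power2_eq_iff_nonneg)
  ultimately show ?thesis by simp
qed

text \<open>Otherwise the orthogonal complement of the eigenspaces is a nonzero invariant subspace
  and contains an eigenvector. Its eigenvalue is |T v|^2 / |v|^2, hence the square of a singular
  value, so the vector lies in an eigenspace to which it is orthogonal.\<close>

lemma span_eigenspaces_adjoint:
  fixes T :: "real^'n \<Rightarrow> real^'n"
  assumes T: "linear T"
  shows "span (\<Union>a\<in>singular_value_set T. eigenspace_adjoint T a) = UNIV"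
proof (rule ccontr)
  let ?f = "\<lambda>v. adjoint T (T v)"
  let ?W = "\<Union>a\<in>singular_value_set T. eigenspace_adjoint T a"
  let ?S = "{x. \<forall>w\<in>?W. orthogonal w x}"
  assume "span ?W \<noteq> UNIV"
  moreover have "?S = {0} \<Longrightarrow> span ?W = UNIV"
  proof -
    assume S0: "?S = {0}"
    show "span ?W = UNIV"
    proof -
      have "x \<in> span ?W" for x
      proof -
        obtain y z where yz: "y \<in> span ?W" "\<And>w. w \<in> span ?W \<Longrightarrow> orthogonal z w" "x = y + z"
          using orthogonal_subspace_decomp_exists[of ?W x] by blast
        then have "z \<in> ?S"
          using orthogonal_commute span_base by blast
        then have "z = 0" using S0 by blast
        then show ?thesis using yz by simp
      qed
      then show ?thesis by auto
    qed
  qed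
  ultimately have S0: "?S \<noteq> {0}" by blast
  have S: "subspace ?S"
    using subspace_orthogonal_to_vectors[of ?W] by (simp add: orthogonal_commute)
  have inv: "?f x \<in> ?S" if x: "x \<in> ?S" for x
  proof -
    have "orthogonal w (?f x)" if "w \<in> ?W" for w
    proof -
      from that obtain a where a: "w \<in> eigenspace_adjoint T a" by blast
      have "w \<bullet> ?f x = ?f w \<bullet> x"
        by (simp add: adjoint_comp_self_adjoint[OF T])
      also have "\<dots> = a\<^sup>2 * (w \<bullet> x)"
        using a by (simp add: eigenspace_adjoint_def)
      also have "\<dots> = 0" using x that by (auto simp: orthogonal_def)
      finally show ?thesis by (simp add: orthogonal_def)
    qed
    then show ?thesis by blast
  qed
  obtain v c where v: "v \<in> ?S" "v \<noteq> 0" "?f v = c *\<^sub>R v"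
    using self_adjoint_eigenvector_exists[OF linear_adjoint_comp[OF T]
        adjoint_comp_self_adjoint[OF T] S S0 inv] by blast
  have "c * (v \<bullet> v) = T v \<bullet> T v"
    using adjoint_works[OF T, of v "T v"] v(3) by (simp add: inner_commute)
  then have "c \<ge> 0"
    using v(2) by (metis inner_ge_zero inner_gt_zero_iff zero_le_mult_iff not_less)
  then have "?f v = (sqrt c)\<^sup>2 *\<^sub>R v"
    using v(3) by simp
  then have "sqrt c \<in> singular_value_set T" "v \<in> eigenspace_adjoint T (sqrt c)"
    using \<open>c \<ge> 0\<close> v(2) by (auto simp: singular_value_set_def eigenspace_adjoint_def)
  then have "v \<in> ?W" by blast
  then have "orthogonal v v" using v(1) by blast
  then show False
    using v(2) by (simp add: orthogonal_self)
qed

lemma sorted_concat_replicate: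
  assumes "sorted_wrt (\<ge>) (xs::real list)"
  shows "sorted_wrt (\<ge>) (concat (map (\<lambda>a. replicate (n a) a) xs))"
proof -
  have "sorted_wrt (\<ge>) (replicate k a)" for k and a :: real
    by (induction k) auto
  then show ?thesis
    using assms by (induction xs) (auto simp: sorted_wrt_append)
qed

text \<open>This trades the list encoding of singular values for vectors: orthonormal bases of the
  eigenspaces are concatenated in the order of the list. Images of different vectors are orthogonal
  because the inner product of T u and T v is a multiple of that of u and v.\<close>

lemma singular_vectors_exist:
  fixes T :: "real^'n \<Rightarrow> real^'n"
  assumes T: "linear T"
  obtains vs where "singular_values T = map (\<lambda>v. norm (T v)) vs" "length vs = CARD('n)" "distinct vs"
    "\<And>u. u \<in> set vs \<Longrightarrow> norm u = 1"
    "\<And>u v. u \<in> set vs \<Longrightarrow> v \<in> set vs \<Longrightarrow> u \<noteq> v \<Longrightarrow> u \<bullet> v = 0 \<and> T u \<bullet> T v = 0"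
    "sorted_wrt (\<ge>) (singular_values T)"
proof -
  let ?A = "singular_value_set T"
  have "\<exists>B. B \<subseteq> eigenspace_adjoint T a \<and> pairwise orthogonal B \<and> (\<forall>x\<in>B. norm x = 1) \<and>
      independent B \<and> card B = dim (eigenspace_adjoint T a) \<and> span B = eigenspace_adjoint T a" for a
    using orthonormal_basis_subspace[OF subspace_eigenspace_adjoint[OF T, of a]] by metis
  then obtain B where B: "\<And>a. B a \<subseteq> eigenspace_adjoint T a" "\<And>a. pairwise orthogonal (B a)"
      "\<And>a x. x \<in> B a \<Longrightarrow> norm x = 1" "\<And>a. independent (B a)"
      "\<And>a. card (B a) = dim (eigenspace_adjoint T a)" "\<And>a. span (B a) = eigenspace_adjoint T a"
    by metis
  define U where "U = (\<Union>a\<in>?A. B a)"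
  have orth_diff: "u \<bullet> v = 0" if "u \<in> B a" "v \<in> B b" "a \<in> ?A" "b \<in> ?A" "a \<noteq> b" for u v a b
    using eigenspaces_adjoint_orthogonal[OF T, of a b u v] that B(1)
    by (auto simp: singular_value_set_def)
  have porth: "pairwise orthogonal U"
    unfolding pairwise_def
  proof (intro ballI impI)
    fix u v assume uv: "u \<in> U" "v \<in> U" "u \<noteq> v"
    then obtain a b where ab: "a \<in> ?A" "b \<in> ?A" "u \<in> B a" "v \<in> B b"
      by (auto simp: U_def)
    show "orthogonal u v"
    proof (cases "a = b")
      case True
      then show ?thesis using B(2)[of a] ab uv by (auto simp: pairwise_def)
    next
      case False
      then show ?thesis using orth_diff ab by (auto simp: orthogonal_def)
    qed
  qed
  have n1: "norm u = 1" if "u \<in> U" for u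
    using that B(3) by (auto simp: U_def)
  then have indep: "independent U"
    using porth pairwise_orthogonal_independent n1 by (metis norm_zero zero_neq_one)
  have disj: "B a \<inter> B b = {}" if "a \<in> ?A" "b \<in> ?A" "a \<noteq> b" for a b
    using orth_diff that B(3) by (metis disjoint_iff inner_eq_zero_iff norm_zero zero_neq_one)
  have finU: "finite U" and cardU: "card U \<le> CARD('n)"
    using independent_bound[OF indep] by auto
  have "span U = UNIV"
  proof -
    have "(\<Union>a\<in>?A. eigenspace_adjoint T a) \<subseteq> span U"
    proof safe
      fix a x assume "a \<in> ?A" "x \<in> eigenspace_adjoint T a"
      then have "x \<in> span (B a)" using B(6) by simp
      moreover have "B a \<subseteq> U" using \<open>a \<in> ?A\<close> by (auto simp: U_def)
      ultimately show "x \<in> span U" using span_mono by blast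
    qed
    then show ?thesis
      using span_eigenspaces_adjoint[OF T] by (metis span_minimal subspace_span top.extremum_unique)
  qed
  then have cardU: "card U = CARD('n)"
    using indep by (metis dim_UNIV dim_eq_card dim_span DIM_cart DIM_real mult_1_right)
  have Bne: "B a \<noteq> {}" if "a \<in> ?A" for a
  proof
    assume "B a = {}"
    then have "eigenspace_adjoint T a = {0}" using B(6)[of a] by simp
    then show False using that by (auto simp: singular_value_set_def eigenspace_adjoint_def)
  qed
  \<comment> \<open>\<open>sorted_list_of_set\<close> is meaningful only for finite sets. Choosing a
    basis vector for each singular value embeds the set into the finite set U.\<close>
  have finA: "finite ?A"
  proof -
    have "inj_on (\<lambda>a. SOME v. v \<in> B a) ?A"
      using disj Bne by (intro inj_onI) (metis disjoint_iff some_in_eq)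
    moreover have "(\<lambda>a. SOME v. v \<in> B a) ` ?A \<subseteq> U"
      using Bne by (auto simp: U_def some_in_eq)
    ultimately show ?thesis using finU by (meson finite_subset inj_on_finite)
  qed
  have finB: "finite (B a)" for a
    using B(4) independent_bound by blast
  have "\<exists>bs. set bs = B a \<and> distinct bs" for a
    using finite_distinct_list[OF finB] by auto
  then obtain bl where bl: "\<And>a. set (bl a) = B a" "\<And>a. distinct (bl a)"
    by metis
  define as where "as = rev (sorted_list_of_set ?A)"
  define vs where "vs = concat (map bl as)"
  have setas: "set as = ?A" and das: "distinct as"
    using finA by (auto simp: as_def)
  have setvs: "set vs = U"
    by (simp add: vs_def bl setas U_def)
  have lenbl: "length (bl a) = dim {v. adjoint T (T v) = a\<^sup>2 *\<^sub>R v}" for a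
    using B(5)[of a] bl[of a] by (metis distinct_card eigenspace_adjoint_def)
  have mapbl: "map (\<lambda>v. norm (T v)) (bl a) = replicate (length (bl a)) a" if "a \<in> ?A" for a
  proof -
    have "norm (T v) = a" if v: "v \<in> set (bl a)" for v
    proof -
      have "v \<in> B a" using v bl(1) by simp
      then have "norm v = 1" "adjoint T (T v) = a\<^sup>2 *\<^sub>R v"
        using B(1)[of a] B(3) by (auto simp: eigenspace_adjoint_def)
      moreover have "0 \<le> a" using \<open>a \<in> ?A\<close> by (simp add: singular_value_set_def)
      ultimately show ?thesis
        using norm_eigenvector_adjoint[OF T, where v = v and a = a] by simp
    qed
    then show ?thesis
      by (intro replicate_eqI) auto
  qed
  have sv: "singular_values T = map (\<lambda>v. norm (T v)) vs"
    unfolding singular_values_def vs_def map_concat as_def[symmetric] map_map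
    using mapbl setas by (intro arg_cong[where f = concat] map_cong refl) (simp flip: lenbl)
  have dvs: "distinct vs"
  proof -
    have "distinct (concat (map bl xs))" if "distinct xs" "set xs \<subseteq> ?A" for xs
      using that
    proof (induction xs)
      case (Cons a xs)
      have "B a \<inter> (\<Union>b\<in>set xs. B b) = {}"
        using Cons.prems disj by auto
      then show ?case using Cons bl by auto
    qed simp
    then show ?thesis using das setas by (simp add: vs_def)
  qed
  show thesis
  proof (rule that[OF sv _ dvs])
    show "length vs = CARD('n)"
      using cardU setvs dvs by (metis distinct_card)
    show "norm u = 1" if "u \<in> set vs" for u
      using that n1 setvs by simp
    show "u \<bullet> v = 0 \<and> T u \<bullet> T v = 0" if uv: "u \<in> set vs" "v \<in> set vs" "u \<noteq> v" for u v
    proof -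
      have "u \<bullet> v = 0"
        using porth uv setvs by (auto simp: pairwise_def orthogonal_def)
      moreover obtain b where "v \<in> B b"
        using uv setvs by (auto simp: U_def)
      then have "adjoint T (T v) = b\<^sup>2 *\<^sub>R v"
        using B(1) by (auto simp: eigenspace_adjoint_def)
      ultimately show ?thesis
        using adjoint_works[OF T, of u "T v"] by simp
    qed
    have "sorted_wrt (\<ge>) as"
      by (simp add: as_def sorted_wrt_rev)
    then show "sorted_wrt (\<ge>) (singular_values T)"
      unfolding singular_values_def as_def[symmetric] by (rule sorted_concat_replicate)
  qed
qed

subsection \<open>Volumes of images of balls\<close>

lemma nn_integral_lborel_translate:
  fixes c :: "'a::euclidean_space"
  assumes "f \<in> borel_measurable borel"
  shows "(\<integral>\<^sup>+x. f (c + x) \<partial>lborel) = (\<integral>\<^sup>+x. f x \<partial>lborel)"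
proof -
  have "(\<integral>\<^sup>+x. f x \<partial>lborel) = (\<integral>\<^sup>+x. f x \<partial>distr lborel borel ((+) c))"
    by (simp add: lborel_distr_plus)
  also have "\<dots> = (\<integral>\<^sup>+x. f (c + x) \<partial>lborel)"
    using assms by (intro nn_integral_distr) auto
  finally show ?thesis by simp
qed

text \<open>The library's \<open>measure_orthogonal_image\<close> needs a well-ordered index type. Here a Fubini argument
  compares the volume and its image under \<open>U\<close> through the unit ball, which \<open>U\<close> preserves.\<close>

lemma emeasure_lborel_orthogonal_vimage:
  fixes U :: "'a::euclidean_space \<Rightarrow> 'a"
  assumes U: "orthogonal_transformation U" and A[measurable]: "A \<in> sets borel"
  shows "emeasure lborel (U -` A) = emeasure lborel A"
proof -
  let ?B = "ball 0 1 :: 'a set"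
  have lin: "linear U" by (rule orthogonal_transformation_linear[OF U])
  have [measurable]: "U \<in> borel_measurable borel"
    by (intro borel_measurable_continuous_onI linear_continuous_on)
      (simp add: lin linear_conv_bounded_linear[symmetric])
  have [measurable]: "?B \<in> sets borel" by simp
  let ?b = "emeasure lborel ?B"
  have b: "?b \<noteq> 0" "?b \<noteq> \<infinity>"
  proof -
    have "?b > 0"
      by (subst emeasure_ball) (auto simp: unit_ball_vol_pos)
    then show "?b \<noteq> 0" by simp
    show "?b \<noteq> \<infinity>" using emeasure_lborel_ball_finite[of "0::'a" 1] by simp
  qed
  \<comment> \<open>For fixed y, the shift by y is the translation by \<open>inv U y\<close> before
    U; for fixed x, it is z = U x + y that is substituted. Both orders of integration thus reduce to
    translation invariance.\<close>
  let ?F = "\<lambda>x y. indicator A (U x + y) * indicator ?B y :: ennreal"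
  have "(\<integral>\<^sup>+x. (\<integral>\<^sup>+y. ?F x y \<partial>lborel) \<partial>lborel) = (\<integral>\<^sup>+y. (\<integral>\<^sup>+x. ?F x y \<partial>lborel) \<partial>lborel)"
    by (intro lborel_pair.Fubini') measurable
  also have "\<dots> = (\<integral>\<^sup>+y. emeasure lborel (U -` A) * indicator ?B y \<partial>lborel)"
  proof (rule nn_integral_cong)
    fix y :: 'a
    have "U x + y = U (inv U y + x)" for x
      by (simp add: linear_add[OF lin] surj_f_inv_f[OF orthogonal_transformation_surj[OF U]])
    then have "(\<integral>\<^sup>+x. ?F x y \<partial>lborel) = (\<integral>\<^sup>+x. indicator A (U (inv U y + x)) \<partial>lborel) * indicator ?B y"
      by (simp add: nn_integral_multc)
    also have "(\<integral>\<^sup>+x. indicator A (U (inv U y + x)) \<partial>lborel) = (\<integral>\<^sup>+x. indicator A (U x) \<partial>lborel)"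
      by (rule nn_integral_lborel_translate[where f = "\<lambda>x. indicator A (U x)"]) measurable
    also have "\<dots> = (\<integral>\<^sup>+x. indicator (U -` A) x \<partial>lborel)"
      by (intro nn_integral_cong) (simp add: indicator_def)
    also have "\<dots> = emeasure lborel (U -` A)"
      by (intro nn_integral_indicator) (use measurable_sets[of U borel borel A] in simp)
    finally show "(\<integral>\<^sup>+x. ?F x y \<partial>lborel) = emeasure lborel (U -` A) * indicator ?B y" .
  qed
  also have "\<dots> = emeasure lborel (U -` A) * ?b"
    by (simp add: nn_integral_cmult)
  finally have 1: "(\<integral>\<^sup>+x. (\<integral>\<^sup>+y. ?F x y \<partial>lborel) \<partial>lborel) = emeasure lborel (U -` A) * ?b" .
  have "(\<integral>\<^sup>+x. (\<integral>\<^sup>+y. ?F x y \<partial>lborel) \<partial>lborel)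
      = (\<integral>\<^sup>+x. (\<integral>\<^sup>+z. indicator A z * indicator ?B (z - U x) \<partial>lborel) \<partial>lborel)"
  proof (rule nn_integral_cong)
    fix x
    show "(\<integral>\<^sup>+y. ?F x y \<partial>lborel) = (\<integral>\<^sup>+z. indicator A z * indicator ?B (z - U x) \<partial>lborel)"
      by (subst nn_integral_lborel_translate[where c = "U x", symmetric]) simp_all
  qed
  also have "\<dots> = (\<integral>\<^sup>+z. (\<integral>\<^sup>+x. indicator A z * indicator ?B (z - U x) \<partial>lborel) \<partial>lborel)"
    by (intro lborel_pair.Fubini') measurable
  also have "\<dots> = (\<integral>\<^sup>+z. indicator A z * ?b \<partial>lborel)"
  proof (rule nn_integral_cong)
    fix z :: 'a
    have "norm (z - U x) = norm (x - inv U z)" for x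
    proof -
      have "z - U x = U (inv U z - x)"
        by (simp add: linear_diff[OF lin] surj_f_inv_f[OF orthogonal_transformation_surj[OF U]])
      then show ?thesis
        by (simp add: orthogonal_transformation_norm[OF U] norm_minus_commute)
    qed
    moreover have [measurable]: "ball (inv U z) 1 \<in> sets borel" by simp
    ultimately have "(\<integral>\<^sup>+x. indicator A z * indicator ?B (z - U x) \<partial>lborel)
        = indicator A z * (\<integral>\<^sup>+x. indicator (ball (inv U z) 1) x \<partial>lborel)"
      by (subst nn_integral_cmult[symmetric]) 
        (auto intro!: nn_integral_cong simp: indicator_def dist_norm norm_minus_commute)
    also have "\<dots> = indicator A z * ?b"
      by (simp add: emeasure_ball)
    finally show "(\<integral>\<^sup>+x. indicator A z * indicator ?B (z - U x) \<partial>lborel) = indicator A z * ?b" .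
  qed
  also have "\<dots> = emeasure lborel A * ?b"
    by (simp add: nn_integral_multc)
  finally show ?thesis
    using 1 b by (metis ennreal_mult_divide_eq infinity_ennreal_def)
qed

lemma orthogonal_image_compact:
  fixes U :: "'a::euclidean_space \<Rightarrow> 'a"
  assumes U: "orthogonal_transformation U" and K: "compact K"
  shows "compact (U ` K)" "measure lborel (U ` K) = measure lborel K"
proof -
  have lin: "linear U" by (rule orthogonal_transformation_linear[OF U])
  show c: "compact (U ` K)"
    by (intro compact_continuous_image K linear_continuous_on)
      (simp add: lin linear_conv_bounded_linear[symmetric])
  have "U -` (U ` K) = K"
    by (simp add: inj_vimage_image_eq orthogonal_transformation_inj[OF U])
  then show "measure lborel (U ` K) = measure lborel K"
    using emeasure_lborel_orthogonal_vimage[OF U, of "U ` K"] c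
    by (simp add: measure_def borel_compact)
qed

lemma orthogonal_transformation_orthonormal_basis:
  fixes b :: "'n::finite \<Rightarrow> real^'n"
  assumes b: "\<And>i j. b i \<bullet> b j = (if i = j then 1 else 0)"
  shows "orthogonal_transformation (\<lambda>x. \<Sum>i\<in>UNIV. (x $ i) *\<^sub>R b i)"
  unfolding orthogonal_transformation_def
proof (intro conjI allI)
  show "linear (\<lambda>x. \<Sum>i\<in>UNIV. (x $ i) *\<^sub>R b i)"
    by (intro linearI) (auto simp: scaleR_add_left sum.distrib scaleR_sum_right)
  show "(\<Sum>i\<in>UNIV. (v $ i) *\<^sub>R b i) \<bullet> (\<Sum>i\<in>UNIV. (w $ i) *\<^sub>R b i) = v \<bullet> w" for v w :: "real^'n"
  proof -
    have "(\<Sum>i\<in>UNIV. (v $ i) *\<^sub>R b i) \<bullet> (\<Sum>i\<in>UNIV. (w $ i) *\<^sub>R b i) = (\<Sum>i\<in>UNIV. v $ i * w $ i)"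
      by (simp add: inner_sum_left inner_sum_right b if_distrib[where f = "\<lambda>x. _ * x"] mult.commute
          cong: if_cong)
    also have "\<dots> = v \<bullet> w" by (simp add: inner_vec_def)
    finally show ?thesis .
  qed
qed

section \<open>Bounds for singular values and the singular value decomposition\<close>

lemma singular_value_bounds:
  fixes T :: "real^'n \<Rightarrow> real^'n"
  assumes T: "linear T" and j: "j \<in> {1..CARD('n)}"
  shows "(\<And>x. a * norm x \<le> norm (T x)) \<Longrightarrow> a \<le> singular_value T j"
    and "(\<And>x. norm (T x) \<le> b * norm x) \<Longrightarrow> singular_value T j \<le> b"
proof -
  obtain vs where vs: "singular_values T = map (\<lambda>v. norm (T v)) vs" "length vs = CARD('n)"
    "\<And>u. u \<in> set vs \<Longrightarrow> norm u = 1"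
    using singular_vectors_exist[OF T] by metis
  have j': "j - 1 < length vs" using j vs by auto
  then have n: "norm (vs ! (j - 1)) = 1"
    using vs(3) by simp
  have sv: "singular_value T j = norm (T (vs ! (j - 1)))"
    using j' by (simp add: singular_value_def vs)
  show "a \<le> singular_value T j" if "\<And>x. a * norm x \<le> norm (T x)"
    using that[of "vs ! (j - 1)"] n sv by simp
  show "singular_value T j \<le> b" if "\<And>x. norm (T x) \<le> b * norm x"
    using that[of "vs ! (j - 1)"] n sv by simp
qed

lemma linear_bij_lower_bound:
  fixes T :: "'a::euclidean_space \<Rightarrow> 'a"
  assumes "linear T" "bij T"
  obtains a where "a > 0" "\<And>x. a * norm x \<le> norm (T x)"
  using linear_inj_bounded_below_pos[of T] assms by (auto simp: bij_def)

lemma singular_value_pos: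
  fixes T :: "real^'n \<Rightarrow> real^'n"
  assumes T: "linear T" "bij T" and j: "j \<in> {1..CARD('n)}"
  shows "singular_value T j > 0"
proof -
  obtain a where a: "a > 0" "\<And>x. a * norm x \<le> norm (T x)"
    using linear_bij_lower_bound[OF T] by blast
  from singular_value_bounds(1)[OF T(1) j a(2)] a(1) show ?thesis by linarith
qed

lemma singular_value_antimono:
  fixes T :: "real^'n \<Rightarrow> real^'n"
  assumes T: "linear T" and ij: "1 \<le> i" "i \<le> j" "j \<le> CARD('n)"
  shows "singular_value T j \<le> singular_value T i"
proof (cases "i = j")
  case False
  obtain vs where vs: "singular_values T = map (\<lambda>v. norm (T v)) vs" "length vs = CARD('n)"
    "sorted_wrt (\<ge>) (singular_values T)"
    using singular_vectors_exist[OF T] by metis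
  have "length (singular_values T) = CARD('n)" using vs by simp
  then show ?thesis
    using sorted_wrt_nth_less[OF vs(3), of "i - 1" "j - 1"] ij False
    by (simp add: singular_value_def)
qed simp

text \<open>The coordinates are indexed by the unordered type 'n, so the bijection e assigns a
  singular value to each of them. V sends the standard basis to the singular vectors and U sends it
  to their normalised images.\<close>

lemma singular_value_decomposition:
  fixes T :: "real^'n \<Rightarrow> real^'n"
  assumes T: "linear T" "bij T"
  obtains U V :: "real^'n \<Rightarrow> real^'n" and e :: "'n \<Rightarrow> nat"
  where "orthogonal_transformation U" "orthogonal_transformation V" "bij_betw e UNIV {1..CARD('n)}"
    "\<And>x. T (V x) = U (\<chi> i. singular_value T (e i) * x $ i)"
proof -
  obtain vs where vs: "singular_values T = map (\<lambda>v. norm (T v)) vs" "length vs = CARD('n)" "distinct vs"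
    "\<And>u. u \<in> set vs \<Longrightarrow> norm u = 1"
    "\<And>u v. u \<in> set vs \<Longrightarrow> v \<in> set vs \<Longrightarrow> u \<noteq> v \<Longrightarrow> u \<bullet> v = 0 \<and> T u \<bullet> T v = 0"
    using singular_vectors_exist[OF T(1)] by metis
  obtain e0 :: "'n \<Rightarrow> nat" where e0: "bij_betw e0 UNIV {0..<CARD('n)}"
    using ex_bij_betw_finite_nat[of "UNIV :: 'n set"] by auto
  define e where "e i = Suc (e0 i)" for i
  have "bij_betw Suc {0..<CARD('n)} {1..CARD('n)}"
    by (simp add: bij_betw_def image_Suc_atLeastLessThan atLeastLessThanSuc_atLeastAtMost)
  then have e: "bij_betw e UNIV {1..CARD('n)}"
    using bij_betw_trans[OF e0, of Suc "{1..CARD('n)}"] by (simp add: e_def[abs_def] o_def)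
  define v where "v i = vs ! e0 i" for i
  have e0_less: "e0 i < length vs" for i
    using e0 vs(2) by (metis UNIV_I atLeastLessThan_iff bij_betwE)
  then have v_in: "v i \<in> set vs" for i
    by (simp add: v_def)
  have v_neq: "v i \<noteq> v j" if "i \<noteq> j" for i j
    using that e0 e0_less vs(3) by (simp add: v_def nth_eq_iff_index_eq bij_betw_def inj_eq)
  have ej: "e i \<in> {1..CARD('n)}" for i
    using e by (auto simp: bij_betw_def)
  define \<sigma> where "\<sigma> i = singular_value T (e i)" for i
  have \<sigma>: "\<sigma> i = norm (T (v i))" for i
    using e0_less by (simp add: \<sigma>_def singular_value_def e_def vs(1) v_def)
  have \<sigma>pos: "\<sigma> i > 0" for i
    unfolding \<sigma>_def using singular_value_pos[OF T ej] .
  define u where "u i = T (v i) /\<^sub>R \<sigma> i" for i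
  have vv: "v i \<bullet> v j = (if i = j then 1 else 0)" for i j
    using vs(4,5) v_in v_neq by (auto simp: norm_eq_1)
  have uu: "u i \<bullet> u j = (if i = j then 1 else 0)" for i j
  proof (cases "i = j")
    case True
    have "norm (u j) = 1" using \<sigma>pos[of j] by (simp add: u_def flip: \<sigma>)
    then show ?thesis using True by (simp add: norm_eq_1)
  next
    case False
    then show ?thesis using vs(5)[OF v_in v_in v_neq] by (simp add: u_def)
  qed
  have Tv: "T (v i) = \<sigma> i *\<^sub>R u i" for i
    using \<sigma>pos[of i] by (simp add: u_def)
  have "T (\<Sum>i\<in>UNIV. (x $ i) *\<^sub>R v i)
      = (\<Sum>i\<in>UNIV. ((\<chi> i. singular_value T (e i) * x $ i) $ i) *\<^sub>R u i)" for x
    by (simp add: linear_sum[OF T(1)] linear_cmul[OF T(1)] Tv mult.commute flip: \<sigma>_def)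
  from that[OF orthogonal_transformation_orthonormal_basis[OF uu]
      orthogonal_transformation_orthonormal_basis[OF vv] e this]
  show thesis .
qed

text \<open>The Minkowski sum of the ellipsoid T(B(0,a)) and the ball B(0,r), that is, the closed
  r-neighbourhood of the ellipsoid.\<close>

definition ball_image :: "('a::real_normed_vector \<Rightarrow> 'b::real_normed_vector) \<Rightarrow> real \<Rightarrow> real \<Rightarrow> 'b set" where
  "ball_image T a r = {T x + z | x z. norm x \<le> a \<and> norm z \<le> r}"

lemma compact_ball_image:
  fixes T :: "real^'n \<Rightarrow> real^'n"
  assumes "linear T"
  shows "compact (ball_image T a r)"
proof -
  have "ball_image T a r = {x + y |x y. x \<in> T ` cball 0 a \<and> y \<in> cball 0 r}"
    unfolding ball_image_def by (auto simp: image_iff Bex_def)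
  moreover have "compact (T ` cball 0 a)"
    by (intro compact_continuous_image linear_continuous_on)
      (simp_all add: assms linear_conv_bounded_linear[symmetric])
  ultimately show ?thesis
    using compact_sums[of "T ` cball 0 a" "cball 0 r"] by simp
qed

text \<open>Up to constants depending on the dimension, this is the volume of
  \<open>ball_image T 1 r\<close>; divided by r^N it is the number of cubes of side r needed to
  cover the ellipsoid T(B(0,1)).\<close>

definition sv_prod :: "(real^'n \<Rightarrow> real^'n) \<Rightarrow> real \<Rightarrow> real" where
  "sv_prod T r = (\<Prod>j=1..CARD('n). max (singular_value T j) r)"

lemma measure_symmetric_box:
  fixes c :: "'n::finite \<Rightarrow> real"
  assumes "\<And>i. 0 \<le> c i"
  shows "measure lborel (cbox (\<chi> i. - c i) (\<chi> i. c i)) = (\<Prod>i\<in>UNIV. 2 * c i)"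
proof -
  have "cbox (\<chi> i. - c i) (\<chi> i. c i) \<noteq> {}"
    using assms by (auto simp: box_ne_empty Basis_vec_def inner_axis intro: order_trans[of _ 0])
  then show ?thesis
    by (subst content_cbox_cart) simp_all
qed

lemma measure_ball_image_le:
  fixes T :: "real^'n \<Rightarrow> real^'n"
  assumes T: "linear T" "bij T" and a: "0 \<le> a" and r: "0 \<le> r"
  shows "measure lborel (ball_image T a r) \<le> (\<Prod>j=1..CARD('n). 2 * (a * singular_value T j + r))"
proof -
  obtain U V and e :: "'n \<Rightarrow> nat" where U: "orthogonal_transformation U" and V: "orthogonal_transformation V"
    and e: "bij_betw e UNIV {1..CARD('n)}"
    and TV: "\<And>x. T (V x) = U (\<chi> i. singular_value T (e i) * x $ i)"
    using singular_value_decomposition[OF T] by metis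
  have ej: "e i \<in> {1..CARD('n)}" for i
    using e by (auto simp: bij_betw_def)
  have pos: "0 < singular_value T (e i)" for i
    by (rule singular_value_pos[OF T ej])
  define c where "c i = a * singular_value T (e i) + r" for i
  let ?K = "cbox (\<chi> i. - c i) (\<chi> i. c i) :: (real^'n) set"
  have c0: "0 \<le> c i" for i
    using pos[of i] a r by (simp add: c_def)
  have "ball_image T a r \<subseteq> U ` ?K"
  proof
    fix y assume "y \<in> ball_image T a r"
    then obtain x z where y: "y = T x + z" "norm x \<le> a" "norm z \<le> r"
      by (auto simp: ball_image_def)
    obtain x' where x': "x = V x'" using orthogonal_transformation_surj[OF V] by (metis surjD)
    obtain z' where z': "z = U z'" using orthogonal_transformation_surj[OF U] by (metis surjD)
    have nx: "norm x' \<le> a" "norm z' \<le> r"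
      using y x' z' orthogonal_transformation_norm[OF U] orthogonal_transformation_norm[OF V] by auto
    let ?w = "(\<chi> i. singular_value T (e i) * x' $ i) + z'"
    have "y = U ?w"
      using y x' z' TV by (simp add: linear_add[OF orthogonal_transformation_linear[OF U]])
    moreover have "\<bar>?w $ i\<bar> \<le> c i" for i
    proof -
      have "\<bar>singular_value T (e i) * x' $ i\<bar> \<le> singular_value T (e i) * a"
        using component_le_norm_cart[of x' i] nx pos[of i] by (simp add: abs_mult)
      moreover have "\<bar>z' $ i\<bar> \<le> r"
        using component_le_norm_cart[of z' i] nx by simp
      ultimately show ?thesis by (simp add: c_def mult.commute)
    qed
    then have "- c i \<le> ?w $ i \<and> ?w $ i \<le> c i" for i
      by (metis abs_le_iff minus_le_iff)
    then have "?w \<in> ?K"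
      unfolding mem_box_cart vec_lambda_beta by blast
    ultimately show "y \<in> U ` ?K" by blast
  qed
  then have "measure lborel (ball_image T a r) \<le> measure lborel (U ` ?K)"
    using compact_ball_image[OF T(1)] orthogonal_image_compact(1)[OF U, of ?K]
    by (intro measure_mono_fmeasurable fmeasurable_compact) (auto simp: borel_compact)
  also have "\<dots> = (\<Prod>i\<in>UNIV. 2 * c i)"
    by (simp add: orthogonal_image_compact(2)[OF U] measure_symmetric_box[OF c0])
  also have "\<dots> = (\<Prod>j=1..CARD('n). 2 * (a * singular_value T j + r))"
    unfolding c_def using prod.reindex_bij_betw[OF e, of "\<lambda>j. 2 * (a * singular_value T j + r)"] by simp
  finally show ?thesis .
qed

text \<open>In singular coordinates the set contains a box with half-sides max(alpha_i, r) / N: the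
  coordinates with alpha_i \<ge> r are produced by the ellipsoid, the others by the ball of radius
  r. The division by N lets the l1-norm control the Euclidean norm of both parts.\<close>

lemma measure_ball_image_ge:
  fixes T :: "real^'n \<Rightarrow> real^'n"
  assumes T: "linear T" "bij T" and r: "0 < r"
  shows "(2 / real CARD('n)) ^ CARD('n) * sv_prod T r \<le> measure lborel (ball_image T 1 r)"
proof -
  obtain U V and e :: "'n \<Rightarrow> nat" where U: "orthogonal_transformation U" and V: "orthogonal_transformation V"
    and e: "bij_betw e UNIV {1..CARD('n)}"
    and TV: "\<And>x. T (V x) = U (\<chi> i. singular_value T (e i) * x $ i)"
    using singular_value_decomposition[OF T] by metis
  let ?N = "real CARD('n)"
  have N: "?N > 0" by simp
  have ej: "e i \<in> {1..CARD('n)}" for i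
    using e by (auto simp: bij_betw_def)
  define s where "s i = singular_value T (e i)" for i
  have pos: "0 < s i" for i
    unfolding s_def by (rule singular_value_pos[OF T ej])
  define c where "c i = max (s i) r / ?N" for i
  let ?K = "cbox (\<chi> i. - c i) (\<chi> i. c i) :: (real^'n) set"
  have c0: "0 \<le> c i" for i
    using r by (simp add: c_def)
  have "U ` ?K \<subseteq> ball_image T 1 r"
  proof
    fix y assume "y \<in> U ` ?K"
    then obtain w where w: "w \<in> ?K" "y = U w" by blast
    then have wi: "\<bar>w $ i\<bar> \<le> c i" for i
      by (auto simp: mem_box_cart abs_le_iff minus_le_iff)
    let ?x = "\<chi> i. if s i \<ge> r then w $ i / s i else 0"
    let ?z = "\<chi> i. if s i \<ge> r then 0 else w $ i"
    have "norm ?x \<le> (\<Sum>i\<in>UNIV. \<bar>?x $ i\<bar>)" by (rule norm_le_l1_cart)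
    also have "\<dots> \<le> (\<Sum>i\<in>(UNIV::'n set). 1 / ?N)"
    proof (intro sum_mono)
      fix i
      show "\<bar>?x $ i\<bar> \<le> 1 / ?N"
        using wi[of i] pos[of i] by (auto simp: c_def field_simps)
    qed
    also have "\<dots> = 1" by simp
    finally have x: "norm ?x \<le> 1" .
    have "norm ?z \<le> (\<Sum>i\<in>UNIV. \<bar>?z $ i\<bar>)" by (rule norm_le_l1_cart)
    also have "\<dots> \<le> (\<Sum>i\<in>(UNIV::'n set). r / ?N)"
    proof (intro sum_mono)
      fix i
      show "\<bar>?z $ i\<bar> \<le> r / ?N"
        using wi[of i] r by (auto simp: c_def)
    qed
    also have "\<dots> = r" by simp
    finally have z: "norm ?z \<le> r" .
    have "w = (\<chi> i. s i * ?x $ i) + ?z"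
      using pos by (auto simp: vec_eq_iff less_imp_neq[symmetric])
    then have "y = T (V ?x) + U ?z"
      unfolding TV w(2) s_def[symmetric] 
      by (metis linear_add[OF orthogonal_transformation_linear[OF U]])
    then show "y \<in> ball_image T 1 r"
      using x z orthogonal_transformation_norm[OF U, of ?z] orthogonal_transformation_norm[OF V, of ?x]
      unfolding ball_image_def mem_Collect_eq by metis
  qed
  then have "measure lborel (U ` ?K) \<le> measure lborel (ball_image T 1 r)"
    using compact_ball_image[OF T(1)] orthogonal_image_compact(1)[OF U, of ?K]
    by (intro measure_mono_fmeasurable fmeasurable_compact) (auto simp: borel_compact)
  moreover have "measure lborel (U ` ?K) = (\<Prod>i\<in>UNIV. 2 * c i)"
    by (simp add: orthogonal_image_compact(2)[OF U] measure_symmetric_box[OF c0])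
  moreover have "(\<Prod>i\<in>UNIV. 2 * c i) = (\<Prod>j=1..CARD('n). 2 / ?N * max (singular_value T j) r)"
    unfolding c_def s_def using prod.reindex_bij_betw[OF e, of "\<lambda>j. 2 / ?N * max (singular_value T j) r"]
    by simp
  moreover have "\<dots> = (2 / ?N) ^ CARD('n) * sv_prod T r"
    unfolding sv_prod_def prod.distrib by simp
  ultimately show ?thesis by simp
qed

text \<open>The transversality estimate. In singular coordinates x_i lies both in [-R, R] and in an
  interval of half-length r / alpha_i with unknown centre, and the shorter of the two intervals
  counts.\<close>

lemma measure_slab_le:
  fixes T :: "real^'n \<Rightarrow> real^'n"
  assumes T: "linear T" "bij T" and R: "0 \<le> R" and r: "0 \<le> r"
  shows "emeasure lborel {v. norm v \<le> R \<and> norm (T v + y) \<le> r}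
    \<le> ennreal (\<Prod>j=1..CARD('n). 2 * min R (r / singular_value T j))"
proof -
  obtain U V and e :: "'n \<Rightarrow> nat" where U: "orthogonal_transformation U" and V: "orthogonal_transformation V"
    and e: "bij_betw e UNIV {1..CARD('n)}"
    and TV: "\<And>x. T (V x) = U (\<chi> i. singular_value T (e i) * x $ i)"
    using singular_value_decomposition[OF T] by metis
  have ej: "e i \<in> {1..CARD('n)}" for i
    using e by (auto simp: bij_betw_def)
  define s where "s i = singular_value T (e i)" for i
  have pos: "0 < s i" for i
    unfolding s_def by (rule singular_value_pos[OF T ej])
  obtain y' where y': "y = U y'" using orthogonal_transformation_surj[OF U] by (metis surjD)
  define a where "a i = max (- R) ((- r - y' $ i) / s i)" for i
  define b where "b i = min R ((r - y' $ i) / s i)" for i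
  let ?K = "cbox (\<chi> i. a i) (\<chi> i. b i) :: (real^'n) set"
  have ab: "b i - a i \<le> 2 * min R (r / s i)" for i
  proof -
    have "(r - y' $ i) / s i - (- r - y' $ i) / s i = 2 * (r / s i)"
      by (simp add: diff_divide_distrib minus_divide_left[symmetric])
    then show ?thesis unfolding a_def b_def by linarith
  qed
  have "{v. norm v \<le> R \<and> norm (T v + y) \<le> r} \<subseteq> V ` ?K"
  proof
    fix v assume "v \<in> {v. norm v \<le> R \<and> norm (T v + y) \<le> r}"
    then have v: "norm v \<le> R" "norm (T v + y) \<le> r" by auto
    obtain x where x: "v = V x" using orthogonal_transformation_surj[OF V] by (metis surjD)
    have "T v + y = U ((\<chi> i. s i * x $ i) + y')"
      by (simp add: x TV y' s_def linear_add[OF orthogonal_transformation_linear[OF U]])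
    then have n: "norm ((\<chi> i. s i * x $ i) + y') \<le> r" "norm x \<le> R"
      using v x orthogonal_transformation_norm[OF U] orthogonal_transformation_norm[OF V] by auto
    have "a i \<le> x $ i \<and> x $ i \<le> b i" for i
    proof -
      have 1: "\<bar>x $ i\<bar> \<le> R" using n component_le_norm_cart[of x i] by linarith
      have 2: "\<bar>s i * x $ i + y' $ i\<bar> \<le> r"
        using n(1) component_le_norm_cart[of "(\<chi> i. s i * x $ i) + y'" i] by simp
      then have "(- r - y' $ i) / s i \<le> x $ i" "x $ i \<le> (r - y' $ i) / s i"
        using pos[of i] by (auto simp: field_simps)
      then show ?thesis using 1 by (auto simp: a_def b_def)
    qed
    then have "x \<in> ?K" by (simp add: mem_box_cart)
    then show "v \<in> V ` ?K" using x by blast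
  qed
  then have "emeasure lborel {v. norm v \<le> R \<and> norm (T v + y) \<le> r} \<le> emeasure lborel (V ` ?K)"
    using orthogonal_image_compact(1)[OF V, of ?K] by (intro emeasure_mono) (auto simp: borel_compact)
  also have "\<dots> = ennreal (measure lborel ?K)"
    using fmeasurable_compact[OF orthogonal_image_compact(1)[OF V, of ?K]] 
      orthogonal_image_compact(2)[OF V, of ?K]
    by (simp add: emeasure_eq_measure2)
  also have "measure lborel ?K \<le> (\<Prod>i\<in>UNIV. 2 * min R (r / s i))"
  proof (cases "?K = {}")
    case True
    then show ?thesis using R r pos by (simp add: prod_nonneg less_imp_le)
  next
    case False
    have "a i \<le> b i" for i
    proof -
      from False obtain x where "x \<in> ?K" by blast
      then have "a i \<le> x $ i" "x $ i \<le> b i" by (simp_all add: mem_box_cart)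
      then show ?thesis by simp
    qed
    then show ?thesis
      unfolding content_cbox_cart[OF False] using ab by (intro prod_mono) auto
  qed
  also have "(\<Prod>i\<in>UNIV. 2 * min R (r / s i)) = (\<Prod>j=1..CARD('n). 2 * min R (r / singular_value T j))"
    unfolding s_def using prod.reindex_bij_betw[OF e, of "\<lambda>j. 2 * min R (r / singular_value T j)"] by simp
  finally show ?thesis by (simp add: ennreal_leI)
qed

subsection \<open>The singular value function\<close>

text \<open>The exponent of the \<open>j\<close>-th singular value in \<open>\<phi>\<^sup>s\<close>, where \<open>n\<close> is the dimension.\<close>

definition sv_exponent :: "nat \<Rightarrow> real \<Rightarrow> nat \<Rightarrow> real" where
  "sv_exponent n s j = (if s \<le> real n then max 0 (min 1 (s - real j + 1)) else s / real n)"

lemma sv_exponent_mono: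
  assumes "1 \<le> n" "s \<le> t" shows "sv_exponent n s j \<le> sv_exponent n t j"
proof (cases "s \<le> real n \<and> t > real n")
  case True
  then have "1 \<le> t / real n" using assms by simp
  then show ?thesis using True by (auto simp: sv_exponent_def)
qed (use assms in \<open>auto simp: sv_exponent_def divide_right_mono max_def min_def\<close>)

lemma sum_sv_exponent:
  assumes n: "1 \<le> n" and s: "0 \<le> s"
  shows "(\<Sum>j=1..n. sv_exponent n s j) = s"
proof (cases "s \<le> real n")
  case True
  \<comment> \<open>The exponents fill up one unit at a time; allowing every k makes the induction
    work.\<close>
  have "(\<Sum>j=1..k. max 0 (min 1 (s - real j + 1))) = min s (real k)" for k
    using s by (induction k) auto
  then show ?thesis using True by (simp add: sv_exponent_def)
qed (use n in \<open>simp add: sv_exponent_def\<close>)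

text \<open>One product formula replaces the three cases of the definition. Since the exponents are
  monotone in s and add up to s, the analysis of phi^s becomes a weighted sum of the logarithms of
  the singular values.\<close>

lemma sv_function_eq_prod:
  fixes T :: "real^'n \<Rightarrow> real^'n"
  assumes T: "linear T" "bij T" and s: "0 \<le> s"
  shows "sv_function s T = (\<Prod>j=1..CARD('n). singular_value T j powr sv_exponent CARD('n) s j)"
proof -
  let ?N = "CARD('n)"
  note pos = singular_value_pos[OF T]
  consider "s = 0" | "0 < s" "s \<le> real ?N" | "s > real ?N" using s by linarith
  then show ?thesis
  proof cases
    case 1
    have "singular_value T j powr sv_exponent ?N s j = 1" if "j \<in> {1..?N}" for j
      using pos[OF that] that 1 by (simp add: sv_exponent_def)
    then show ?thesis using 1 by (simp add: sv_function_def)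
  next
    case 2
    define l where "l = nat \<lceil>s\<rceil>"
    have l: "real l - 1 < s" "s \<le> real l" "1 \<le> l" "l \<le> ?N"
      using 2 unfolding l_def by linarith+
    have e: "sv_exponent ?N s j = (if j < l then 1 else if j = l then s - real l + 1 else 0)" if "j \<ge> 1" for j
    proof -
      consider "real j \<le> real l - 1" | "j = l" | "real j \<ge> real l + 1" by linarith
      then show ?thesis using 2 l by cases (auto simp: sv_exponent_def)
    qed
    have split: "{1..?N} = {1..l-1} \<union> {l} \<union> {l<..?N}"
      using l by auto
    have "(\<Prod>j=1..?N. singular_value T j powr sv_exponent ?N s j)
        = (\<Prod>j=1..l-1. singular_value T j powr sv_exponent ?N s j) * 
          singular_value T l powr sv_exponent ?N s l * (\<Prod>j\<in>{l<..?N}. singular_value T j powr sv_exponent ?N s j)"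
      unfolding split using l(3) by (subst prod.union_disjoint; (subst prod.union_disjoint)?) auto
    also have "(\<Prod>j\<in>{l<..?N}. singular_value T j powr sv_exponent ?N s j) = 1"
    proof (intro prod.neutral ballI)
      fix j assume "j \<in> {l<..?N}"
      then show "singular_value T j powr sv_exponent ?N s j = 1"
        using pos[of j] e[of j] by auto
    qed
    also have "(\<Prod>j=1..l-1. singular_value T j powr sv_exponent ?N s j) = (\<Prod>j=1..l-1. singular_value T j)"
    proof (intro prod.cong refl)
      fix j assume "j \<in> {1..l-1}"
      then show "singular_value T j powr sv_exponent ?N s j = singular_value T j"
        using pos[of j] e[of j] l by auto
    qed
    finally show ?thesis
      using 2 e[of l] l(3) by (simp add: sv_function_def Let_def l_def[symmetric])
  next
    case 3
    have "(\<Prod>j=1..?N. singular_value T j) powr (s / real ?N) = (\<Prod>j=1..?N. singular_value T j powr (s / real ?N))"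
      by (rule prod_powr_distrib)
    moreover have "\<not> s \<le> 0" using 3 by (smt (verit) of_nat_0_le_iff)
    ultimately show ?thesis using 3 by (simp add: sv_function_def sv_exponent_def)
  qed
qed

lemma sv_function_pos:
  fixes T :: "real^'n \<Rightarrow> real^'n"
  assumes T: "linear T" "bij T" and s: "0 \<le> s"
  shows "0 < sv_function s T"
  unfolding sv_function_eq_prod[OF T s] using singular_value_pos[OF T] by (intro prod_pos) force

lemma ln_sv_function:
  fixes T :: "real^'n \<Rightarrow> real^'n"
  assumes T: "linear T" "bij T" and s: "0 \<le> s"
  shows "ln (sv_function s T) = (\<Sum>j=1..CARD('n). sv_exponent CARD('n) s j * ln (singular_value T j))"
  unfolding sv_function_eq_prod[OF T s]
  by (subst ln_prod) (use singular_value_pos[OF T] in \<open>force simp: ln_powr\<close>)+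

text \<open>The increments of the exponents are nonnegative weights of total mass t - s, and every
  singular value lies between a and b.\<close>

lemma ln_sv_function_increment:
  fixes T :: "real^'n \<Rightarrow> real^'n"
  assumes T: "linear T" "bij T" and s: "0 \<le> s" "s \<le> t" and a: "0 < a" "\<And>x. a * norm x \<le> norm (T x)"
    and b: "\<And>x. norm (T x) \<le> b * norm x"
  shows "(t - s) * ln a \<le> ln (sv_function t T) - ln (sv_function s T)"
    and "ln (sv_function t T) - ln (sv_function s T) \<le> (t - s) * ln b"
proof -
  let ?N = "CARD('n)"
  have N: "1 \<le> ?N" by (simp add: Suc_leI)
  define d where "d j = sv_exponent ?N t j - sv_exponent ?N s j" for j
  have d: "0 \<le> d j" for j
    using sv_exponent_mono[OF N s(2), of j] by (simp add: d_def)
  have sd: "(\<Sum>j=1..?N. d j) = t - s"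
    using sum_sv_exponent[OF N] s unfolding d_def sum_subtractf by simp
  have eq: "ln (sv_function t T) - ln (sv_function s T) = (\<Sum>j=1..?N. d j * ln (singular_value T j))"
    using s by (simp add: ln_sv_function[OF T] d_def left_diff_distrib sum_subtractf)
  have a': "ln a \<le> ln (singular_value T j)" if "j \<in> {1..?N}" for j
    using singular_value_bounds(1)[OF T(1) that a(2)] a(1) singular_value_pos[OF T that] by simp
  have b': "ln (singular_value T j) \<le> ln b" if "j \<in> {1..?N}" for j
    using singular_value_bounds(2)[OF T(1) that b] singular_value_pos[OF T that] by simp
  have "(\<Sum>j=1..?N. d j * ln a) \<le> (\<Sum>j=1..?N. d j * ln (singular_value T j))"
    using a' d by (intro sum_mono mult_left_mono) auto
  then show "(t - s) * ln a \<le> ln (sv_function t T) - ln (sv_function s T)"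
    unfolding eq sum_distrib_right[symmetric] sd .
  have "(\<Sum>j=1..?N. d j * ln (singular_value T j)) \<le> (\<Sum>j=1..?N. d j * ln b)"
    using b' d by (intro sum_mono mult_left_mono) auto
  then show "ln (sv_function t T) - ln (sv_function s T) \<le> (t - s) * ln b"
    unfolding eq sum_distrib_right[symmetric] sd .
qed

lemma sv_prod_pos:
  fixes T :: "real^'n \<Rightarrow> real^'n"
  assumes T: "linear T" "bij T" 
  shows "0 < sv_prod T r"
  unfolding sv_prod_def using singular_value_pos[OF T] by (intro prod_pos) (auto simp: less_max_iff_disj)

text \<open>Each factor on the left is a weighted geometric mean of alpha_j and r, hence at most
  their maximum. At the critical radius this is an equality: weight 1 occurs where alpha_j \<ge> r,
  weight 0 where alpha_j \<le> r, and the only fractional weight belongs to alpha_j = r.\<close>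

lemma sv_function_le_sv_prod:
  fixes T :: "real^'n \<Rightarrow> real^'n"
  assumes T: "linear T" "bij T" and s: "0 \<le> s" "s \<le> real CARD('n)" and r: "0 < r"
  shows "sv_function s T * r powr (real CARD('n) - s) \<le> sv_prod T r"
    and "s > 0 \<Longrightarrow> r = singular_value T (nat \<lceil>s\<rceil>) \<Longrightarrow> sv_prod T r = sv_function s T * r powr (real CARD('n) - s)"
proof -
  let ?N = "CARD('n)"
  have N: "1 \<le> ?N" by (simp add: Suc_leI)
  let ?e = "sv_exponent ?N s"
  have e01: "0 \<le> ?e j" "?e j \<le> 1" for j
    using s by (auto simp: sv_exponent_def)
  have "r powr (real ?N - s) = r powr (\<Sum>j=1..?N. 1 - ?e j)"
    using sum_sv_exponent[OF N s(1)] by (simp only: sum_subtractf) simp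
  also have "\<dots> = (\<Prod>j=1..?N. r powr (1 - ?e j))"
    using r by (intro powr_sum) auto
  finally have eq: "sv_function s T * r powr (real ?N - s)
      = (\<Prod>j=1..?N. singular_value T j powr ?e j * r powr (1 - ?e j))"
    by (simp add: sv_function_eq_prod[OF T s(1)] prod.distrib)
  show "sv_function s T * r powr (real ?N - s) \<le> sv_prod T r"
    unfolding eq sv_prod_def
  proof (intro prod_mono conjI)
    fix j assume "j \<in> {1..?N}"
    then have p: "0 < singular_value T j" by (rule singular_value_pos[OF T])
    let ?m = "max (singular_value T j) r"
    have "singular_value T j powr ?e j * r powr (1 - ?e j) \<le> ?m powr ?e j * ?m powr (1 - ?e j)"
      using p r e01[of j] by (intro mult_mono powr_mono2) auto
    also have "\<dots> = ?m" using r by (simp flip: powr_add)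
    finally show "singular_value T j powr ?e j * r powr (1 - ?e j) \<le> ?m" .
  qed (use r in simp)
  show "sv_prod T r = sv_function s T * r powr (real ?N - s)"
    if s0: "s > 0" and rl: "r = singular_value T (nat \<lceil>s\<rceil>)"
  proof -
    define l where "l = nat \<lceil>s\<rceil>"
    have l: "real l - 1 < s" "s \<le> real l" "1 \<le> l" "l \<le> ?N"
      using s0 s unfolding l_def by linarith+
    show ?thesis
      unfolding eq sv_prod_def
    proof (intro prod.cong refl)
      fix j assume j: "j \<in> {1..?N}"
      then have p: "0 < singular_value T j" by (rule singular_value_pos[OF T])
      consider "real j \<le> real l - 1" | "j = l" | "real j \<ge> real l + 1" by linarith
      then show "max (singular_value T j) r = singular_value T j powr ?e j * r powr (1 - ?e j)"
      proof cases
        case 1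
        then have "r \<le> singular_value T j"
          unfolding rl l_def[symmetric] using j l by (intro singular_value_antimono[OF T(1)]) auto
        moreover have "?e j = 1" using 1 l s by (auto simp: sv_exponent_def)
        ultimately show ?thesis using p r by simp
      next
        case 2
        then have "r = singular_value T j" using rl by (simp add: l_def)
        then show ?thesis using r by (simp flip: powr_add)
      next
        case 3
        then have "singular_value T j \<le> r"
          unfolding rl l_def[symmetric] using j l by (intro singular_value_antimono[OF T(1)]) auto
        moreover have "?e j = 0" using 3 l s by (auto simp: sv_exponent_def)
        ultimately show ?thesis using p r by simp
      qed
    qed
  qed
qed

text \<open>For R \<ge> 1 each min R (r / alpha_j) is at most R r / max(alpha_j, r), which turns the
  volume of the box into r^N divided by \<open>sv_prod T r\<close>. The lower bound of the latter by
  phi^s is valid at every radius, critical or not.\<close>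

lemma emeasure_slab_le_sv_function:
  fixes T :: "real^'n \<Rightarrow> real^'n"
  assumes T: "linear T" "bij T" and s: "0 \<le> s" "s \<le> real CARD('n)" and R: "1 \<le> R" and r: "0 < r"
  shows "emeasure lborel {v. norm v \<le> R \<and> norm (T v + y) \<le> r}
    \<le> ennreal ((2 * R) ^ CARD('n) * r powr s / sv_function s T)"
proof -
  let ?N = "CARD('n)"
  have "(\<Prod>j=1..?N. 2 * min R (r / singular_value T j)) 
      \<le> (\<Prod>j=1..?N. 2 * R * r / max (singular_value T j) r)"
  proof (intro prod_mono conjI)
    fix j assume "j \<in> {1..?N}"
    then have p: "0 < singular_value T j" by (rule singular_value_pos[OF T])
    show "0 \<le> 2 * min R (r / singular_value T j)" using p r R by simp
    have "r / singular_value T j \<le> R * r / singular_value T j"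
      using p r R by (intro divide_right_mono) auto
    then show "2 * min R (r / singular_value T j) \<le> 2 * R * r / max (singular_value T j) r"
      using p r R by (auto simp: max_def min_def)
  qed
  also have "\<dots> = (2 * R) ^ ?N * (r ^ ?N / sv_prod T r)"
    by (simp add: sv_prod_def prod_dividef power_mult_distrib)
  also have "r ^ ?N / sv_prod T r \<le> r ^ ?N / (sv_function s T * r powr (real ?N - s))"
    using sv_function_le_sv_prod(1)[OF T s r] sv_function_pos[OF T s(1)] r
    by (intro divide_left_mono) (auto simp: sv_prod_pos[OF T])
  also have "\<dots> = r powr s / sv_function s T"
    using r by (simp add: powr_diff powr_realpow)
  finally show ?thesis
    using measure_slab_le[OF T, of R r y] R r
    by (intro order_trans[OF measure_slab_le[OF T] ennreal_leI]) (auto simp: mult_left_mono)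
qed

subsection \<open>Counting mesh cubes\<close>

lemma mesh_cube_measurable [measurable]: "mesh_cube r j \<in> sets borel"
  unfolding mesh_cube_def by measurable

lemma mesh_cube_iff:
  assumes "r > 0" shows "x \<in> mesh_cube r j \<longleftrightarrow> j = (\<chi> i. \<lfloor>x $ i / r\<rfloor>)"
  using assms by (auto simp: mesh_cube_def vec_eq_iff floor_eq_iff field_simps eq_commute[of _ "\<lfloor>_\<rfloor>"])

lemma measure_mesh_cube_ge:
  fixes j :: "int^'n"
  assumes "r > 0" shows "r ^ CARD('n) \<le> measure lborel (mesh_cube r j)"
    "mesh_cube r j \<in> fmeasurable lborel"
proof -
  define a b :: "real^'n" where "a = (\<chi> i. of_int (j $ i) * r)" and "b = (\<chi> i. (of_int (j $ i) + 1) * r)"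
  have sub: "box a b \<subseteq> mesh_cube r j" "mesh_cube r j \<subseteq> cbox a b"
    by (auto simp: mesh_cube_def a_def b_def mem_box_cart less_imp_le)
  show fm: "mesh_cube r j \<in> fmeasurable lborel"
    by (rule fmeasurableI2[OF fmeasurable_cbox sub(2)]) simp
  have ne: "cbox a b \<noteq> {}"
  proof -
    have "a \<in> cbox a b"
      using assms by (auto simp: a_def b_def mem_box_cart algebra_simps)
    then show ?thesis by blast
  qed
  have "measure lborel (box a b) = measure lborel (cbox a b)"
    by (simp add: measure_lborel_box_eq measure_lborel_cbox_eq)
  also have "\<dots> = r ^ CARD('n)"
    by (subst content_cbox_cart[OF ne]) (simp add: a_def b_def algebra_simps)
  finally show "r ^ CARD('n) \<le> measure lborel (mesh_cube r j)"
    using measure_mono_fmeasurable[OF sub(1) _ fm] by simp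
qed

lemma mesh_cube_diameter:
  fixes x y :: "real^'n"
  assumes "r > 0" "x \<in> mesh_cube r j" "y \<in> mesh_cube r j"
  shows "norm (x - y) \<le> real CARD('n) * r"
proof -
  have "norm (x - y) \<le> (\<Sum>i\<in>UNIV. \<bar>(x - y) $ i\<bar>)" by (rule norm_le_l1_cart)
  also have "\<dots> \<le> (\<Sum>i\<in>(UNIV::'n set). r)"
  proof (rule sum_mono)
    fix i
    have "of_int (j $ i) * r \<le> x $ i" "x $ i < (of_int (j $ i) + 1) * r"
      "of_int (j $ i) * r \<le> y $ i" "y $ i < (of_int (j $ i) + 1) * r"
      using assms by (auto simp: mesh_cube_def)
    then show "\<bar>(x - y) $ i\<bar> \<le> r"
      by (simp add: algebra_simps abs_le_iff)
  qed
  finally show ?thesis by simp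
qed

text \<open>The cubes that meet S are disjoint, have volume at least r^N and lie in V. Finite
  subfamilies are treated first, since the finiteness of the whole family is a consequence of the
  bound.\<close>

lemma card_mesh_cubes_le:
  fixes S V :: "(real^'n) set"
  assumes r: "r > 0" and V: "V \<in> fmeasurable lborel"
    and sub: "\<And>x y. x \<in> S \<Longrightarrow> norm (y - x) \<le> real CARD('n) * r \<Longrightarrow> y \<in> V"
  shows "finite {j. mesh_cube r j \<inter> S \<noteq> {}}"
    and "real (card {j. mesh_cube r j \<inter> S \<noteq> {}}) * r ^ CARD('n) \<le> measure lborel V"
proof -
  let ?J = "{j. mesh_cube r j \<inter> S \<noteq> {}}"
  let ?N = "CARD('n)"
  have bound: "real (card G) * r ^ ?N \<le> measure lborel V" if G: "G \<subseteq> ?J" "finite G" for G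
  proof -
    have inV: "mesh_cube r j \<subseteq> V" if j: "j \<in> G" for j
    proof
      fix y assume y: "y \<in> mesh_cube r j"
      from j G obtain x where x: "x \<in> mesh_cube r j" "x \<in> S" by blast
      show "y \<in> V" using sub[OF x(2) mesh_cube_diameter[OF r y x(1)]] .
    qed
    have "real (card G) * r ^ ?N = (\<Sum>j\<in>G. r ^ ?N)" by simp
    also have "\<dots> \<le> (\<Sum>j\<in>G. measure lborel (mesh_cube r j))"
      by (intro sum_mono measure_mesh_cube_ge(1) r)
    also have "\<dots> = measure lborel (\<Union>j\<in>G. mesh_cube r j)"
    proof (rule measure_finite_Union[symmetric])
      show "disjoint_family_on (mesh_cube r) G"
      proof (unfold disjoint_family_on_def, intro ballI impI)
        fix i j :: "int^'n" assume "i \<noteq> j"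
        then show "mesh_cube r i \<inter> mesh_cube r j = {}"
          using mesh_cube_iff[OF r, of _ i] mesh_cube_iff[OF r, of _ j] by (metis disjoint_iff)
      qed
      show "emeasure lborel (mesh_cube r i) \<noteq> \<infinity>" for i
        using measure_mesh_cube_ge(2)[OF r, of i] by (auto simp: fmeasurable_def)
    qed (use G in auto)
    also have "\<dots> \<le> measure lborel V"
      using inV V G by (intro measure_mono_fmeasurable) auto
    finally show ?thesis .
  qed
  define C where "C = nat \<lceil>measure lborel V / r ^ ?N\<rceil>"
  have "card G \<le> C" if "G \<subseteq> ?J" "finite G" for G
  proof -
    have "real (card G) \<le> measure lborel V / r ^ ?N"
      using bound[OF that] r by (simp add: field_simps)
    then show ?thesis unfolding C_def by linarith
  qed
  then show fin: "finite ?J" using finite_if_finite_subsets_card_bdd[of ?J C] by blast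
  show "real (card ?J) * r ^ ?N \<le> measure lborel V" by (rule bound[OF order_refl fin])
qed


lemma card_mesh_cubes_ball_image_le:
  fixes T :: "real^'n \<Rightarrow> real^'n"
  assumes T: "linear T" "bij T" and r: "r > 0" and a: "0 \<le> a"
  shows "finite {j. mesh_cube r j \<inter> (\<lambda>x. T x + c) ` cball 0 a \<noteq> {}}"
    and "real (card {j. mesh_cube r j \<inter> (\<lambda>x. T x + c) ` cball 0 a \<noteq> {}}) * r ^ CARD('n)
      \<le> (2 * (a + real CARD('n))) ^ CARD('n) * sv_prod T r"
proof -
  let ?N = "CARD('n)"
  define V where "V = (\<lambda>y. c + y) ` ball_image T a (real ?N * r)"
  have "compact V"
    unfolding V_def by (rule compact_translation[OF compact_ball_image[OF T(1)]])
  then have V: "V \<in> fmeasurable lborel" by (rule fmeasurable_compact)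
  have mV: "measure lborel V = measure lborel (ball_image T a (real ?N * r))"
  proof -
    have "measure lborel V = measure lebesgue V"
      by (simp add: borel_compact \<open>compact V\<close>)
    also have "\<dots> = measure lebesgue (ball_image T a (real ?N * r))"
      unfolding V_def by (rule measure_translation)
    also have "\<dots> = measure lborel (ball_image T a (real ?N * r))"
      by (simp add: borel_compact compact_ball_image[OF T(1)])
    finally show ?thesis .
  qed
  have sub: "y \<in> V" if x: "x \<in> (\<lambda>x. T x + c) ` cball 0 a" and y: "norm (y - x) \<le> real ?N * r" for x y
  proof -
    from x obtain u where u: "x = T u + c" "norm u \<le> a" by auto
    have "T u + (y - x) \<in> ball_image T a (real ?N * r)"
      using u(2) y unfolding ball_image_def by blast
    moreover have "y = c + (T u + (y - x))" using u by simp
    ultimately show ?thesis unfolding V_def by blast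
  qed
  show "finite {j. mesh_cube r j \<inter> (\<lambda>x. T x + c) ` cball 0 a \<noteq> {}}"
    by (rule card_mesh_cubes_le(1)[OF r V sub])
  have "real (card {j. mesh_cube r j \<inter> (\<lambda>x. T x + c) ` cball 0 a \<noteq> {}}) * r ^ ?N \<le> measure lborel V"
    by (rule card_mesh_cubes_le(2)[OF r V sub])
  also have "\<dots> \<le> (\<Prod>j=1..?N. 2 * (a * singular_value T j + real ?N * r))"
    unfolding mV using r a by (intro measure_ball_image_le T) auto
  also have "\<dots> \<le> (\<Prod>j=1..?N. 2 * (a + real ?N) * max (singular_value T j) r)"
  proof (intro prod_mono conjI)
    fix j assume "j \<in> {1..?N}"
    then have p: "0 < singular_value T j" by (rule singular_value_pos[OF T])
    show "0 \<le> 2 * (a * singular_value T j + real ?N * r)" using p r a by simp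
    define M where "M = max (singular_value T j) r"
    have "singular_value T j \<le> M" "r \<le> M" by (auto simp: M_def)
    then have "2 * (a * singular_value T j + real ?N * r) \<le> 2 * (a * M + real ?N * M)"
      using a by (intro mult_left_mono add_mono) auto
    also have "\<dots> = 2 * (a + real ?N) * M" by (simp add: algebra_simps)
    finally have "2 * (a * singular_value T j + real ?N * r) \<le> 2 * (a + real ?N) * M" .
    then show "2 * (a * singular_value T j + real ?N * r) \<le> 2 * (a + real ?N) * max (singular_value T j) r"
      by (simp only: M_def)
  qed
  also have "\<dots> = (2 * (a + real ?N)) ^ ?N * sv_prod T r"
    by (simp only: sv_prod_def prod.distrib prod_constant card_atLeastAtMost diff_Suc_1
        power_mult_distrib mult.assoc)
  finally show "real (card {j. mesh_cube r j \<inter> (\<lambda>x. T x + c) ` cball 0 a \<noteq> {}}) * r ^ ?N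
      \<le> (2 * (a + real ?N)) ^ ?N * sv_prod T r" .
qed

subsection \<open>Submultiplicativity up to a constant\<close>

text \<open>The product of the losses in the comparison of volumes below: the first power inverts
  the lower bound for a thickened ellipsoid, one of the other two comes from counting cubes and the
  other from the volume of the image of a cube.\<close>

definition sv_const :: "nat \<Rightarrow> real" where
  "sv_const n = (real n / 2) ^ n * ((2 * (1 + real n)) ^ n * (2 * (1 + real n)) ^ n)"

lemma sv_const_ge_1: "n \<ge> 1 \<Longrightarrow> 1 \<le> sv_const n"
proof -
  assume n: "n \<ge> 1"
  have "1 \<le> real n / 2 * (2 * (1 + real n)) * (2 * (1 + real n))"
  proof -
    have "1 * 1 \<le> real n * (1 + real n)" using n by (intro mult_mono) auto
    then have "1 * 1 \<le> (real n * (1 + real n)) * (2 * (1 + real n))" by (intro mult_mono) auto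
    also have "\<dots> = real n / 2 * (2 * (1 + real n)) * (2 * (1 + real n))"
      by (simp add: algebra_simps)
    finally show ?thesis by simp
  qed
  then have "1 \<le> (real n / 2 * (2 * (1 + real n)) * (2 * (1 + real n))) ^ n"
    by (rule one_le_power)
  then show ?thesis by (simp only: sv_const_def power_mult_distrib mult.assoc)
qed

text \<open>Cover the image of the unit ball under \<open>B\<close> by cubes of side \<open>r\<close>, apply \<open>A\<close> to each of them and
  compare volumes. With \<open>r\<close> and \<open>r'\<close> the critical singular values, this is the submultiplicativity
  of \<open>\<phi>\<^sup>s\<close> up to a constant, without exterior powers.\<close>

lemma sv_prod_comp_le:
  fixes A B :: "real^'n \<Rightarrow> real^'n"
  assumes A: "linear A" "bij A" and B: "linear B" "bij B" and r: "r > 0" and r': "r' > 0"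
  shows "sv_prod (A \<circ> B) (r * r') \<le> sv_const CARD('n) * (sv_prod A r' * sv_prod B r)"
proof -
  let ?N = "CARD('n)"
  have AB: "linear (A \<circ> B)" "bij (A \<circ> B)"
    using linear_compose[OF B(1) A(1)] bij_comp[OF B(2) A(2)] by auto
  let ?J = "{j. mesh_cube r j \<inter> (\<lambda>x. B x + 0) ` cball 0 1 \<noteq> {}}"
  have fin: "finite ?J" by (rule card_mesh_cubes_ball_image_le(1)[OF B r]) simp
  have card: "real (card ?J) * r ^ ?N \<le> (2 * (1 + real ?N)) ^ ?N * sv_prod B r"
    by (rule card_mesh_cubes_ball_image_le(2)[OF B r]) simp
  \<comment> \<open>A cube of side r has diameter at most N r, so its image under A, thickened by r
    r', lies in a translate of K.\<close>
  define K where "K = ball_image A (real ?N * r) (r * r')"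
  have "\<exists>c. c \<in> mesh_cube r j \<inter> (\<lambda>x. B x + 0) ` cball 0 1" if "j \<in> ?J" for j
    using that by blast
  then obtain c where c: "\<And>j. j \<in> ?J \<Longrightarrow> c j \<in> mesh_cube r j \<inter> (\<lambda>x. B x + 0) ` cball 0 1"
    by metis
  have cK: "compact K" unfolding K_def by (rule compact_ball_image[OF A(1)])
  have cK': "compact ((+) (A (c j)) ` K)" for j
    by (rule compact_translation[OF cK])
  have mK: "measure lborel ((+) (A (c j)) ` K) = measure lborel K" for j
  proof -
    have "measure lborel ((+) (A (c j)) ` K) = measure lebesgue ((+) (A (c j)) ` K)"
      by (simp add: borel_compact cK')
    also have "\<dots> = measure lebesgue K" by (rule measure_translation)
    also have "\<dots> = measure lborel K" by (simp add: borel_compact cK)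
    finally show ?thesis .
  qed
  have "ball_image (A \<circ> B) 1 (r * r') \<subseteq> (\<Union>j\<in>?J. (+) (A (c j)) ` K)"
  proof
    fix y assume "y \<in> ball_image (A \<circ> B) 1 (r * r')"
    then obtain x z where y: "y = A (B x) + z" "norm x \<le> 1" "norm z \<le> r * r'"
      by (auto simp: ball_image_def)
    define j :: "int^'n" where "j = (\<chi> i. \<lfloor>B x $ i / r\<rfloor>)"
    have Bx: "B x \<in> mesh_cube r j" by (simp add: mesh_cube_iff[OF r] j_def)
    then have j: "j \<in> ?J" using y(2) by auto
    have "norm (B x - c j) \<le> real ?N * r"
      using mesh_cube_diameter[OF r Bx] c[OF j] by blast
    then have "A (B x - c j) + z \<in> K"
      using y(3) unfolding K_def ball_image_def by blast
    moreover have "y = A (c j) + (A (B x - c j) + z)"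
      using y(1) by (simp add: linear_diff[OF A(1)])
    ultimately show "y \<in> (\<Union>j\<in>?J. (+) (A (c j)) ` K)" using j by blast
  qed
  then have "measure lborel (ball_image (A \<circ> B) 1 (r * r')) \<le> measure lborel (\<Union>j\<in>?J. (+) (A (c j)) ` K)"
    using fin compact_ball_image[OF AB(1)] cK'
    by (intro measure_mono_fmeasurable fmeasurable_compact compact_UN) (auto simp: borel_compact)
  also have "\<dots> \<le> (\<Sum>j\<in>?J. measure lborel ((+) (A (c j)) ` K))"
  proof (rule measure_subadditive_finite[OF fin])
    show "(\<lambda>j. (+) (A (c j)) ` K) ` ?J \<subseteq> sets lborel" using cK' by (auto simp: borel_compact)
    show "emeasure lborel ((+) (A (c i)) ` K) \<noteq> \<infinity>" for i
      using emeasure_compact_finite[OF cK'] by (simp add: less_top)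
  qed
  also have "\<dots> = real (card ?J) * measure lborel K" by (simp add: mK)
  finally have 1: "measure lborel (ball_image (A \<circ> B) 1 (r * r')) \<le> real (card ?J) * measure lborel K" .
  have "measure lborel K \<le> (\<Prod>j=1..?N. 2 * (real ?N * r * singular_value A j + r * r'))"
    unfolding K_def using r r' by (intro measure_ball_image_le A) auto
  also have "\<dots> \<le> (\<Prod>j=1..?N. r * (2 * (1 + real ?N) * max (singular_value A j) r'))"
  proof (intro prod_mono conjI)
    fix j assume "j \<in> {1..?N}"
    then have p: "0 < singular_value A j" by (rule singular_value_pos[OF A])
    show "0 \<le> 2 * (real ?N * r * singular_value A j + r * r')" using p r r' by simp
    define M where "M = max (singular_value A j) r'"
    have "singular_value A j \<le> M" "r' \<le> M" by (auto simp: M_def)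
    then have "real ?N * singular_value A j + r' \<le> real ?N * M + M"
      by (intro mult_left_mono add_mono) auto
    also have "\<dots> = (1 + real ?N) * M" by (simp add: algebra_simps)
    finally have "real ?N * singular_value A j + r' \<le> (1 + real ?N) * M" .
    then have "real ?N * singular_value A j + r' \<le> (1 + real ?N) * max (singular_value A j) r'"
      by (simp only: M_def)
    then have "2 * r * (real ?N * singular_value A j + r') \<le> 2 * r * ((1 + real ?N) * max (singular_value A j) r')"
      using r by (intro mult_left_mono) auto
    then show "2 * (real ?N * r * singular_value A j + r * r') \<le> r * (2 * (1 + real ?N) * max (singular_value A j) r')"
      by (simp add: algebra_simps)
  qed
  also have "\<dots> = r ^ ?N * ((2 * (1 + real ?N)) ^ ?N * sv_prod A r')"
    by (simp only: sv_prod_def prod.distrib prod_constant card_atLeastAtMost diff_Suc_1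
        power_mult_distrib mult.assoc)
  finally have 2: "measure lborel K \<le> r ^ ?N * ((2 * (1 + real ?N)) ^ ?N * sv_prod A r')" .
  have "measure lborel (ball_image (A \<circ> B) 1 (r * r'))
      \<le> (real (card ?J) * r ^ ?N) * ((2 * (1 + real ?N)) ^ ?N * sv_prod A r')"
    using order_trans[OF 1 mult_left_mono[OF 2]] by (simp only: mult.assoc of_nat_0_le_iff)
  also have "\<dots> \<le> ((2 * (1 + real ?N)) ^ ?N * sv_prod B r) * ((2 * (1 + real ?N)) ^ ?N * sv_prod A r')"
    by (rule mult_right_mono[OF card]) (simp add: sv_prod_pos[OF A] less_imp_le)
  finally have "(2 / real ?N) ^ ?N * sv_prod (A \<circ> B) (r * r')
      \<le> ((2 * (1 + real ?N)) ^ ?N * sv_prod B r) * ((2 * (1 + real ?N)) ^ ?N * sv_prod A r')"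
    using measure_ball_image_ge[OF AB, of "r * r'"] r r' by simp
  then have "(real ?N / 2) ^ ?N * ((2 / real ?N) ^ ?N * sv_prod (A \<circ> B) (r * r'))
      \<le> (real ?N / 2) ^ ?N * (((2 * (1 + real ?N)) ^ ?N * sv_prod B r) * ((2 * (1 + real ?N)) ^ ?N * sv_prod A r'))"
    by (rule mult_left_mono) simp
  moreover have "(real ?N / 2) ^ ?N * (2 / real ?N) ^ ?N = 1"
    by (subst power_mult_distrib[symmetric]) simp
  then have "(real ?N / 2) ^ ?N * ((2 / real ?N) ^ ?N * x) = x" for x
    by (simp only: mult.assoc[symmetric] mult_1)
  ultimately have "sv_prod (A \<circ> B) (r * r') \<le> (real ?N / 2) ^ ?N *
      (((2 * (1 + real ?N)) ^ ?N * sv_prod B r) * ((2 * (1 + real ?N)) ^ ?N * sv_prod A r'))"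
    by (simp only:)
  also have "\<dots> = sv_const ?N * (sv_prod A r' * sv_prod B r)"
    by (simp only: sv_const_def mult_ac)
  finally show ?thesis .
qed

text \<open>Equality between \<open>sv_prod\<close> and phi^s is used on the right only, where both
  radii are critical. On the left the radius r r' need not be critical for the composition, but the
  inequality there holds for all radii, and the powers of r r' cancel.\<close>

lemma sv_function_comp_le_small:
  fixes A B :: "real^'n \<Rightarrow> real^'n"
  assumes A: "linear A" "bij A" and B: "linear B" "bij B" and s: "0 < s" "s \<le> real CARD('n)"
  shows "sv_function s (A \<circ> B) \<le> sv_const CARD('n) * (sv_function s A * sv_function s B)"
proof -
  let ?N = "real CARD('n)"
  have AB: "linear (A \<circ> B)" "bij (A \<circ> B)"
    using linear_compose[OF B(1) A(1)] bij_comp[OF B(2) A(2)] by auto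
  define l where "l = nat \<lceil>s\<rceil>"
  have l: "l \<in> {1..CARD('n)}"
    using s unfolding l_def by (auto simp: le_nat_iff ceiling_le_iff nat_le_iff)
  define r r' where "r = singular_value B l" and "r' = singular_value A l"
  have r: "0 < r" and r': "0 < r'"
    unfolding r_def r'_def using singular_value_pos[OF A l] singular_value_pos[OF B l] by auto
  have s0: "0 \<le> s" using s by simp
  have "sv_function s (A \<circ> B) * (r * r') powr (?N - s) \<le> sv_prod (A \<circ> B) (r * r')"
    using r r' s by (intro sv_function_le_sv_prod AB) auto
  also have "\<dots> \<le> sv_const CARD('n) * (sv_prod A r' * sv_prod B r)"
    by (rule sv_prod_comp_le[OF A B r r'])
  also have "sv_prod A r' = sv_function s A * r' powr (?N - s)"
    by (rule sv_function_le_sv_prod(2)[OF A s0 s(2) r' s(1)]) (simp add: r'_def l_def)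
  also have "sv_prod B r = sv_function s B * r powr (?N - s)"
    by (rule sv_function_le_sv_prod(2)[OF B s0 s(2) r s(1)]) (simp add: r_def l_def)
  finally have "sv_function s (A \<circ> B) * (r * r') powr (?N - s)
     \<le> (sv_const CARD('n) * (sv_function s A * sv_function s B)) * (r * r') powr (?N - s)"
    using r r' by (simp only: powr_mult mult_ac)
  then show ?thesis
    by (rule mult_right_le_imp_le) (use r r' in simp)
qed

lemma ln_sv_function_comp_le:
  fixes A B :: "real^'n \<Rightarrow> real^'n"
  assumes A: "linear A" "bij A" and B: "linear B" "bij B" and s: "0 \<le> s"
  shows "ln (sv_function s (A \<circ> B))
    \<le> ln (sv_function s A) + ln (sv_function s B) + (1 + s) * ln (sv_const CARD('n))"
proof -
  let ?N = "CARD('n)"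
  have N: "1 \<le> ?N" by (simp add: Suc_leI)
  have C: "1 \<le> sv_const ?N" by (rule sv_const_ge_1[OF N])
  have AB: "linear (A \<circ> B)" "bij (A \<circ> B)"
    using linear_compose[OF B(1) A(1)] bij_comp[OF B(2) A(2)] by auto
  have small: "ln (sv_function t (A \<circ> B)) \<le> ln (sv_function t A) + ln (sv_function t B) + ln (sv_const ?N)"
    if t: "0 < t" "t \<le> real ?N" for t
  proof -
    have p: "0 < sv_function t A" "0 < sv_function t B" "0 < sv_function t (A \<circ> B)"
      using sv_function_pos[OF A] sv_function_pos[OF B] sv_function_pos[OF AB] t by auto
    have "ln (sv_function t (A \<circ> B)) \<le> ln (sv_const ?N * (sv_function t A * sv_function t B))"
      using sv_function_comp_le_small[OF A B t] p by simp
    also have "\<dots> = ln (sv_function t A) + ln (sv_function t B) + ln (sv_const ?N)"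
      using p C by (simp add: ln_mult)
    finally show ?thesis .
  qed
  consider "s = 0" | "0 < s" "s \<le> real ?N" | "s > real ?N" using s by linarith
  then show ?thesis
  proof cases
    case 1
    then show ?thesis using C by (simp add: sv_function_def)
  next
    case 2
    have "ln (sv_const ?N) \<le> (1 + s) * ln (sv_const ?N)"
      using C s by (simp add: mult_le_cancel_right1)
    then show ?thesis using small[OF 2] by linarith
  next
    case 3
    \<comment> \<open>Above N, phi^s is the power s / N of phi^N, so the constant is raised to the
      power q \<le> s. The factor 1 + s in the statement covers all cases.\<close>
    define q where "q = s / real ?N"
    have q: "0 \<le> q" "q \<le> s" using 3 N s by (auto simp: q_def field_simps mult_le_cancel_left1)
    have eq: "ln (sv_function s T) = q * ln (sv_function (real ?N) T)" if T: "linear T" "bij T" for T :: "real^'n \<Rightarrow> real^'n"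
    proof -
      have "sv_exponent ?N s j = q * sv_exponent ?N (real ?N) j" if "j \<in> {1..?N}" for j
        using that 3 by (simp add: sv_exponent_def q_def)
      then show ?thesis
        by (simp add: ln_sv_function[OF T] s sum_distrib_left mult.assoc)
    qed
    have "q * ln (sv_function (real ?N) (A \<circ> B))
        \<le> q * (ln (sv_function (real ?N) A) + ln (sv_function (real ?N) B) + ln (sv_const ?N))"
      using N by (intro mult_left_mono small q) auto
    moreover have "q * ln (sv_const ?N) \<le> (1 + s) * ln (sv_const ?N)"
      using C q by (intro mult_right_mono) auto
    ultimately show ?thesis
      by (simp add: eq[OF A] eq[OF B] eq[OF AB] algebra_simps)
  qed
qed

text \<open>As functions of \<open>ln r\<close>, the logarithms of \<open>sv_prod A r\<close> and \<open>sv_prod (A \<circ> B) r\<close> are within a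
  constant of each other, while their slopes differ between the \<open>l\<close>-th singular values of \<open>A \<circ> B\<close>
  and of \<open>A\<close>. So these singular values are comparable.\<close>

lemma singular_value_comp_ge:
  fixes A B :: "real^'n \<Rightarrow> real^'n"
  assumes A: "linear A" "bij A" and B: "linear B" "bij B" and l: "l \<in> {1..CARD('n)}"
    and B1: "\<And>x. norm (B x) \<le> norm x" and a: "0 < a" "\<And>x. a * norm x \<le> norm (B x)"
  shows "a ^ CARD('n) / (sv_const CARD('n))\<^sup>2 * singular_value A l \<le> singular_value (A \<circ> B) l"
proof -
  let ?N = "CARD('n)"
  have N: "1 \<le> ?N" by (simp add: Suc_leI)
  define C where "C = sv_const ?N"
  have C: "1 \<le> C" unfolding C_def by (rule sv_const_ge_1[OF N])
  have AB: "linear (A \<circ> B)" "bij (A \<circ> B)"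
    using linear_compose[OF B(1) A(1)] bij_comp[OF B(2) A(2)] by auto
  have IB: "linear (inv B)" "bij (inv B)"
    using B bij_imp_bij_inv linear_inj_on_left_inverse by (auto simp: bij_def intro: inj_linear_imp_inv_linear)
  have a1: "a \<le> 1"
  proof -
    obtain b :: "real^'n" where "b \<in> Basis" using nonempty_Basis by blast
    then show ?thesis using a(2)[of b] B1[of b] by simp
  qed
  \<comment> \<open>B is a contraction, so all its singular values are at most 1 and
    \<open>sv_prod B 1\<close> equals 1.\<close>
  have up: "sv_prod (A \<circ> B) r \<le> C * sv_prod A r" if r: "r > 0" for r
  proof -
    have "sv_prod B 1 = 1"
      unfolding sv_prod_def using singular_value_bounds(2)[OF B(1), of _ 1] B1
      by (intro prod.neutral ballI) (simp add: max_absorb2)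
    then show ?thesis
      using sv_prod_comp_le[OF A B _ r, of 1] by (simp add: C_def)
  qed
  \<comment> \<open>The same inequality for A = (A B) B^-1: the singular values of B^-1 are at most
    1 / a, so at radius 1 / a its product is a^-N.\<close>
  have low: "sv_prod A r \<le> C / a ^ ?N * sv_prod (A \<circ> B) r" if r: "r > 0" for r
  proof -
    have "norm (inv B x) \<le> 1 / a * norm x" for x
      using a(2)[of "inv B x"] a(1) B(2) by (simp add: field_simps bij_inv_eq_iff bij_is_surj surj_f_inv_f)
    then have ib: "singular_value (inv B) j \<le> 1 / a" if "j \<in> {1..?N}" for j
      by (rule singular_value_bounds(2)[OF IB(1) that])
    have "sv_prod (inv B) (1 / a) = (\<Prod>j=1..?N. 1 / a)"
      unfolding sv_prod_def using ib by (intro prod.cong refl) (simp add: max_absorb2)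
    then have i: "sv_prod (inv B) (1 / a) = 1 / a ^ ?N" by (simp add: power_one_over)
    have "(A \<circ> B) \<circ> inv B = A"
      using B(2) by (simp add: fun_eq_iff surj_f_inv_f bij_is_surj)
    then have "sv_prod A r \<le> C * (sv_prod (A \<circ> B) (a * r) * (1 / a ^ ?N))"
      using sv_prod_comp_le[OF AB IB, of "1 / a" "a * r"] a(1) r i by (simp add: C_def)
    also have "sv_prod (A \<circ> B) (a * r) \<le> sv_prod (A \<circ> B) r"
      unfolding sv_prod_def
    proof (intro prod_mono conjI)
      fix j
      have "a * r \<le> r" using a1 r by simp
      then show "max (singular_value (A \<circ> B) j) (a * r) \<le> max (singular_value (A \<circ> B) j) r" by simp
      have "0 < a * r" using a r by simp
      then show "0 \<le> max (singular_value (A \<circ> B) j) (a * r)" by simp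
    qed
    finally show ?thesis using C a(1) by (simp add: divide_right_mono mult_left_mono)
  qed
  define S t where "S = singular_value A l" and "t = singular_value (A \<circ> B) l"
  have S: "S > 0" and t: "t > 0"
    unfolding S_def t_def using singular_value_pos[OF A l] singular_value_pos[OF AB l] by auto
  have aC: "a ^ ?N / C\<^sup>2 \<le> 1"
    using a a1 C by (simp add: power_le_one divide_le_eq) (smt (verit) power_le_one one_le_power)
  show ?thesis
  proof (cases "t < S")
    case False
    then have "a ^ ?N / C\<^sup>2 * S \<le> 1 * t" using aC S by (intro mult_mono) auto
    then show ?thesis by (simp add: C_def S_def t_def)
  next
    case True
    \<comment> \<open>When the radius grows from t to S, each of the k + 1 indices j \<ge> l
      contributes the full factor S / t to the product for A B, whereas for A only the k indices j >
      l can contribute, at most S / t each. The surplus factor S / t is therefore bounded by the two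
      comparison constants.\<close>
    define k where "k = ?N - l"
    have prods: "(\<Prod>j=1..?N. if P j then S / t else 1) = (S / t) ^ card {j\<in>{1..?N}. P j}" for P
      by (simp add: prod.If_cases Int_def)
    have "{j\<in>{1..?N}. l \<le> j} = {l..?N}" "{j\<in>{1..?N}. l < j} = {l<..?N}"
      using l by auto
    then have cards: "card {j\<in>{1..?N}. l \<le> j} = Suc k" "card {j\<in>{1..?N}. l < j} = k"
      using l by (auto simp: k_def)
    have "(S / t) ^ Suc k * sv_prod (A \<circ> B) t
        = (\<Prod>j=1..?N. (if l \<le> j then S / t else 1) * max (singular_value (A \<circ> B) j) t)"
      unfolding sv_prod_def prod.distrib prods cards ..
    also have "\<dots> \<le> sv_prod (A \<circ> B) S"
      unfolding sv_prod_def
    proof (intro prod_mono conjI)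
      fix j assume j: "j \<in> {1..?N}"
      have "l \<le> j \<Longrightarrow> singular_value (A \<circ> B) j \<le> t"
        unfolding t_def using j l by (intro singular_value_antimono AB) auto
      then show "(if l \<le> j then S / t else 1) * max (singular_value (A \<circ> B) j) t \<le> max (singular_value (A \<circ> B) j) S"
        using t True by (auto simp: max_def)
      show "0 \<le> (if l \<le> j then S / t else 1) * max (singular_value (A \<circ> B) j) t"
        using S t by (auto simp: less_max_iff_disj intro!: less_imp_le)
    qed
    also have "\<dots> \<le> C * sv_prod A S" by (rule up[OF S])
    finally have 1: "(S / t) ^ Suc k * sv_prod (A \<circ> B) t \<le> C * sv_prod A S" .
    have "sv_prod A S \<le> (\<Prod>j=1..?N. (if l < j then S / t else 1) * max (singular_value A j) t)"
      unfolding sv_prod_def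
    proof (intro prod_mono conjI)
      fix j assume j: "j \<in> {1..?N}"
      have "\<not> l < j \<Longrightarrow> S \<le> singular_value A j"
        unfolding S_def using j l by (intro singular_value_antimono A) auto
      moreover have "max x S \<le> S / t * max x t" if "0 < x" for x
        using t True S that by (auto simp: max_def field_simps mult_le_cancel_left)
      ultimately show "max (singular_value A j) S \<le> (if l < j then S / t else 1) * max (singular_value A j) t"
        using singular_value_pos[OF A j] by auto
    qed (use S in auto)
    also have "\<dots> = (S / t) ^ k * sv_prod A t"
      unfolding sv_prod_def prod.distrib prods cards ..
    also have "\<dots> \<le> (S / t) ^ k * (C / a ^ ?N * sv_prod (A \<circ> B) t)"
      using S t by (intro mult_left_mono low) auto
    finally have 2: "sv_prod A S \<le> (S / t) ^ k * (C / a ^ ?N * sv_prod (A \<circ> B) t)" .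
    have "(S / t) ^ Suc k * sv_prod (A \<circ> B) t \<le> C * ((S / t) ^ k * (C / a ^ ?N * sv_prod (A \<circ> B) t))"
      by (rule order_trans[OF 1 mult_left_mono[OF 2]]) (use C in simp)
    then have "(S / t) * ((S / t) ^ k * sv_prod (A \<circ> B) t) \<le> (C\<^sup>2 / a ^ ?N) * ((S / t) ^ k * sv_prod (A \<circ> B) t)"
      by (simp add: power2_eq_square mult_ac)
    moreover have "0 < (S / t) ^ k * sv_prod (A \<circ> B) t"
      using S t sv_prod_pos[OF AB] by simp
    ultimately have "S / t \<le> C\<^sup>2 / a ^ ?N" by (simp only: mult_le_cancel_right_pos)
    then have "a ^ ?N / C\<^sup>2 * S \<le> t" using t a(1) C by (simp add: field_simps)
    then show ?thesis by (simp add: C_def S_def t_def)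
  qed
qed

subsection \<open>The Bernoulli shift\<close>

definition shift :: "nat \<Rightarrow> (nat \<Rightarrow> nat) \<Rightarrow> nat \<Rightarrow> nat" where
  "shift n x = (\<lambda>k. x (n + k))"

lemma shift_0 [simp]: "shift 0 x = x"
  and shift_shift [simp]: "shift a (shift b x) = shift (b + a) x"
  by (auto simp: shift_def add.assoc)

locale bernoulli_shift =
  fixes m :: nat and p :: "nat \<Rightarrow> real"
  assumes p_pos: "\<And>i. i \<in> {1..m} \<Longrightarrow> p i > 0"
    and p_sum: "(\<Sum>i=1..m. p i) = 1"
begin

abbreviation letter :: "nat measure" where
  "letter \<equiv> point_measure {1..m} (\<lambda>a. ennreal (p a))"

abbreviation bm :: "(nat \<Rightarrow> nat) measure" where
  "bm \<equiv> bernoulli_measure m p"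

sublocale letter: prob_space letter
  using p_pos p_sum by (intro prob_space_letters) (auto intro: less_imp_le)

sublocale seq: sequence_space letter
  ..

sublocale bm: prob_space bm
  using p_pos p_sum by (intro prob_space_bernoulli_measure) (auto intro: less_imp_le)

lemma bm_eq: "bm = PiM UNIV (\<lambda>_. letter)"
  by (simp add: bernoulli_measure_def)

lemma space_letter [simp]: "space letter = {1..m}"
  by (simp add: space_point_measure)

lemma prob_code_space [simp]: "measure bm (code_space m) = 1"
  using bm.prob_space by simp

lemma in_code_space_iff: "x \<in> code_space m \<longleftrightarrow> (\<forall>n. x n \<in> {1..m})"
  by (auto simp: code_space_def PiE_iff)

lemma shift_in_code_space: "x \<in> code_space m \<Longrightarrow> shift n x \<in> code_space m"
  by (simp add: in_code_space_iff shift_def)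

lemma measurable_coordinate [measurable]: "(\<lambda>x. x n) \<in> bm \<rightarrow>\<^sub>M letter"
  unfolding bm_eq by (rule measurable_component_singleton) simp

lemma measurable_to_bm:
  assumes "\<And>k. (\<lambda>x. f x k) \<in> M \<rightarrow>\<^sub>M letter"
  shows "f \<in> M \<rightarrow>\<^sub>M bm"
proof -
  have "(\<lambda>x. \<lambda>k\<in>UNIV. f x k) \<in> M \<rightarrow>\<^sub>M PiM UNIV (\<lambda>_. letter)"
    by (intro measurable_restrict assms)
  then show ?thesis by (simp add: bm_eq restrict_UNIV)
qed

lemma measurable_shift [measurable]: "shift n \<in> bm \<rightarrow>\<^sub>M bm"
  unfolding shift_def by (intro measurable_to_bm) measurable

lemma distr_shift: "distr bm bm (shift n) = bm"
proof -
  have "distr (PiM UNIV (\<lambda>_. letter)) (\<Pi>\<^sub>M i\<in>UNIV. letter) (\<lambda>\<omega>. \<lambda>k\<in>UNIV. \<omega> (n + k)) = (\<Pi>\<^sub>M i\<in>UNIV. letter)"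
    by (rule distr_PiM_reindex[where f = "\<lambda>k. n + k", OF letter.prob_space_axioms]) (auto simp: inj_on_def)
  then show ?thesis by (simp add: bm_eq shift_def[abs_def] restrict_UNIV)
qed

lemma measure_vimage_shift:
  assumes "A \<in> sets bm"
  shows "measure bm (shift n -` A \<inter> code_space m) = measure bm A"
  by (subst (2) distr_shift[of n, symmetric]) (simp add: measure_distr assms)

lemma integral_shift:
  fixes f :: "(nat \<Rightarrow> nat) \<Rightarrow> real"
  assumes "f \<in> borel_measurable bm"
  shows "(\<integral>x. f (shift n x) \<partial>bm) = (\<integral>x. f x \<partial>bm)"
  by (subst (2) distr_shift[of n, symmetric]) (simp add: integral_distr assms)

lemma indep_coordinates: "bm.indep_vars (\<lambda>_. letter) (\<lambda>n x. x n) UNIV"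
proof -
  have 1: "(\<Pi>\<^sub>M i\<in>UNIV. distr bm letter (\<lambda>x. x i)) = bm"
    unfolding bm_eq by (subst seq.PiM_component) auto
  have 2: "distr bm (\<Pi>\<^sub>M i\<in>UNIV. letter) (\<lambda>x. \<lambda>i\<in>UNIV. x i) = bm"
    unfolding restrict_UNIV by (rule distr_id2) (simp add: bm_eq)
  show ?thesis
    by (rule iffD2[OF bm.indep_vars_iff_distr_eq_PiM]) (rule UNIV_not_empty measurable_coordinate trans[OF 2 1[symmetric]])+
qed

text \<open>Up to null sets such a set is a tail event.\<close>

lemma shift_decreasing_0_1:
  assumes G: "G \<in> sets bm" and dec: "\<And>x. x \<in> code_space m \<Longrightarrow> shift 1 x \<in> G \<Longrightarrow> x \<in> G"
  shows "measure bm G = 0 \<or> measure bm G = 1"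
proof -
  \<comment> \<open>The sets H n decrease and all have the measure of G, hence so has their
    intersection. For every n it is the intersection of the later sets, so it depends only on the
    letters from n on.\<close>
  define H where "H n = shift n -` G \<inter> code_space m" for n
  have Hm: "H n \<in> sets bm" for n
    unfolding H_def using measurable_sets[OF measurable_shift G] by simp
  have "H (Suc n) \<subseteq> H n" for n
    using dec[of "shift n _"] by (auto simp: H_def shift_in_code_space)
  then have decH: "decseq H" by (simp add: decseq_Suc_iff)
  have "(\<lambda>n. measure bm (H n)) \<longlonglongrightarrow> measure bm (\<Inter>n. H n)"
    using Hm decH by (intro bm.finite_Lim_measure_decseq) auto
  moreover have "measure bm (H n) = measure bm G" for n
    unfolding H_def by (rule measure_vimage_shift[OF G])
  ultimately have eq: "measure bm (\<Inter>n. H n) = measure bm G"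
    by (simp add: LIMSEQ_const_iff)
  define A where "A i = sigma_sets (space bm) {(\<lambda>x. x i) -` B \<inter> space bm | B. B \<in> sets letter}" for i :: nat
  have "measure bm (\<Inter>n. H n) = 0 \<or> measure bm (\<Inter>n. H n) = 1"
  proof (rule bm.kolmogorov_0_1_law[of A])
    show "sigma_algebra (space bm) (A i)" for i
      unfolding A_def by (intro sigma_algebra_sigma_sets) auto
    show "bm.indep_sets A UNIV"
      using indep_coordinates[unfolded bm.indep_vars_def] unfolding A_def by (rule conjunct2)
    show "(\<Inter>n. H n) \<in> bm.tail_events A"
      unfolding bm.tail_events_def
    proof
      fix n
      let ?\<Sigma> = "sigma (space bm) (\<Union> (A ` {n..}))"
      have "A i \<subseteq> Pow (space bm)" for i
      proof -
        have "{(\<lambda>x. x i) -` B \<inter> space bm | B. B \<in> sets letter} \<subseteq> Pow (space bm)" by blast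
        from sigma_sets_into_sp[OF this] show ?thesis unfolding A_def by blast
      qed
      then have sub: "\<Union> (A ` {n..}) \<subseteq> Pow (space bm)" by blast
      have coord: "(\<lambda>x. x i) \<in> ?\<Sigma> \<rightarrow>\<^sub>M letter" if "i \<ge> n" for i
      proof (rule measurableI)
        show "x i \<in> space letter" if "x \<in> space ?\<Sigma>" for x
        proof -
          have "x \<in> code_space m" using that sub by simp
          then show ?thesis unfolding space_letter in_code_space_iff by blast
        qed
        fix B assume B: "B \<in> sets letter"
        have "(\<lambda>x. x i) -` B \<inter> space bm \<in> A i"
          unfolding A_def using B by (intro sigma_sets.Basic) blast
        then show "(\<lambda>x. x i) -` B \<inter> space ?\<Sigma> \<in> sets ?\<Sigma>"
          using that sub by (auto intro: sigma_sets.Basic)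
      qed
      have "H k \<in> sets ?\<Sigma>" if "k \<ge> n" for k
      proof -
        have "shift k \<in> ?\<Sigma> \<rightarrow>\<^sub>M bm"
          unfolding shift_def using that by (intro measurable_to_bm coord) simp
        from measurable_sets[OF this G] show ?thesis
          using sub by (simp add: H_def)
      qed
      then have "(\<Inter>k\<in>{n..}. H k) \<in> sets ?\<Sigma>"
        by (intro sets.countable_INT') auto
      moreover have "(\<Inter>k. H k) = (\<Inter>k\<in>{n..}. H k)"
      proof -
        have "x \<in> H k" if "x \<in> H (max n k)" for x k
          using decseqD[OF decH, of k "max n k"] that by auto
        then show ?thesis by (auto; metis atLeast_iff max.cobounded1)
      qed
      ultimately show "(\<Inter>k. H k) \<in> sigma_sets (space bm) (\<Union> (A ` {n..}))"
        using sub by simp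
    qed
  qed
  then show ?thesis by (simp add: eq)
qed

end

subsection \<open>The subadditive ergodic theorem\<close>

text \<open>The uniform linear bound gives integrability and controls the incomplete blocks left at
  the ends of a decomposition.\<close>

locale subadditive_process = bernoulli_shift +
  fixes g :: "nat \<Rightarrow> (nat \<Rightarrow> nat) \<Rightarrow> real" and C :: real
  assumes g_measurable [measurable]: "\<And>n. g n \<in> borel_measurable bm"
    and g_bound: "\<And>n x. x \<in> code_space m \<Longrightarrow> \<bar>g n x\<bar> \<le> C * real n"
    and g_subadditive: "\<And>k n x. x \<in> code_space m \<Longrightarrow> g (k + n) x \<le> g k x + g n (shift k x)"
begin

lemma C_nonneg: "0 \<le> C"
proof -
  obtain x where "x \<in> code_space m" using bm.not_empty by auto
  from g_bound[OF this, of 1] show ?thesis by simp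
qed

lemma integrable_g: "integrable bm (g n)"
  by (rule bm.integrable_const_bound[where B = "C * real n"]) (auto simp: g_bound intro!: AE_I2)

text \<open>Greedy decomposition: a point outside \<open>B\<close> starts a block of length at most \<open>K\<close> on which the
  average of \<open>g\<close> is at most \<open>\<gamma>\<close>.\<close>

lemma greedy_bound:
  assumes K: "1 \<le> K" and x: "x \<in> code_space m"
    and B: "\<And>x. x \<in> code_space m \<Longrightarrow> x \<notin> B \<Longrightarrow> \<exists>l\<in>{1..K}. g l x \<le> \<gamma> * real l"
  shows "g n x \<le> \<gamma> * real n + (C + \<bar>\<gamma>\<bar>) * (\<Sum>k<n. indicator B (shift k x)) + (C + \<bar>\<gamma>\<bar>) * real K"
  using x
proof (induction n arbitrary: x rule: less_induct)
  case (less n)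
  \<comment> \<open>A single step taken inside B costs at most C instead of \<gamma>, an excess of
    at most \<open>?D\<close>. The final stretch of fewer than K steps costs at most
    \<open>?D * real K\<close> too much.\<close>
  let ?D = "C + \<bar>\<gamma>\<bar>"
  have D: "0 \<le> ?D" using C_nonneg by simp
  have sn: "0 \<le> (\<Sum>k<n. indicator B (shift k x) :: real)" by (intro sum_nonneg) auto
  consider "n < K" | "n \<ge> K" "x \<in> B" | "n \<ge> K" "x \<notin> B" by linarith
  then show ?case
  proof cases
    case 1
    have "g n x \<le> C * real n" using g_bound[OF less.prems, of n] by linarith
    also have "\<dots> \<le> C * real n + (\<gamma> + \<bar>\<gamma>\<bar>) * real n" by simp
    also have "\<dots> = \<gamma> * real n + ?D * real n" by (simp only: distrib_right)
    also have "?D * real n \<le> ?D * real K" using 1 D by (intro mult_left_mono) auto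
    finally show ?thesis using D sn by (smt (verit) mult_nonneg_nonneg)
  next
    case 2
    then obtain n' where n': "n = Suc n'" using K by (cases n) auto
    have "g n x \<le> g 1 x + g n' (shift 1 x)"
      using g_subadditive[OF less.prems, of 1 n'] n' by simp
    also have "g 1 x \<le> C" using g_bound[OF less.prems, of 1] by simp
    also have "g n' (shift 1 x) \<le> \<gamma> * real n' + ?D * (\<Sum>k<n'. indicator B (shift (Suc k) x)) + ?D * real K"
      using less.IH[of n' "shift 1 x"] n' less.prems by (simp add: shift_in_code_space)
    finally have "g n x \<le> C + (\<gamma> * real n' + ?D * (\<Sum>k<n'. indicator B (shift (Suc k) x)) + ?D * real K)"
      by simp
    also have "\<dots> \<le> \<gamma> * real n + ?D * (1 + (\<Sum>k<n'. indicator B (shift (Suc k) x))) + ?D * real K"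
      by (simp add: n' algebra_simps)
    also have "1 + (\<Sum>k<n'. indicator B (shift (Suc k) x)) = (\<Sum>k<n. indicator B (shift k x) :: real)"
      using 2 by (simp add: n' sum.lessThan_Suc_shift del: sum.lessThan_Suc)
    finally show ?thesis .
  next
    case 3
    then obtain l where l: "l \<in> {1..K}" "g l x \<le> \<gamma> * real l" using B less.prems by blast
    have "g n x \<le> g l x + g (n - l) (shift l x)"
      using g_subadditive[OF less.prems, of l "n - l"] l 3 by simp
    also have "g (n - l) (shift l x)
        \<le> \<gamma> * real (n - l) + ?D * (\<Sum>k<n - l. indicator B (shift (l + k) x)) + ?D * real K"
      using less.IH[of "n - l" "shift l x"] l 3 less.prems by (simp add: shift_in_code_space)
    also have "(\<Sum>k<n - l. indicator B (shift (l + k) x) :: real) = (\<Sum>k=l..<n. indicator B (shift k x))"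
      using l 3 by (intro sum.reindex_bij_witness[of _ "\<lambda>k. k - l" "\<lambda>k. l + k"]) auto
    also have "\<dots> \<le> (\<Sum>k<n. indicator B (shift k x))"
      by (intro sum_mono2) auto
    finally have "g n x \<le> g l x + (\<gamma> * real (n - l) + ?D * (\<Sum>k<n. indicator B (shift k x)) + ?D * real K)"
      using D by (simp add: mult_left_mono)
    moreover have "g l x + \<gamma> * real (n - l) \<le> \<gamma> * real n"
      using l 3 by (simp add: of_nat_diff algebra_simps)
    ultimately show ?thesis by linarith
  qed
qed

text \<open>The set where the lower limit of g n x / n is at most L - e has measure 0 or 1. If the
  measure were 1, almost every point would begin a block with average at most L - e/2, with block
  length below a fixed K outside a set of small measure. The integrated greedy bound would then push
  the mean of g n below L n for large n.\<close>

lemma AE_lower_bound: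
  assumes L: "\<And>n. n \<ge> 1 \<Longrightarrow> L * real n \<le> (\<integral>x. g n x \<partial>bm)" and e: "e > 0"
  shows "AE x in bm. \<forall>\<^sub>F n in sequentially. (L - e) * real n \<le> g n x"
proof -
  define \<gamma> where "\<gamma> = L - e"
  \<comment> \<open>The slack 1 / (j + 1), for all j, expresses that the lower limit is at most
    \<gamma>. It also absorbs the bounded error from restoring a first letter: below, the index 2 j
    + 1 halves the slack and the other half pays for the error.\<close>
  define G where "G = {x \<in> space bm. \<forall>j::nat. \<forall>k::nat. \<exists>n. k \<le> n \<and> 1 \<le> n \<and> g n x \<le> (\<gamma> + 1 / real (Suc j)) * real n}"
  have Gm: "G \<in> sets bm" unfolding G_def by measurable
  have dec: "x \<in> G" if x: "x \<in> code_space m" and G: "shift 1 x \<in> G" for x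
    unfolding G_def
  proof (intro CollectI conjI allI)
    fix j k :: nat
    obtain K :: nat where K: "2 * real (Suc j) * (C + \<bar>\<gamma>\<bar>) \<le> real K"
      using real_arch_simple by blast
    from G obtain n where n: "max k K \<le> n" "1 \<le> n" "g n (shift 1 x) \<le> (\<gamma> + 1 / real (Suc (2 * j + 1))) * real n"
      unfolding G_def by blast
    have "g (Suc n) x \<le> g 1 x + g n (shift 1 x)"
      using g_subadditive[OF x, of 1 n] by simp
    also have "g 1 x \<le> C" using g_bound[OF x, of 1] by simp
    also note n(3)
    finally have 1: "g (Suc n) x \<le> C + (\<gamma> + 1 / real (Suc (2 * j + 1))) * real n" by simp
    define q where "q = 1 / real (Suc (2 * j + 1))"
    have q: "0 < q" and h: "1 / real (Suc j) = 2 * q"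
      by (simp_all add: q_def field_simps)
    have "C + \<bar>\<gamma>\<bar> \<le> q * real K"
      using K by (simp add: q_def field_simps)
    also have "\<dots> \<le> q * real n"
      using n q by (intro mult_left_mono) auto
    finally have "C \<le> q * real n + \<gamma> + 2 * q" using q by linarith
    then have "C + (\<gamma> + q) * real n \<le> (\<gamma> + 2 * q) * real (Suc n)"
      by (simp add: algebra_simps)
    then have "C + (\<gamma> + 1 / real (Suc (2 * j + 1))) * real n \<le> (\<gamma> + 1 / real (Suc j)) * real (Suc n)"
      unfolding h by (simp only: q_def)
    then show "\<exists>n. k \<le> n \<and> 1 \<le> n \<and> g n x \<le> (\<gamma> + 1 / real (Suc j)) * real n"
      using 1 n by (intro exI[of _ "Suc n"]) auto
  qed (use x in simp)
  have "measure bm G \<noteq> 1"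
  proof
    assume G1: "measure bm G = 1"
    define \<gamma>' where "\<gamma>' = L - e / 2"
    define D where "D = C + \<bar>\<gamma>'\<bar>"
    have D: "0 \<le> D" using C_nonneg by (simp add: D_def)
    define B where "B K = {x \<in> space bm. \<forall>l\<in>{1..K}. \<gamma>' * real l < g l x}" for K
    have Bm[measurable]: "B K \<in> sets bm" for K unfolding B_def by measurable
    have "decseq B" by (auto simp: decseq_def B_def)
    then have "(\<lambda>K. measure bm (B K)) \<longlonglongrightarrow> measure bm (\<Inter>K. B K)"
      using Bm by (intro bm.finite_Lim_measure_decseq) auto
    moreover have "measure bm (\<Inter>K. B K) = 0"
    proof -
      obtain j :: nat where j: "1 / real (Suc j) < e / 2"
        using e nat_approx_posE[of "e / 2"] by auto
      have "(\<Inter>K. B K) \<inter> G = {}"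
      proof (intro equals0I)
        fix x assume x: "x \<in> (\<Inter>K. B K) \<inter> G"
        then obtain n where n: "1 \<le> n" "g n x \<le> (\<gamma> + 1 / real (Suc j)) * real n"
          unfolding G_def by blast
        have "(\<gamma> + 1 / real (Suc j)) * real n \<le> \<gamma>' * real n"
          using j by (intro mult_right_mono) (auto simp: \<gamma>_def \<gamma>'_def)
        moreover have "x \<in> B n" using x by blast
        then have "\<gamma>' * real n < g n x" using n by (simp add: B_def)
        ultimately show False using n by linarith
      qed
      then have "measure bm (\<Inter>K. B K) + measure bm G = measure bm ((\<Inter>K. B K) \<union> G)"
        using Gm Bm by (intro bm.finite_measure_Union[symmetric]) auto
      also have "\<dots> \<le> 1" by (rule bm.prob_le_1)
      finally show ?thesis using G1 measure_nonneg[of bm "\<Inter>K. B K"] by linarith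
    qed
    ultimately have lim: "(\<lambda>K. measure bm (B K)) \<longlonglongrightarrow> 0" by simp
    \<comment> \<open>With this choice the visits to B K use up at most e/4 per step of the gap e/2
      between L and \<gamma>', and e/4 per step remains for the contradiction.\<close>
    define \<delta> where "\<delta> = e / (4 * (D + 1))"
    have "\<delta> > 0" using e D by (simp add: \<delta>_def)
    from order_tendstoD(2)[OF lim this] obtain K0 where K0: "\<And>K. K \<ge> K0 \<Longrightarrow> measure bm (B K) < \<delta>"
      by (auto simp: eventually_sequentially)
    define K where "K = max 1 K0"
    have K: "1 \<le> K" "measure bm (B K) < \<delta>" using K0[of K] by (auto simp: K_def)
    have main: "L * real n \<le> \<gamma>' * real n + D * (real n * measure bm (B K)) + D * real K" if n: "n \<ge> 1" for n
    proof -
      have int_ind: "integrable bm (\<lambda>x. indicator (B K) (shift k x) :: real)" for k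
        by (rule bm.integrable_const_bound[where B = 1]) auto
      have "(\<integral>x. g n x \<partial>bm)
          \<le> (\<integral>x. \<gamma>' * real n + D * (\<Sum>k<n. indicator (B K) (shift k x)) + D * real K \<partial>bm)"
      proof (rule integral_mono)
        show "integrable bm (\<lambda>x. \<gamma>' * real n + D * (\<Sum>k<n. indicator (B K) (shift k x)) + D * real K)"
          by (intro Bochner_Integration.integrable_add integrable_mult_right Bochner_Integration.integrable_sum
              int_ind) auto
        fix x assume "x \<in> space bm"
        then show "g n x \<le> \<gamma>' * real n + D * (\<Sum>k<n. indicator (B K) (shift k x)) + D * real K"
          unfolding D_def by (intro greedy_bound K) (auto simp: B_def not_less)
      qed (rule integrable_g)
      also have "\<dots> = \<gamma>' * real n + D * (\<Sum>k<n. \<integral>x. indicator (B K) (shift k x) \<partial>bm) + D * real K"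
        using int_ind by simp
      also have "(\<Sum>k<n. \<integral>x. indicator (B K) (shift k x) \<partial>bm) = real n * measure bm (B K)"
      proof -
        have "B K \<inter> code_space m = B K" by (auto simp: B_def)
        then show ?thesis by (simp add: integral_shift)
      qed
      finally show ?thesis using L[OF n] by linarith
    qed
    have "D * measure bm (B K) \<le> D * \<delta>" using K D by (intro mult_left_mono) auto
    also have "\<dots> \<le> e / 4" using e D by (simp add: \<delta>_def field_simps)
    finally have De: "D * measure bm (B K) \<le> e / 4" .
    have "e / 4 * real n \<le> D * real K" if "n \<ge> 1" for n
    proof -
      have "D * (real n * measure bm (B K)) \<le> e / 4 * real n"
        using mult_right_mono[OF De, of "real n"] by (simp add: mult_ac)
      then show ?thesis using main[OF that] by (simp add: \<gamma>'_def algebra_simps)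
    qed
    moreover obtain n :: nat where "D * real K / (e / 4) < real n" using reals_Archimedean2 by blast
    then have "D * real K < e / 4 * real (Suc n)" using e by (simp add: field_simps)
    ultimately show False by (metis One_nat_def not_less Suc_le_mono le0)
  qed
  then have "measure bm G = 0" using shift_decreasing_0_1[OF Gm dec] by blast
  then have "AE x in bm. x \<notin> G"
    using Gm by (intro AE_not_in) (simp add: null_setsI bm.emeasure_eq_measure)
  then show ?thesis
  proof (rule AE_mp, intro AE_I2 impI)
    fix x assume "x \<in> space bm" "x \<notin> G"
    then obtain j k where jk: "\<And>n. k \<le> n \<Longrightarrow> 1 \<le> n \<Longrightarrow> (\<gamma> + 1 / real (Suc j)) * real n < g n x"
      unfolding G_def mem_Collect_eq not_all not_ex not_le de_Morgan_conj by (metis not_le)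
    have "(L - e) * real n \<le> g n x" if "n \<ge> max k 1" for n
    proof -
      have "\<gamma> * real n \<le> (\<gamma> + 1 / real (Suc j)) * real n" by (intro mult_right_mono) auto
      also have "\<dots> < g n x" using that by (intro jk) auto
      finally show ?thesis by (simp add: \<gamma>_def)
    qed
    then show "\<forall>\<^sub>F n in sequentially. (L - e) * real n \<le> g n x"
      unfolding eventually_sequentially by blast
  qed
qed


text \<open>A moving window: U n sums g over the k consecutive lengths from n on. Moving the window
  by one replaces g n x by g (n + k) x and costs at most g k (shift n x). This bounds g by a
  Birkhoff sum of g k with an error independent of n.\<close>

lemma block_bound:
  assumes x: "x \<in> code_space m"
  shows "real k * g (n + k) x \<le> 2 * C * (real k)\<^sup>2 + (\<Sum>j<n. g k (shift j x))"
proof -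
  define U where "U n = (\<Sum>r<k. g (n + r) x)" for n
  have step: "U (Suc n) \<le> U n + g k (shift n x)" for n
  proof -
    have "U (Suc n) + g n x = (\<Sum>r<Suc k. g (n + r) x)"
      by (simp add: U_def sum.lessThan_Suc_shift del: sum.lessThan_Suc)
    also have "\<dots> = U n + g (n + k) x" by (simp add: U_def)
    finally show ?thesis using g_subadditive[OF x, of n k] by linarith
  qed
  have U: "U n \<le> U 0 + (\<Sum>j<n. g k (shift j x))"
    by (induction n) (use step in \<open>auto intro: order_trans\<close>, smt (verit) step)
  have "U 0 \<le> (\<Sum>r<k. C * real k)"
    unfolding U_def
  proof (rule sum_mono)
    fix r assume "r \<in> {..<k}"
    then have "C * real r \<le> C * real k" using C_nonneg by (intro mult_left_mono) auto
    then show "g (0 + r) x \<le> C * real k" using g_bound[OF x, of r] by simp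
  qed
  moreover have "(\<Sum>r<k. g (n + k) x) \<le> (\<Sum>r<k. g (n + r) x + C * real k)"
  proof (rule sum_mono)
    fix r assume r: "r \<in> {..<k}"
    have "g (n + k) x \<le> g (n + r) x + g (k - r) (shift (n + r) x)"
      using g_subadditive[OF x, of "n + r" "k - r"] r by simp
    also have "g (k - r) (shift (n + r) x) \<le> C * real (k - r)"
      using g_bound[OF shift_in_code_space[OF x], of "k - r" "n + r"] by simp
    also have "\<dots> \<le> C * real k" using C_nonneg by (intro mult_left_mono) auto
    finally show "g (n + k) x \<le> g (n + r) x + C * real k" by simp
  qed
  ultimately show ?thesis
    using U by (simp add: U_def sum.distrib power2_eq_square algebra_simps)
qed

text \<open>L is the infimum of the normalised means. The lower half is
  \<open>AE_lower_bound\<close>. For the upper half, g is bounded by Birkhoff sums of g k for a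
  nearly optimal k; the negatives of these sums form an additive process, so that
  \<open>AE_lower_bound\<close> applies to them as well.\<close>

theorem kingman:
  obtains L where "(\<lambda>n. (\<integral>x. g n x \<partial>bm) / real n) \<longlonglongrightarrow> L"
    and "AE x in bm. (\<lambda>n. g n x / real n) \<longlonglongrightarrow> L"
proof -
  define a where "a n = (\<integral>x. g n x \<partial>bm)" for n
  have a_lower: "- C * real n \<le> a n" for n
  proof -
    have "(\<integral>x. - C * real n \<partial>bm) \<le> a n"
      unfolding a_def
    proof (rule integral_mono)
      show "- C * real n \<le> g n x" if "x \<in> space bm" for x
        using g_bound[of x n] that by simp
    qed (auto intro: integrable_g)
    then show ?thesis by simp
  qed
  define L where "L = Inf ((\<lambda>n. a n / real n) ` {1..})"
  have bdd: "bdd_below ((\<lambda>n. a n / real n) ` {1..})"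
    by (rule bdd_belowI2[where m = "- C"]) (use a_lower in \<open>simp add: field_simps\<close>)
  have L_le: "L * real n \<le> a n" if "n \<ge> 1" for n
  proof -
    have "L \<le> a n / real n" unfolding L_def by (rule cINF_lower[OF bdd]) (use that in simp)
    then show ?thesis using that by (simp add: field_simps)
  qed
  have ex_k: "\<exists>k\<ge>1. a k \<le> (L + e) * real k" if e: "e > 0" for e
  proof -
    have "\<exists>y\<in>(\<lambda>n. a n / real n) ` {1..}. y < L + e"
      unfolding L_def by (rule cInf_lessD) (use e in auto)
    then obtain k where "k \<ge> 1" "a k / real k < L + e" by auto
    then show ?thesis by (intro exI[of _ k]) (auto simp: field_simps)
  qed
  \<comment> \<open>Of the three e, one comes from the choice of k, one from the assumed bound on h,
    and one absorbs the terms that do not grow with n.\<close>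
  have limsup_aux: "\<forall>\<^sub>F n in sequentially. h n \<le> (L + 3 * e) * real n"
    if e: "e > 0" and k: "k \<ge> 1" "a k \<le> (L + e) * real k"
      and h: "\<forall>\<^sub>F n in sequentially. real k * h (n + k) \<le> 2 * C * (real k)\<^sup>2 + (a k + e) * real n" for e k and h :: "nat \<Rightarrow> real"
  proof -
    define D where "D = 2 * C * real k + \<bar>L + 3 * e\<bar> * real k"
    obtain n0 :: nat where n0: "D / e \<le> real n0" using real_arch_simple by blast
    have "\<forall>\<^sub>F n in sequentially. h (n + k) \<le> (L + 3 * e) * real (n + k)"
      using h eventually_ge_at_top[of n0]
    proof eventually_elim
      case (elim n)
      have "e * 1 \<le> e * real k" using e k by (intro mult_left_mono) auto
      then have "a k + e \<le> (L + 2 * e) * real k" using k by (simp add: algebra_simps)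
      then have "(a k + e) * real n \<le> (L + 2 * e) * real k * real n" by (intro mult_right_mono) auto
      then have "real k * h (n + k) \<le> real k * (2 * C * real k + (L + 2 * e) * real n)"
        using elim(1) by (simp add: power2_eq_square algebra_simps)
      then have 1: "h (n + k) \<le> 2 * C * real k + (L + 2 * e) * real n" using k by simp
      have "D / e \<le> real n" using n0 elim(2) by linarith
      then have "D \<le> e * real n" using e by (simp add: field_simps)
      moreover have "- (\<bar>L + 3 * e\<bar> * real k) \<le> (L + 3 * e) * real k"
        using mult_right_mono[of "- \<bar>L + 3 * e\<bar>" "L + 3 * e" "real k"] by simp
      ultimately show ?case using 1 unfolding D_def by (simp add: algebra_simps)
    qed
    then show ?thesis using eventually_sequentially_seg[of "\<lambda>n. h n \<le> (L + 3 * e) * real n" k] by simp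
  qed
  have lim: "(\<lambda>n. h n / real n) \<longlonglongrightarrow> L"
    if lo: "\<And>j. \<forall>\<^sub>F n in sequentially. (L - 1 / real (Suc j)) * real n \<le> h n"
      and up: "\<And>j. \<forall>\<^sub>F n in sequentially. h n \<le> (L + 3 * (1 / real (Suc j))) * real n" for h :: "nat \<Rightarrow> real"
  proof (rule LIMSEQ_I)
    fix r :: real assume r: "r > 0"
    then obtain j where j: "1 / real (Suc j) < r / 3" using nat_approx_posE[of "r / 3"] by auto
    have "\<forall>\<^sub>F n in sequentially. norm (h n / real n - L) < r"
      using lo[of j] up[of j] eventually_ge_at_top[of "1::nat"]
    proof eventually_elim
      case (elim n)
      then have "L - 1 / real (Suc j) \<le> h n / real n" "h n / real n \<le> L + 3 * (1 / real (Suc j))"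
        by (auto simp: field_simps)
      then show ?case using j by auto
    qed
    then show "\<exists>no. \<forall>n\<ge>no. norm (h n / real n - L) < r" by (simp add: eventually_sequentially)
  qed
  have "(\<lambda>n. a n / real n) \<longlonglongrightarrow> L"
  proof (rule lim)
    fix j
    let ?e = "1 / real (Suc j)"
    have e: "?e > 0" by simp
    show "\<forall>\<^sub>F n in sequentially. (L - ?e) * real n \<le> a n"
      using eventually_ge_at_top[of "1::nat"]
    proof eventually_elim
      case (elim n)
      have "(L - ?e) * real n \<le> L * real n" by (intro mult_right_mono) auto
      then show ?case using L_le[OF elim] by linarith
    qed
    obtain k where k: "k \<ge> 1" "a k \<le> (L + ?e) * real k" using ex_k[OF e] by blast
    show "\<forall>\<^sub>F n in sequentially. a n \<le> (L + 3 * ?e) * real n"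
    proof (rule limsup_aux[OF e k], rule always_eventually, rule allI)
      fix n
      have int: "integrable bm (\<lambda>x. g k (shift j x))" for j
        by (rule bm.integrable_const_bound[where B = "C * real k"]) 
          (auto intro!: AE_I2 g_bound shift_in_code_space)
      have "real k * a (n + k) = (\<integral>x. real k * g (n + k) x \<partial>bm)"
        by (simp add: a_def)
      also have "\<dots> \<le> (\<integral>x. 2 * C * (real k)\<^sup>2 + (\<Sum>j<n. g k (shift j x)) \<partial>bm)"
      proof (rule integral_mono)
        show "real k * g (n + k) x \<le> 2 * C * (real k)\<^sup>2 + (\<Sum>j<n. g k (shift j x))" if "x \<in> space bm" for x
          using block_bound that by simp
      qed (auto intro!: integrable_g int)
      also have "\<dots> = 2 * C * (real k)\<^sup>2 + (\<Sum>j<n. \<integral>x. g k (shift j x) \<partial>bm)"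
        using int by simp
      also have "(\<Sum>j<n. \<integral>x. g k (shift j x) \<partial>bm) = real n * a k"
        by (simp add: integral_shift a_def)
      also have "real n * a k \<le> (a k + ?e) * real n" by (simp add: algebra_simps)
      finally show "real k * a (n + k) \<le> 2 * C * (real k)\<^sup>2 + (a k + ?e) * real n" by simp
    qed
  qed
  moreover have "AE x in bm. (\<lambda>n. g n x / real n) \<longlonglongrightarrow> L"
  proof -
    have lo: "AE x in bm. \<forall>j. \<forall>\<^sub>F n in sequentially. (L - 1 / real (Suc j)) * real n \<le> g n x"
      unfolding AE_all_countable using AE_lower_bound[OF L_le[unfolded a_def]] by simp
    have up: "AE x in bm. \<forall>j. \<forall>\<^sub>F n in sequentially. g n x \<le> (L + 3 * (1 / real (Suc j))) * real n"
      unfolding AE_all_countable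
    proof
      fix j
      let ?e = "1 / real (Suc j)"
      have e: "?e > 0" by simp
      obtain k where k: "k \<ge> 1" "a k \<le> (L + ?e) * real k" using ex_k[OF e] by blast
      interpret neg: subadditive_process m p "\<lambda>n x. - (\<Sum>j<n. g k (shift j x))" "C * real k"
      proof
        show "(\<lambda>x. - (\<Sum>j<n. g k (shift j x))) \<in> borel_measurable bm" for n by measurable
        fix x assume x: "x \<in> code_space m"
        fix n
        have "\<bar>- (\<Sum>j<n. g k (shift j x))\<bar> \<le> (\<Sum>j<n. \<bar>g k (shift j x)\<bar>)" by simp
        also have "\<dots> \<le> (\<Sum>j<n. C * real k)"
          by (intro sum_mono g_bound shift_in_code_space x)
        finally show "\<bar>- (\<Sum>j<n. g k (shift j x))\<bar> \<le> C * real k * real n" by (simp add: mult_ac)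
        fix l
        have "(\<Sum>j<l + n. g k (shift j x)) = (\<Sum>j<l. g k (shift j x)) + (\<Sum>j<n. g k (shift j (shift l x)))"
          by (induction n) (simp_all add: add.assoc)
        then show "- (\<Sum>j<l + n. g k (shift j x)) \<le> - (\<Sum>j<l. g k (shift j x)) + - (\<Sum>j<n. g k (shift j (shift l x)))"
          by simp
      qed
      have int: "integrable bm (\<lambda>x. g k (shift j x))" for j
        by (rule bm.integrable_const_bound[where B = "C * real k"]) 
          (auto intro!: AE_I2 g_bound shift_in_code_space)
      have "AE x in bm. \<forall>\<^sub>F n in sequentially. (- a k - ?e) * real n \<le> - (\<Sum>j<n. g k (shift j x))"
      proof (rule neg.AE_lower_bound[OF _ e])
        show "- a k * real n \<le> (\<integral>x. - (\<Sum>j<n. g k (shift j x)) \<partial>bm)" for n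
          using int by (simp add: integral_shift a_def mult.commute)
      qed
      then show "AE x in bm. \<forall>\<^sub>F n in sequentially. g n x \<le> (L + 3 * ?e) * real n"
      proof (rule AE_mp, intro AE_I2 impI)
        fix x assume x: "x \<in> space bm"
          and ev: "\<forall>\<^sub>F n in sequentially. (- a k - ?e) * real n \<le> - (\<Sum>j<n. g k (shift j x))"
        show "\<forall>\<^sub>F n in sequentially. g n x \<le> (L + 3 * ?e) * real n"
        proof (rule limsup_aux[OF e k])
          show "\<forall>\<^sub>F n in sequentially. real k * g (n + k) x \<le> 2 * C * (real k)\<^sup>2 + (a k + ?e) * real n"
            using ev
          proof eventually_elim
            case (elim n)
            have "(- a k - ?e) * real n = - ((a k + ?e) * real n)" by (simp add: algebra_simps)
            then show ?case using block_bound[of x k n] x elim by simp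
          qed
        qed
      qed
    qed
    from lo up show ?thesis
      by eventually_elim (intro lim; blast)
  qed
  ultimately show thesis using that unfolding a_def by blast
qed

end

subsection \<open>Words\<close>

lemma length_prefix_word [simp]: "length (prefix_word x k) = k"
  by (simp add: prefix_word_def)

lemma prefix_word_0 [simp]: "prefix_word x 0 = []"
  by (simp add: prefix_word_def)

lemma prefix_word_add: "prefix_word x (k + n) = prefix_word x k @ prefix_word (shift k x) n"
  by (rule nth_equalityI) (auto simp: prefix_word_def shift_def nth_append)

lemma prefix_word_Suc: "prefix_word x (Suc k) = prefix_word x k @ [x k]"
  by (simp add: prefix_word_def)

lemma word_map_append: "word_map T (u @ v) = word_map T u \<circ> word_map T v"
  by (induction u) auto

lemma finite_words_of_length: "finite (words_of_length m k)"
proof -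
  have "words_of_length m k = {w. set w \<subseteq> {1..m} \<and> length w = k}"
    by (auto simp: words_of_length_def words_def lists_eq_set)
  then show ?thesis using finite_lists_length_eq[of "{1..m}" k] by simp
qed

lemma words_append: "u @ v \<in> words m \<longleftrightarrow> u \<in> words m \<and> v \<in> words m"
  by (auto simp: words_def)

definition word_prob :: "(nat \<Rightarrow> real) \<Rightarrow> nat list \<Rightarrow> real" where
  "word_prob p w = prod_list (map p w)"

lemma word_prob_append: "word_prob p (u @ v) = word_prob p u * word_prob p v"
  by (simp add: word_prob_def)

context bernoulli_shift
begin

lemma prefix_word_in_words: "x \<in> code_space m \<Longrightarrow> prefix_word x k \<in> words_of_length m k"
  by (auto simp: words_of_length_def words_def prefix_word_def in_code_space_iff)

lemma prefix_word_in_words': "x \<in> code_space m \<Longrightarrow> prefix_word x k \<in> words m"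
  using prefix_word_in_words by (auto simp: words_of_length_def)

lemma measurable_coordinate_count_space [measurable]: "(\<lambda>x. x n) \<in> bm \<rightarrow>\<^sub>M count_space UNIV"
proof (rule measurable_compose[OF measurable_coordinate])
  show "(\<lambda>a. a) \<in> letter \<rightarrow>\<^sub>M count_space UNIV"
  proof (rule measurableI)
    fix A :: "nat set"
    show "(\<lambda>a. a) -` A \<inter> space letter \<in> sets letter"
      unfolding sets_point_measure space_letter by blast
  qed simp
qed

lemma cylinder_measurable [measurable]: "cylinder m w \<in> sets bm"
proof -
  have "cylinder m w = {x \<in> space bm. \<forall>j\<in>{..<length w}. x j = w ! j}"
    unfolding cylinder_def prefix_word_def list_eq_iff_nth_eq by auto
  also have "\<dots> \<in> sets bm" by measurable
  finally show ?thesis .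
qed

lemma measurable_prefix_word [measurable]: "(\<lambda>x. prefix_word x k) \<in> bm \<rightarrow>\<^sub>M count_space UNIV"
proof (subst measurable_count_space_eq2_countable, safe)
  fix w :: "nat list"
  have "(\<lambda>x. prefix_word x k) -` {w} \<inter> space bm = (if length w = k then cylinder m w else {})"
    by (auto simp: cylinder_def)
  then show "(\<lambda>x. prefix_word x k) -` {w} \<inter> space bm \<in> sets bm"
    by auto
qed auto

lemma measure_cylinder: "w \<in> words m \<Longrightarrow> measure bm (cylinder m w) = word_prob p w"
  unfolding word_prob_def using p_pos p_sum by (intro measure_bernoulli_cylinder) (auto intro: less_imp_le)

lemma word_prob_pos: "w \<in> words m \<Longrightarrow> 0 < word_prob p w"
  unfolding words_def word_prob_def by (induction w) (auto intro!: mult_pos_pos p_pos)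

lemma integral_prefix_word:
  fixes F :: "nat list \<Rightarrow> real"
  shows "(\<integral>x. F (prefix_word x k) \<partial>bm) = (\<Sum>w\<in>words_of_length m k. word_prob p w * F w)"
    and "integrable bm (\<lambda>x. F (prefix_word x k))"
proof -
  let ?W = "words_of_length m k"
  have eq: "F (prefix_word x k) = (\<Sum>w\<in>?W. indicator (cylinder m w) x * F w)" if "x \<in> space bm" for x
  proof -
    have "indicator (cylinder m w) x = (if w = prefix_word x k then 1 else 0 :: real)" if "w \<in> ?W" for w
      using that \<open>x \<in> space bm\<close> by (auto simp: cylinder_def words_of_length_def indicator_def)
    then have "(\<Sum>w\<in>?W. indicator (cylinder m w) x * F w) = (\<Sum>w\<in>?W. if w = prefix_word x k then F w else 0)"
      by (intro sum.cong) auto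
    also have "\<dots> = F (prefix_word x k)"
      using prefix_word_in_words[of x k] that by (simp add: sum.delta finite_words_of_length)
    finally show ?thesis ..
  qed
  have int: "integrable bm (\<lambda>x. indicator (cylinder m w) x * F w)" for w
    by (intro integrable_mult_left integrable_real_indicator) (auto simp: bm.emeasure_finite less_top[symmetric])
  have "(\<integral>x. F (prefix_word x k) \<partial>bm) = (\<integral>x. (\<Sum>w\<in>?W. indicator (cylinder m w) x * F w) \<partial>bm)"
    by (rule Bochner_Integration.integral_cong[OF refl eq])
  also have "\<dots> = (\<Sum>w\<in>?W. \<integral>x. indicator (cylinder m w) x * F w \<partial>bm)"
    by (intro Bochner_Integration.integral_sum int)
  also have "\<dots> = (\<Sum>w\<in>?W. word_prob p w * F w)"
  proof (intro sum.cong refl)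
    fix w assume "w \<in> ?W"
    then have "w \<in> words m" by (simp add: words_of_length_def)
    moreover have "cylinder m w \<inter> code_space m = cylinder m w" by (auto simp: cylinder_def)
    ultimately show "(\<integral>x. indicator (cylinder m w) x * F w \<partial>bm) = word_prob p w * F w"
      by (simp add: measure_cylinder)
  qed
  finally show "(\<integral>x. F (prefix_word x k) \<partial>bm) = (\<Sum>w\<in>?W. word_prob p w * F w)" .
  have "integrable bm (\<lambda>x. \<Sum>w\<in>?W. indicator (cylinder m w) x * F w)"
    by (intro Bochner_Integration.integrable_sum int)
  then show "integrable bm (\<lambda>x. F (prefix_word x k))"
    by (subst Bochner_Integration.integrable_cong[OF refl eq])
qed

lemma sum_word_prob: "(\<Sum>w\<in>words_of_length m k. word_prob p w) = 1"
  using integral_prefix_word(1)[of "\<lambda>_. 1" k] by simp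

end

subsection \<open>Pressure\<close>

locale self_affine = bernoulli_shift m p for m :: nat and p :: "nat \<Rightarrow> real" +
  fixes T :: "nat \<Rightarrow> real^'n \<Rightarrow> real^'n" and \<kappa> \<Lambda> q Q :: real
  assumes T_linear: "\<And>i. i \<in> {1..m} \<Longrightarrow> linear (T i)"
    and T_bij: "\<And>i. i \<in> {1..m} \<Longrightarrow> bij (T i)"
    and lam: "0 < \<kappa>" "\<And>i x. i \<in> {1..m} \<Longrightarrow> \<kappa> * norm x \<le> norm (T i x)"
    and Lam: "0 < \<Lambda>" "\<Lambda> < 1" "\<And>i x. i \<in> {1..m} \<Longrightarrow> norm (T i x) \<le> \<Lambda> * norm x"
    and q: "0 < q" "\<And>i. i \<in> {1..m} \<Longrightarrow> q \<le> p i"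
    and Q: "0 < Q" "Q < 1" "\<And>i. i \<in> {1..m} \<Longrightarrow> p i \<le> Q"
begin

lemma lam_le_Lam: "\<kappa> \<le> \<Lambda>"
proof -
  obtain x where "x \<in> code_space m" using bm.not_empty by auto
  then have i: "x 0 \<in> {1..m}" by (simp only: in_code_space_iff)
  obtain b :: "real^'n" where "b \<in> Basis" using nonempty_Basis by blast
  then show ?thesis using lam(2)[OF i, of b] Lam(3)[OF i, of b] by simp
qed

lemma q_le_Q: "q \<le> Q"
proof -
  obtain x where "x \<in> code_space m" using bm.not_empty by auto
  then have i: "x 0 \<in> {1..m}" by (simp only: in_code_space_iff)
  then show ?thesis using q(2)[OF i] Q(3)[OF i] by linarith
qed

lemma word_map_linear_bij:
  assumes "w \<in> words m" shows "linear (word_map T w)" "bij (word_map T w)"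
proof -
  have "linear (word_map T w) \<and> bij (word_map T w)"
    using assms
  proof (induction w)
    case Nil
    then show ?case using linear_id bij_id by (simp add: id_def)
  next
    case (Cons a w)
    then have a: "a \<in> {1..m}" and w: "w \<in> words m" by (auto simp: words_def)
    show ?case
      unfolding word_map.simps
      using linear_compose[OF _ T_linear[OF a]] bij_comp[OF _ T_bij[OF a]] Cons.IH[OF w] by blast
  qed
  then show "linear (word_map T w)" "bij (word_map T w)" by auto
qed

lemma word_map_bounds:
  assumes "w \<in> words m"
  shows "\<kappa> ^ length w * norm x \<le> norm (word_map T w x)" "norm (word_map T w x) \<le> \<Lambda> ^ length w * norm x"
proof -
  have "\<kappa> ^ length w * norm x \<le> norm (word_map T w x) \<and> norm (word_map T w x) \<le> \<Lambda> ^ length w * norm x"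
    using assms
  proof (induction w)
    case (Cons a w)
    then have a: "a \<in> {1..m}" and w: "w \<in> words m" by (auto simp: words_def)
    have "\<kappa> * (\<kappa> ^ length w * norm x) \<le> \<kappa> * norm (word_map T w x)"
      using Cons.IH[OF w] lam by (intro mult_left_mono) auto
    moreover have "\<Lambda> * norm (word_map T w x) \<le> \<Lambda> * (\<Lambda> ^ length w * norm x)"
      using Cons.IH[OF w] Lam by (intro mult_left_mono) auto
    ultimately show ?case
      using lam(2)[OF a, of "word_map T w x"] Lam(3)[OF a, of "word_map T w x"] by (simp add: mult.assoc)
  qed simp
  then show "\<kappa> ^ length w * norm x \<le> norm (word_map T w x)" "norm (word_map T w x) \<le> \<Lambda> ^ length w * norm x"
    by auto
qed

lemma word_prob_bounds:
  assumes "w \<in> words m"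
  shows "q ^ length w \<le> word_prob p w" "word_prob p w \<le> Q ^ length w"
proof -
  have "q ^ length w \<le> word_prob p w \<and> word_prob p w \<le> Q ^ length w"
    using assms
  proof (induction w)
    case (Cons a w)
    then have a: "a \<in> {1..m}" and w: "w \<in> words m" by (auto simp: words_def)
    have "q * q ^ length w \<le> p a * word_prob p w" "p a * word_prob p w \<le> Q * Q ^ length w"
      using q(1) q(2)[OF a] Q(1) Q(3)[OF a] Cons.IH[OF w] word_prob_pos[OF w] p_pos[OF a] by (auto intro!: mult_mono)
    then show ?case by (simp add: word_prob_def)
  qed (simp add: word_prob_def)
  then show "q ^ length w \<le> word_prob p w" "word_prob p w \<le> Q ^ length w" by auto
qed

definition \<phi> :: "real \<Rightarrow> nat list \<Rightarrow> real" where
  "\<phi> s w = sv_function s (word_map T w)"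

lemma phi_pos: "w \<in> words m \<Longrightarrow> 0 \<le> s \<Longrightarrow> 0 < \<phi> s w"
  unfolding \<phi>_def using word_map_linear_bij by (intro sv_function_pos) auto

lemma ln_phi_increment:
  assumes w: "w \<in> words m" and s: "0 \<le> s" "s \<le> t"
  shows "real (length w) * ((t - s) * ln \<kappa>) \<le> ln (\<phi> t w) - ln (\<phi> s w)"
    and "ln (\<phi> t w) - ln (\<phi> s w) \<le> real (length w) * ((t - s) * ln \<Lambda>)"
proof -
  have "0 < \<kappa> ^ length w" using lam by simp
  note * = ln_sv_function_increment[OF word_map_linear_bij[OF w] s this word_map_bounds[OF w]]
  have "(t - s) * ln (\<kappa> ^ length w) = real (length w) * ((t - s) * ln \<kappa>)"
    "(t - s) * ln (\<Lambda> ^ length w) = real (length w) * ((t - s) * ln \<Lambda>)"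
    using lam Lam by (simp_all add: ln_realpow)
  with * show "real (length w) * ((t - s) * ln \<kappa>) \<le> ln (\<phi> t w) - ln (\<phi> s w)"
    "ln (\<phi> t w) - ln (\<phi> s w) \<le> real (length w) * ((t - s) * ln \<Lambda>)"
    by (simp_all only: \<phi>_def)
qed

text \<open>The \<open>n\<close>-th term of the pressure is minus the mean of this process.\<close>

definition energy :: "real \<Rightarrow> nat list \<Rightarrow> real" where
  "energy s w = ln (\<phi> s w) - ln (word_prob p w)"

lemma phi_0 [simp]: "\<phi> 0 w = 1"
  by (simp add: \<phi>_def sv_function_def)

lemma energy_bound:
  assumes w: "w \<in> words m" and s: "0 \<le> s"
  shows "\<bar>energy s w\<bar> \<le> (s * \<bar>ln \<kappa>\<bar> + \<bar>ln q\<bar>) * real (length w)"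
proof -
  have "ln (q ^ length w) \<le> ln (word_prob p w)" "ln (word_prob p w) \<le> ln (Q ^ length w)"
    using word_prob_bounds[OF w] q Q word_prob_pos[OF w] by (auto intro!: ln_mono)
  then have p: "real (length w) * ln q \<le> ln (word_prob p w)" "ln (word_prob p w) \<le> real (length w) * ln Q"
    using q Q by (auto simp: ln_realpow)
  have "ln q < 0" "ln Q < 0" "ln \<kappa> < 0" "ln \<Lambda> < 0"
    using q Q q_le_Q lam Lam lam_le_Lam by auto
  then have neg: "real (length w) * ln Q \<le> 0" "real (length w) * (s * ln \<Lambda>) \<le> 0"
    "\<bar>ln q\<bar> = - ln q" "\<bar>ln \<kappa>\<bar> = - ln \<kappa>"
    using s by (auto simp: mult_le_0_iff)
  have "real (length w) * (s * ln \<kappa>) \<le> ln (\<phi> s w)" "ln (\<phi> s w) \<le> real (length w) * (s * ln \<Lambda>)"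
    using ln_phi_increment[OF w order_refl s] by auto
  then have "\<bar>energy s w\<bar> \<le> - (real (length w) * (s * ln \<kappa>)) - real (length w) * ln q"
    using p neg unfolding energy_def by linarith
  then show ?thesis unfolding neg by (simp add: algebra_simps)
qed

lemma energy_append:
  assumes u: "u \<in> words m" and v: "v \<in> words m" and s: "0 \<le> s"
  shows "energy s (u @ v) \<le> energy s u + energy s v + (1 + s) * ln (sv_const CARD('n))"
proof -
  have "ln (\<phi> s (u @ v)) \<le> ln (\<phi> s u) + ln (\<phi> s v) + (1 + s) * ln (sv_const CARD('n))"
    unfolding \<phi>_def word_map_append
    by (rule ln_sv_function_comp_le[OF word_map_linear_bij[OF u] word_map_linear_bij[OF v] s])
  moreover have "ln (word_prob p (u @ v)) = ln (word_prob p u) + ln (word_prob p v)"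
    using word_prob_pos[OF u] word_prob_pos[OF v] by (simp add: word_prob_append ln_mult)
  ultimately show ?thesis unfolding energy_def by linarith
qed

definition pressure_term :: "real \<Rightarrow> nat \<Rightarrow> real" where
  "pressure_term s k = (\<Sum>w\<in>words_of_length m k. word_prob p w * - energy s w)"

lemma pressure1_eq_lim: "0 \<le> s \<Longrightarrow> pressure1 m p T s = lim (\<lambda>k. pressure_term s k / real k)"
  unfolding pressure1_def
proof (intro arg_cong[where f = lim] ext)
  fix k assume s: "0 \<le> s"
  have "ln (inverse (\<phi> s w) * word_prob p w) = - energy s w" if "w \<in> words m" for w
    using phi_pos[OF that s] word_prob_pos[OF that] by (simp add: energy_def ln_mult ln_inverse)
  then show "1 / real k * (\<Sum>w\<in>words_of_length m k. measure bm (cylinder m w) *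
      ln (inverse (sv_function s (word_map T w)) * measure bm (cylinder m w))) = pressure_term s k / real k"
    unfolding pressure_term_def times_divide_eq_left mult_1
    by (intro arg_cong2[where f = "(/)"] sum.cong refl) (simp add: measure_cylinder words_of_length_def flip: \<phi>_def)
qed

lemma pressure_limits:
  assumes s: "0 \<le> s"
  shows "(\<lambda>k. pressure_term s k / real k) \<longlonglongrightarrow> pressure1 m p T s"
    and "AE x in bm. (\<lambda>n. energy s (prefix_word x n) / real n) \<longlonglongrightarrow> - pressure1 m p T s"
proof -
  define c where "c = (1 + s) * ln (sv_const CARD('n))"
  have c: "0 \<le> c" unfolding c_def using s sv_const_ge_1[of "CARD('n)"] by (simp add: Suc_leI)
  \<comment> \<open>Adding c turns subadditivity up to the constant c into subadditivity: c on the
    left stands against 2 c on the right. At n = 0 the linear bound of the process forces the value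
    0.\<close>
  define g where "g n x = (if n = 0 then 0 else energy s (prefix_word x n) + c)" for n x
  interpret subadditive_process m p g "s * \<bar>ln \<kappa>\<bar> + \<bar>ln q\<bar> + c"
  proof
    show "g n \<in> borel_measurable bm" for n unfolding g_def by measurable
    fix x assume x: "x \<in> code_space m"
    show "\<bar>g n x\<bar> \<le> (s * \<bar>ln \<kappa>\<bar> + \<bar>ln q\<bar> + c) * real n" for n
    proof (cases "n = 0")
      case False
      have "c \<le> c * real n" using False c by (simp add: mult_le_cancel_left1)
      then show ?thesis
        using energy_bound[OF prefix_word_in_words'[OF x, of n] s] c False by (simp add: g_def distrib_right)
    qed (simp add: g_def)
    show "g (k + n) x \<le> g k x + g n (shift k x)" for k n
      using energy_append[OF prefix_word_in_words'[OF x, of k] prefix_word_in_words'[OF shift_in_code_space[OF x], of k n] s]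
      by (simp add: g_def prefix_word_add c_def)
  qed
  obtain L where L: "(\<lambda>n. (\<integral>x. g n x \<partial>bm) / real n) \<longlonglongrightarrow> L" "AE x in bm. (\<lambda>n. g n x / real n) \<longlonglongrightarrow> L"
    using kingman by blast
  have c0: "(\<lambda>n. c / real n) \<longlonglongrightarrow> 0" by (rule lim_const_over_n)
  have "(\<lambda>k. c / real k - (\<integral>x. g k x \<partial>bm) / real k) \<longlonglongrightarrow> 0 - L"
    by (intro tendsto_diff c0 L)
  moreover have "c / real k - (\<integral>x. g k x \<partial>bm) / real k = pressure_term s k / real k" for k
  proof (cases "k = 0")
    case False
    have "(\<integral>x. g k x \<partial>bm) = (\<integral>x. energy s (prefix_word x k) \<partial>bm) + c"
      using False integral_prefix_word(2)[of "energy s" k] by (simp add: g_def)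
    also have "(\<integral>x. energy s (prefix_word x k) \<partial>bm) = - pressure_term s k"
      by (simp add: integral_prefix_word(1) pressure_term_def sum_negf)
    finally show ?thesis using False by (simp add: field_simps)
  qed simp
  ultimately have lim: "(\<lambda>k. pressure_term s k / real k) \<longlonglongrightarrow> - L" by simp
  then have P: "pressure1 m p T s = - L"
    unfolding pressure1_eq_lim[OF s] by (rule limI)
  show "(\<lambda>k. pressure_term s k / real k) \<longlonglongrightarrow> pressure1 m p T s"
    using lim P by simp
  show "AE x in bm. (\<lambda>n. energy s (prefix_word x n) / real n) \<longlonglongrightarrow> - pressure1 m p T s"
    using L(2)
  proof eventually_elim
    case (elim x)
    have "(\<lambda>n. g n x / real n - c / real n) \<longlonglongrightarrow> L - 0"
      by (intro tendsto_diff c0 elim)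
    moreover have "\<forall>\<^sub>F n in sequentially. g n x / real n - c / real n = energy s (prefix_word x n) / real n"
      using eventually_gt_at_top[of 0] by eventually_elim (simp add: g_def field_simps)
    ultimately show ?case unfolding P by (simp add: Lim_transform_eventually)
  qed
qed

text \<open>Word by word this is \<open>ln_phi_increment\<close>, averaged with weights of sum 1. It
  provides the strict monotonicity and the Lipschitz continuity on which the existence and
  uniqueness of d_1 rest.\<close>

lemma pressure_increment:
  assumes s: "0 \<le> s" "s \<le> t"
  shows "(t - s) * - ln \<Lambda> \<le> pressure1 m p T t - pressure1 m p T s"
    and "pressure1 m p T t - pressure1 m p T s \<le> (t - s) * - ln \<kappa>"
proof -
  have t: "0 \<le> t" using s by simp
  have diff: "pressure_term t k - pressure_term s k = (\<Sum>w\<in>words_of_length m k. word_prob p w * (ln (\<phi> s w) - ln (\<phi> t w)))" for k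
    unfolding pressure_term_def sum_subtractf[symmetric] by (intro sum.cong) (auto simp: energy_def algebra_simps)
  have c: "(\<Sum>w\<in>words_of_length m k. word_prob p w * (real k * d)) = real k * d" for k d
    by (simp add: sum_word_prob flip: sum_distrib_right)
  have lim: "(\<lambda>k. pressure_term t k / real k - pressure_term s k / real k)
      \<longlonglongrightarrow> pressure1 m p T t - pressure1 m p T s"
    by (intro tendsto_diff pressure_limits s t)
  have 1: "real k * ((t - s) * - ln \<Lambda>) \<le> pressure_term t k - pressure_term s k" for k
  proof (subst c[symmetric], unfold diff, intro sum_mono mult_left_mono)
    fix w assume "w \<in> words_of_length m k"
    then have w: "w \<in> words m" "length w = k" by (auto simp: words_of_length_def)
    show "real k * ((t - s) * - ln \<Lambda>) \<le> ln (\<phi> s w) - ln (\<phi> t w)"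
      using ln_phi_increment(2)[OF w(1) s] w by simp
    show "0 \<le> word_prob p w" using word_prob_pos[OF w(1)] by simp
  qed
  have 2: "pressure_term t k - pressure_term s k \<le> real k * ((t - s) * - ln \<kappa>)" for k
  proof (subst c[symmetric], unfold diff, intro sum_mono mult_left_mono)
    fix w assume "w \<in> words_of_length m k"
    then have w: "w \<in> words m" "length w = k" by (auto simp: words_of_length_def)
    show "ln (\<phi> s w) - ln (\<phi> t w) \<le> real k * ((t - s) * - ln \<kappa>)"
      using ln_phi_increment(1)[OF w(1) s] w by simp
    show "0 \<le> word_prob p w" using word_prob_pos[OF w(1)] by simp
  qed
  show "(t - s) * - ln \<Lambda> \<le> pressure1 m p T t - pressure1 m p T s"
  proof (rule LIMSEQ_le_const[OF lim], intro exI allI impI)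
    fix k :: nat assume "1 \<le> k"
    then show "(t - s) * - ln \<Lambda> \<le> pressure_term t k / real k - pressure_term s k / real k"
      using 1[of k] unfolding diff_divide_distrib[symmetric] by (simp add: le_divide_eq mult.commute)
  qed
  show "pressure1 m p T t - pressure1 m p T s \<le> (t - s) * - ln \<kappa>"
  proof (rule LIMSEQ_le_const2[OF lim], intro exI allI impI)
    fix k :: nat assume "1 \<le> k"
    then show "pressure_term t k / real k - pressure_term s k / real k \<le> (t - s) * - ln \<kappa>"
      using 2[of k] unfolding diff_divide_distrib[symmetric] by (simp add: divide_le_eq mult.commute)
  qed
qed

text \<open>At s = 0 the pressure is minus the entropy of the Bernoulli measure, negative because no
  letter has probability above Q < 1.\<close>

lemma pressure_0_neg: "pressure1 m p T 0 < 0"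
proof -
  have "pressure1 m p T 0 \<le> ln Q"
  proof (rule LIMSEQ_le_const2[OF pressure_limits(1)[OF order_refl]], intro exI allI impI)
    fix k :: nat assume k: "1 \<le> k"
    have "pressure_term 0 k \<le> (\<Sum>w\<in>words_of_length m k. word_prob p w * (real k * ln Q))"
      unfolding pressure_term_def
    proof (intro sum_mono mult_left_mono)
      fix w assume "w \<in> words_of_length m k"
      then have w: "w \<in> words m" "length w = k" by (auto simp: words_of_length_def)
      show "0 \<le> word_prob p w" using word_prob_pos[OF w(1)] by simp
      have "ln (word_prob p w) \<le> ln (Q ^ k)"
        using word_prob_bounds(2)[OF w(1)] w word_prob_pos[OF w(1)] Q(1) by simp
      then show "- energy 0 w \<le> real k * ln Q" using Q(1) by (simp add: energy_def ln_realpow)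
    qed
    also have "\<dots> = real k * ln Q" by (simp add: sum_word_prob flip: sum_distrib_right)
    finally show "pressure_term 0 k / real k \<le> ln Q" using k by (simp add: divide_le_eq mult.commute)
  qed
  also have "ln Q < 0" using Q by simp
  finally show ?thesis .
qed

lemma d1_properties: "0 < d1 m p T" "pressure1 m p T (d1 m p T) = 0"
proof -
  let ?P = "pressure1 m p T"
  have L: "0 < - ln \<Lambda>" using Lam by simp
  have mono: "?P s < ?P t" if "0 \<le> s" "s < t" for s t
    using pressure_increment(1)[of s t] that L by (smt (verit) mult_pos_pos)
  \<comment> \<open>The pressure grows with slope at least - ln \<Lambda>, so it has become
    nonnegative at M.\<close>
  define M where "M = - ?P 0 / - ln \<Lambda>"
  have M: "0 \<le> M" using pressure_0_neg L by (simp add: M_def divide_nonpos_neg)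
  have "0 \<le> ?P M"
    using pressure_increment(1)[OF order_refl M] L by (simp add: M_def)
  moreover have "continuous_on {0..M} ?P"
  proof (rule lipschitz_on_continuous_on[where L = "- ln \<kappa>"], rule lipschitz_onI)
    show "0 \<le> - ln \<kappa>" using lam Lam lam_le_Lam by simp
    have lip: "\<bar>?P s - ?P t\<bar> \<le> - ln \<kappa> * \<bar>s - t\<bar>" if "0 \<le> s" "s \<le> t" for s t
    proof -
      have "?P s \<le> ?P t" using mono[of s t] that by (cases "s = t") auto
      moreover have "\<bar>s - t\<bar> = t - s" using that by simp
      ultimately show ?thesis
        using pressure_increment(2)[OF that] by (simp only: mult.commute[of "- ln \<kappa>"])
    qed
    show "dist (?P s) (?P t) \<le> - ln \<kappa> * dist s t" if "s \<in> {0..M}" "t \<in> {0..M}" for s t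
      using that lip[of s t] lip[of t s]
      unfolding dist_real_def by (cases "s \<le> t") (simp_all add: abs_minus_commute[of t s] abs_minus_commute[of "?P t"])
  qed
  ultimately obtain d where d: "0 \<le> d" "?P d = 0"
    using IVT'[of ?P 0 0 M] pressure_0_neg M by auto
  then have "0 < d" using pressure_0_neg by (cases "d = 0") auto
  have "d1 m p T = d"
    unfolding d1_def
  proof (rule the_equality)
    fix d' assume "0 < d' \<and> ?P d' = 0"
    then show "d' = d" using mono[of d d'] mono[of d' d] d by (metis less_imp_le linorder_neqE_linordered_idom less_irrefl)
  qed (use \<open>0 < d\<close> d in simp)
  then show "0 < d1 m p T" "?P (d1 m p T) = 0" using \<open>0 < d\<close> d by auto
qed

lemma AE_energy_lower:
  assumes s: "0 \<le> s" "s < d1 m p T"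
  obtains c where "c > 0" "AE x in bm. \<forall>\<^sub>F n in sequentially. c * real n \<le> energy s (prefix_word x n)"
proof -
  define c where "c = - pressure1 m p T s / 2"
  have "0 < (d1 m p T - s) * - ln \<Lambda>" using s Lam by (intro mult_pos_pos) auto
  then have P: "pressure1 m p T s < 0"
    using pressure_increment(1)[of s "d1 m p T"] s d1_properties by simp
  then have c: "c > 0" by (simp add: c_def)
  have "AE x in bm. \<forall>\<^sub>F n in sequentially. c * real n \<le> energy s (prefix_word x n)"
    using pressure_limits(2)[OF s(1)]
  proof eventually_elim
    case (elim x)
    have "\<forall>\<^sub>F n in sequentially. c < energy s (prefix_word x n) / real n"
      by (rule order_tendstoD(1)[OF elim]) (use P in \<open>simp add: c_def\<close>)
    then show ?case using eventually_gt_at_top[of 0]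
      by eventually_elim (auto simp: field_simps)
  qed
  then show thesis using that c by blast
qed

lemma AE_energy_upper:
  assumes s: "d1 m p T < s"
  obtains c where "c > 0" "AE x in bm. \<forall>\<^sub>F n in sequentially. energy s (prefix_word x n) \<le> - c * real n"
proof -
  define c where "c = pressure1 m p T s / 2"
  have s0: "0 \<le> s" using s d1_properties by simp
  have "0 < (s - d1 m p T) * - ln \<Lambda>" using s Lam by (intro mult_pos_pos) auto
  then have P: "pressure1 m p T s > 0"
    using pressure_increment(1)[of "d1 m p T" s] s d1_properties by simp
  then have c: "c > 0" by (simp add: c_def)
  have "AE x in bm. \<forall>\<^sub>F n in sequentially. energy s (prefix_word x n) \<le> - c * real n"
    using pressure_limits(2)[OF s0]
  proof eventually_elim
    case (elim x)
    have "\<forall>\<^sub>F n in sequentially. energy s (prefix_word x n) / real n < - c"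
      by (rule order_tendstoD(2)[OF elim]) (use P in \<open>simp add: c_def\<close>)
    then show ?case using eventually_gt_at_top[of 0]
      by eventually_elim (auto simp: field_simps)
  qed
  then show thesis using that c by blast
qed

end

subsection \<open>Information dimension of exact dimensional measures\<close>

text \<open>The parameter r is continuous, so dominated convergence is applied to the indicators
  along sequences tending to 0.\<close>

lemma (in prob_space) prob_AE_eventually_tendsto_0:
  fixes B :: "real \<Rightarrow> 'a set"
  assumes B: "\<And>r. r > 0 \<Longrightarrow> B r \<in> events" and ae: "AE x in M. \<forall>\<^sub>F r in at_right 0. x \<notin> B r"
  shows "((\<lambda>r. prob (B r)) \<longlongrightarrow> 0) (at_right 0)"
  unfolding tendsto_at_iff_sequentially
proof (intro allI impI)
  fix X :: "nat \<Rightarrow> real" assume X: "\<forall>i. X i \<in> {0<..} - {0}" "X \<longlonglongrightarrow> 0"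
  then have fl: "filterlim X (at_right 0) sequentially"
    by (auto simp: filterlim_at intro!: always_eventually) (metis less_irrefl)
  have [measurable]: "B (X i) \<in> events" for i using X(1) by (intro B) auto
  have "(\<lambda>i. \<integral>x. indicator (B (X i)) x \<partial>M) \<longlonglongrightarrow> (\<integral>x. (0::real) \<partial>M)"
  proof (rule integral_dominated_convergence[where w = "\<lambda>_. 1"])
    show "AE x in M. (\<lambda>i. indicator (B (X i)) x :: real) \<longlonglongrightarrow> 0"
      using ae
    proof eventually_elim
      case (elim x)
      have "\<forall>\<^sub>F i in sequentially. x \<notin> B (X i)"
        using filterlim_iff[THEN iffD1, OF fl] elim by blast
      then have "\<forall>\<^sub>F i in sequentially. indicator (B (X i)) x = (0::real)"
        by eventually_elim simp
      then show ?case by (rule tendsto_eventually)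
    qed
  qed (auto simp: indicator_def)
  moreover have "(\<integral>x. indicator (B (X i)) x \<partial>M) = prob (B (X i))" for i
    using sets.sets_into_space[of "B (X i)" M] by (simp add: Int_absorb2)
  ultimately show "((\<lambda>r. prob (B r)) \<circ> X) \<longlonglongrightarrow> 0"
    by (simp add: o_def)
qed

lemma measurable_measure_cball:
  fixes \<nu> :: "(real^'n) measure"
  assumes "prob_space \<nu>" and [measurable_cong]: "sets \<nu> = sets borel"
  shows "(\<lambda>x. measure \<nu> (cball x r)) \<in> borel_measurable borel"
proof -
  interpret prob_space \<nu> by fact
  have "{z \<in> space (borel \<Otimes>\<^sub>M \<nu>). dist (fst z) (snd z) \<le> r} \<in> sets (borel \<Otimes>\<^sub>M \<nu>)" by measurable
  then have "(\<lambda>x. emeasure \<nu> (Pair x -` {z \<in> space (borel \<Otimes>\<^sub>M \<nu>). dist (fst z) (snd z) \<le> r})) \<in> borel_measurable borel"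
    by (rule measurable_emeasure_Pair)
  moreover have "Pair x -` {z \<in> space (borel \<Otimes>\<^sub>M \<nu>). dist (fst z) (snd z) \<le> r} = cball x r" for x
    using sets_eq_imp_space_eq[OF assms(2)] by (auto simp: space_pair_measure)
  ultimately show ?thesis by (simp add: measure_def)
qed

text \<open>This is ln u \<le> u - 1 at u = 1 / (a n). Summed over at most n cells it bounds their
  entropy by their total mass times ln n, plus 1.\<close>

lemma neg_mult_ln_le:
  fixes a :: real
  assumes "0 \<le> a" "0 < n" shows "- (a * ln a) \<le> a * ln n + 1 / n"
proof (cases "a = 0")
  case False
  then have a: "0 < a" using assms by simp
  have "ln (1 / (a * n)) \<le> 1 / (a * n) - 1"
    using a assms by (intro ln_le_minus_one) simp
  then have "a * ln (1 / (a * n)) \<le> a * (1 / (a * n) - 1)"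
    using a by (intro mult_left_mono) auto
  also have "\<dots> \<le> 1 / n" using a assms by (simp add: right_diff_distrib)
  also have "ln (1 / (a * n)) = - ln a - ln n"
    using a assms by (simp add: ln_div ln_mult)
  finally show ?thesis by (simp add: algebra_simps)
qed (use assms in simp)

section \<open>Entropy sums of a measure with a local dimension almost everywhere\<close>

locale local_dimension = prob_space \<nu> for \<nu> :: "(real^'n) measure" +
  fixes d R :: real
  assumes sets_nu [measurable_cong]: "sets \<nu> = sets borel"
    and d: "0 < d" and R: "0 \<le> R" and support: "prob (cball 0 R) = 1"
    and local_dim: "\<And>e. e > 0 \<Longrightarrow> AE x in \<nu>. \<forall>\<^sub>F r in at_right 0.
      r powr (d + e) \<le> prob (cball x r) \<and> prob (cball x r) \<le> r powr (d - e)"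
begin

lemma space_nu: "space \<nu> = UNIV"
  using sets_eq_imp_space_eq[OF sets_nu] by simp

lemma measurable_prob_cball [measurable]: "(\<lambda>x. prob (cball x r)) \<in> borel_measurable borel"
  by (rule measurable_measure_cball[OF prob_space_axioms sets_nu])

abbreviation cubes :: "real \<Rightarrow> (int^'n) set" where
  "cubes r \<equiv> {j. mesh_cube r j \<inter> cball 0 R \<noteq> {}}"

lemma card_cubes:
  assumes r: "0 < r" "r \<le> 1"
  shows "finite (cubes r)" "real (card (cubes r)) * r ^ CARD('n) \<le> measure lborel (cball (0::real^'n) (R + CARD('n)))"
proof -
  have V: "cball (0::real^'n) (R + CARD('n)) \<in> fmeasurable lborel"
    by (rule fmeasurable_compact) simp
  have sub: "y \<in> cball 0 (R + CARD('n))" if "x \<in> cball 0 R" "norm (y - x) \<le> real CARD('n) * r" for x y :: "real^'n"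
  proof -
    have "real CARD('n) * r \<le> real CARD('n)" using r by (simp add: mult_left_le)
    then show ?thesis using that norm_triangle_sub[of y x] unfolding mem_cball_0 by linarith
  qed
  show "finite (cubes r)" by (rule card_mesh_cubes_le(1)[OF r(1) V sub])
  show "real (card (cubes r)) * r ^ CARD('n) \<le> measure lborel (cball (0::real^'n) (R + CARD('n)))"
    by (rule card_mesh_cubes_le(2)[OF r(1) V sub])
qed

lemma finite_cubes:
  assumes r: "0 < r" shows "finite (cubes r)"
proof (rule card_mesh_cubes_le(1)[OF r fmeasurable_compact[of "cball 0 (R + real CARD('n) * r)"]])
  fix x y :: "real^'n" assume "x \<in> cball 0 R" "norm (y - x) \<le> real CARD('n) * r"
  then show "y \<in> cball 0 (R + real CARD('n) * r)"
    using norm_triangle_sub[of y x] unfolding mem_cball_0 by linarith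
qed simp

lemma disjoint_mesh: "0 < r \<Longrightarrow> disjoint_family_on (mesh_cube r) I"
  unfolding disjoint_family_on_def using mesh_cube_iff by (metis disjoint_iff)

lemma prob_UN_cubes: "0 < r \<Longrightarrow> finite I \<Longrightarrow> prob (\<Union>j\<in>I. mesh_cube r j) = (\<Sum>j\<in>I. prob (mesh_cube r j))"
  by (intro finite_measure_finite_Union disjoint_mesh) (auto simp: sets_nu)

lemma sum_prob_cubes:
  assumes r: "0 < r" shows "(\<Sum>j\<in>cubes r. prob (mesh_cube r j)) = 1"
proof -
  have "cball 0 R \<subseteq> (\<Union>j\<in>cubes r. mesh_cube r j)"
  proof
    fix x :: "real^'n" assume x: "x \<in> cball 0 R"
    have "x \<in> mesh_cube r (\<chi> i. \<lfloor>x $ i / r\<rfloor>)" by (simp add: mesh_cube_iff[OF r])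
    then show "x \<in> (\<Union>j\<in>cubes r. mesh_cube r j)" using x by blast
  qed
  then have "1 \<le> prob (\<Union>j\<in>cubes r. mesh_cube r j)"
    unfolding support[symmetric] using finite_cubes[OF r] 
    by (intro finite_measure_mono) (auto simp: sets_nu)
  then show ?thesis
    using prob_UN_cubes[OF r finite_cubes[OF r]] prob_le_1[of "\<Union>j\<in>cubes r. mesh_cube r j"] by linarith
qed

definition entropy_sum :: "real \<Rightarrow> real" where
  "entropy_sum r = (\<Sum>j\<in>cubes r. prob (mesh_cube r j) * ln (prob (mesh_cube r j)))"

lemma charged_cubes:
  assumes r: "0 < r"
  shows "finite (charged_mesh_cubes \<nu> r)"
    and "(\<Sum>\<^sub>\<infinity>C\<in>charged_mesh_cubes \<nu> r. prob C * ln (prob C)) = entropy_sum r"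
proof -
  let ?J = "{j. prob (mesh_cube r j) > 0}"
  have eq: "charged_mesh_cubes \<nu> r = mesh_cube r ` ?J"
    by (auto simp: charged_mesh_cubes_def)
  have sub: "?J \<subseteq> cubes r"
  proof clarify
    fix j assume j: "0 < prob (mesh_cube r j)" "mesh_cube r j \<inter> cball 0 R = {}"
    then have "prob (mesh_cube r j) + prob (cball 0 R) = prob (mesh_cube r j \<union> cball 0 R)"
      by (intro finite_measure_Union[symmetric]) (auto simp: sets_nu)
    then show False using j support prob_le_1[of "mesh_cube r j \<union> cball 0 R"] by linarith
  qed
  then have fin: "finite ?J" using finite_cubes[OF r] finite_subset by blast
  then show "finite (charged_mesh_cubes \<nu> r)" by (simp add: eq)
  have inj: "inj_on (mesh_cube r) ?J"
  proof (rule inj_onI)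
    fix i j assume ij: "i \<in> ?J" "mesh_cube r i = mesh_cube r j"
    then have "mesh_cube r i \<noteq> {}" by (metis (mono_tags) mem_Collect_eq measure_empty less_irrefl)
    then obtain x where "x \<in> mesh_cube r i" by blast
    then show "i = j" using ij mesh_cube_iff[OF r, of x i] mesh_cube_iff[OF r, of x j] by simp
  qed
  have "(\<Sum>\<^sub>\<infinity>C\<in>charged_mesh_cubes \<nu> r. prob C * ln (prob C)) = (\<Sum>j\<in>?J. prob (mesh_cube r j) * ln (prob (mesh_cube r j)))"
    unfolding eq using fin by (simp add: sum.reindex[OF inj])
  \<comment> \<open>Cubes that meet the support without carrying mass contribute 0 * ln 0 =
    0.\<close>
  also have "\<dots> = entropy_sum r"
    unfolding entropy_sum_def using finite_cubes[OF r] sub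
    by (intro sum.mono_neutral_left) (auto simp: not_less measure_le_0_iff)
  finally show "(\<Sum>\<^sub>\<infinity>C\<in>charged_mesh_cubes \<nu> r. prob C * ln (prob C)) = entropy_sum r" .
qed

lemma sum_prob_cubes_subset:
  assumes r: "0 < r" and I: "I \<subseteq> cubes r" and A: "A \<in> sets borel" "\<And>j. j \<in> I \<Longrightarrow> mesh_cube r j \<subseteq> A"
  shows "(\<Sum>j\<in>I. prob (mesh_cube r j)) \<le> prob A"
proof -
  have "finite I" using finite_cubes[OF r] I finite_subset by blast
  then show ?thesis
    using A by (subst prob_UN_cubes[OF r, symmetric]) (auto intro!: finite_measure_mono simp: sets_nu)
qed

text \<open>A cube containing a point outside B r lies in the ball of radius N r about that point,
  so its mass a is at most (N r)^(d-e) and it contributes at least a (d-e) |ln (N r)|. The cubes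
  inside B r carry at most the mass of B r, which tends to 0, and their contribution is
  nonnegative.\<close>

lemma entropy_lower:
  assumes e: "0 < e" "e < d"
  shows "\<forall>\<^sub>F r in at_right 0. d - 2 * e \<le> entropy_sum r / ln r"
proof -
  let ?N = "real CARD('n)"
  have N: "?N \<ge> 1" by (simp add: Suc_leI)
  define B where "B r = {x. \<not> prob (cball x (?N * r)) \<le> (?N * r) powr (d - e)}" for r
  have Bm: "B r \<in> sets borel" for r unfolding B_def by measurable
  have fl: "filterlim (\<lambda>r. ?N * r) (at_right 0) (at_right 0)"
    using N by (intro filterlim_times_pos) (auto simp: filterlim_ident)
  have "AE x in \<nu>. \<forall>\<^sub>F r in at_right 0. x \<notin> B r"
    using local_dim[OF e(1)]
  proof eventually_elim
    case (elim x)
    have "\<forall>\<^sub>F r in at_right 0. (?N * r) powr (d + e) \<le> prob (cball x (?N * r)) \<and> prob (cball x (?N * r)) \<le> (?N * r) powr (d - e)"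
      using filterlim_iff[THEN iffD1, OF fl, rule_format, OF elim] .
    then show ?case by eventually_elim (simp add: B_def)
  qed
  then have lim0: "((\<lambda>r. prob (B r)) \<longlongrightarrow> 0) (at_right 0)"
    by (intro prob_AE_eventually_tendsto_0) (auto simp: sets_nu Bm)
  have "((\<lambda>r. (1 - prob (B r)) * (d - e) * ((ln ?N + ln r) / ln r)) \<longlongrightarrow> (1 - 0) * (d - e) * 1) (at_right 0)"
    by (intro tendsto_mult tendsto_diff tendsto_const lim0) real_asymp
  then have "\<forall>\<^sub>F r in at_right 0. d - 2 * e < (1 - prob (B r)) * (d - e) * ((ln ?N + ln r) / ln r)"
    using e by (intro order_tendstoD(1)) auto
  moreover have "\<forall>\<^sub>F r in at_right (0::real). r < 1 / ?N"
    using N by (intro eventually_at_rightI[of 0 "1 / ?N"]) auto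
  ultimately show ?thesis
    using eventually_at_right_less[of 0]
  proof eventually_elim
    case (elim r)
    then have r: "0 < r" "?N * r < 1" using N by (auto simp: field_simps)
    have r1: "r < 1" using mult_right_mono[of 1 ?N r] N r by linarith
    define M where "M = (d - e) * - ln (?N * r)"
    have M: "0 \<le> M" using e r N by (auto simp: M_def mult_nonneg_nonpos)
    let ?a = "\<lambda>j. prob (mesh_cube r j)"
    define I where "I = {j \<in> cubes r. mesh_cube r j \<subseteq> B r}"
    have fin: "finite (cubes r)" by (rule finite_cubes[OF r(1)])
    have "I \<subseteq> cubes r" by (auto simp: I_def)
    then have "(\<Sum>j\<in>cubes r - I. ?a j) + (\<Sum>j\<in>I. ?a j) = 1"
      using sum.subset_diff[OF _ fin, of I ?a] sum_prob_cubes[OF r(1)] by simp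
    moreover have "(\<Sum>j\<in>I. ?a j) \<le> prob (B r)"
      by (rule sum_prob_cubes_subset[OF r(1) _ Bm]) (auto simp: I_def)
    ultimately have good: "1 - prob (B r) \<le> (\<Sum>j\<in>cubes r - I. ?a j)" by linarith
    have "(1 - prob (B r)) * M \<le> (\<Sum>j\<in>cubes r - I. ?a j) * M"
      using good M by (rule mult_right_mono)
    also have "\<dots> \<le> (\<Sum>j\<in>cubes r - I. - (?a j * ln (?a j)))"
      unfolding sum_distrib_right
    proof (rule sum_mono)
      fix j assume "j \<in> cubes r - I"
      then obtain x where x: "x \<in> mesh_cube r j" "x \<notin> B r" by (auto simp: I_def)
      show "?a j * M \<le> - (?a j * ln (?a j))"
      proof (cases "?a j = 0")
        case False
        then have a: "0 < ?a j" by (simp add: less_le)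
        have "mesh_cube r j \<subseteq> cball x (?N * r)"
          using mesh_cube_diameter[OF r(1) x(1)] by (auto simp: dist_norm)
        then have "?a j \<le> prob (cball x (?N * r))" by (intro finite_measure_mono) (auto simp: sets_nu)
        also have "\<dots> \<le> (?N * r) powr (d - e)" using x(2) by (simp add: B_def)
        finally have "ln (?a j) \<le> ln ((?N * r) powr (d - e))" using a by (intro ln_mono) auto
        also have "\<dots> = - M" using r N by (simp add: ln_powr M_def)
        finally have "?a j * M \<le> ?a j * - ln (?a j)" using a by (intro mult_left_mono) auto
        then show ?thesis by simp
      qed simp
    qed
    also have "\<dots> \<le> (\<Sum>j\<in>cubes r. - (?a j * ln (?a j)))"
    proof (rule sum_mono2[OF fin])
      fix j
      have "ln (?a j) \<le> 0" by (cases "?a j = 0") (auto simp: less_le)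
      then show "0 \<le> - (?a j * ln (?a j))" by (simp add: mult_nonneg_nonpos)
    qed auto
    finally have main: "(1 - prob (B r)) * M \<le> - entropy_sum r"
      by (simp add: entropy_sum_def sum_negf)
    have ln: "ln r < 0" using r r1 by simp
    have "(1 - prob (B r)) * (d - e) * ((ln ?N + ln r) / ln r) = (1 - prob (B r)) * M / - ln r"
      using r N ln by (simp add: M_def ln_mult field_simps)
    also have "\<dots> \<le> - entropy_sum r / - ln r"
      using main ln by (intro divide_right_mono) auto
    finally show ?case using elim(1) by simp
  qed
qed

text \<open>Cubes of mass at least r^(d+2e) contribute at most (d + 2e) |ln r| together. The lighter
  ones have small total mass: some lie in B r, and each other one has at most the fraction r^e of
  the mass of a ball of radius r about one of its points, where these balls have bounded overlap. As
  the number of cubes is polynomial in 1/r, a family of vanishing total mass adds only o(|ln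
  r|).\<close>

lemma entropy_upper:
  assumes e: "0 < e"
  shows "\<forall>\<^sub>F r in at_right 0. entropy_sum r / ln r \<le> d + 3 * e"
proof -
  let ?N = "real CARD('n)"
  define B where "B r = {x. \<not> r powr (d + e) \<le> prob (cball x r)}" for r
  have Bm: "B r \<in> sets borel" for r unfolding B_def by measurable
  have "AE x in \<nu>. \<forall>\<^sub>F r in at_right 0. x \<notin> B r"
    using local_dim[OF e]
  proof eventually_elim
    case (elim x)
    then show ?case by eventually_elim (simp add: B_def)
  qed
  then have lim0: "((\<lambda>r. prob (B r)) \<longlongrightarrow> 0) (at_right 0)"
    by (intro prob_AE_eventually_tendsto_0) (auto simp: sets_nu Bm)
  \<comment> \<open>K / r^N bounds the number of cubes of side r meeting the support, and K2 the
    number of those meeting a given ball of radius r.\<close>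
  define K K2 where "K = measure lborel (cball (0::real^'n) (R + CARD('n)))"
    and "K2 = unit_ball_vol ?N * (1 + ?N) ^ CARD('n)"
  have K: "K > 0" using R by (simp add: K_def content_cball unit_ball_vol_pos add_nonneg_pos)
  define \<eta> where "\<eta> r = prob (B r) + K2 * r powr e" for r
  have "((\<lambda>r. r powr e) \<longlongrightarrow> 0) (at_right 0)" using e by real_asymp
  then have "(\<eta> \<longlongrightarrow> 0 + K2 * 0) (at_right 0)"
    unfolding \<eta>_def by (intro tendsto_intros lim0)
  moreover have "((\<lambda>r. (ln K + ?N * - ln r) / - ln r) \<longlongrightarrow> ?N) (at_right 0)" by real_asymp
  moreover have "((\<lambda>r. 1 / - ln r) \<longlongrightarrow> (0::real)) (at_right 0)" by real_asymp
  ultimately have "((\<lambda>r. d + 2 * e + \<eta> r * ((ln K + ?N * - ln r) / - ln r) + 1 / - ln r)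
      \<longlongrightarrow> d + 2 * e + (0 + K2 * 0) * ?N + 0) (at_right 0)"
    by (intro tendsto_intros)
  then have "\<forall>\<^sub>F r in at_right 0. d + 2 * e + \<eta> r * ((ln K + ?N * - ln r) / - ln r) + 1 / - ln r < d + 3 * e"
    using e by (intro order_tendstoD(2)) auto
  moreover have "\<forall>\<^sub>F r in at_right (0::real). r < 1"
    by (intro eventually_at_rightI[of 0 1]) auto
  ultimately show ?thesis
    using eventually_at_right_less[of 0]
  proof eventually_elim
    case (elim r)
    then have r: "0 < r" "r < 1" by auto
    have ln: "ln r < 0" using r by simp
    let ?a = "\<lambda>j. prob (mesh_cube r j)"
    have fin: "finite (cubes r)" by (rule finite_cubes[OF r(1)])
    define S where "S = {j \<in> cubes r. ?a j < r powr (d + 2 * e)}"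
    define I where "I = {j \<in> S. mesh_cube r j \<subseteq> B r}"
    have SI: "S \<subseteq> cubes r" "I \<subseteq> S" by (auto simp: S_def I_def)
    have finS: "finite S" using fin SI finite_subset by blast
    have I: "(\<Sum>j\<in>I. ?a j) \<le> prob (B r)"
      by (rule sum_prob_cubes_subset[OF r(1) _ Bm]) (auto simp: I_def S_def)
    have "\<exists>x. x \<in> mesh_cube r j \<and> x \<notin> B r" if "j \<in> S - I" for j
      using that by (auto simp: I_def)
    then obtain x where x: "\<And>j. j \<in> S - I \<Longrightarrow> x j \<in> mesh_cube r j \<and> x j \<notin> B r" by metis
    have "(\<Sum>j\<in>S - I. ?a j) \<le> (\<Sum>j\<in>S - I. r powr e * prob (cball (x j) r))"
    proof (rule sum_mono)
      fix j assume j: "j \<in> S - I"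
      have "?a j \<le> r powr (d + 2 * e)" using j by (simp add: S_def)
      also have "\<dots> = r powr e * r powr (d + e)" by (simp add: powr_add[symmetric] algebra_simps)
      also have "\<dots> \<le> r powr e * prob (cball (x j) r)"
        using x[OF j] by (intro mult_left_mono) (auto simp: B_def)
      finally show "?a j \<le> r powr e * prob (cball (x j) r)" .
    qed
    also have "\<dots> = r powr e * (\<integral>y. (\<Sum>j\<in>S - I. indicator (cball (x j) r) y) \<partial>\<nu>)"
      by (subst Bochner_Integration.integral_sum) (auto simp: sum_distrib_left space_nu sets_nu emeasure_eq_measure)
    also have "(\<integral>y. (\<Sum>j\<in>S - I. indicator (cball (x j) r) y) \<partial>\<nu>) \<le> (\<integral>y. K2 \<partial>\<nu>)"
    proof (rule integral_mono)
      show "integrable \<nu> (\<lambda>y. \<Sum>j\<in>S - I. indicator (cball (x j) r) y :: real)"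
        by (intro Bochner_Integration.integrable_sum integrable_real_indicator)
          (auto simp: sets_nu emeasure_eq_measure)
      fix y :: "real^'n"
      let ?Y = "{j. mesh_cube r j \<inter> cball y r \<noteq> {}}"
      have V: "cball y ((1 + ?N) * r) \<in> fmeasurable lborel" by (rule fmeasurable_compact) simp
      have sub: "v \<in> cball y ((1 + ?N) * r)" if "u \<in> cball y r" "norm (v - u) \<le> ?N * r" for u v :: "real^'n"
        using that dist_triangle[of y v u] by (simp add: dist_norm norm_minus_commute algebra_simps)
      have finY: "finite ?Y" by (rule card_mesh_cubes_le(1)[OF r(1) V sub])
      have "real (card ?Y) * r ^ CARD('n) \<le> measure lborel (cball y ((1 + ?N) * r))"
        by (rule card_mesh_cubes_le(2)[OF r(1) V sub])
      also have "\<dots> = K2 * r ^ CARD('n)"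
        using r by (simp add: content_cball K2_def power_mult_distrib)
      finally have cY: "real (card ?Y) \<le> K2" using r by simp
      have "(\<Sum>j\<in>S - I. indicator (cball (x j) r) y :: real) = real (card {j \<in> S - I. y \<in> cball (x j) r})"
        using finS by (simp add: indicator_def sum.If_cases Int_def)
      also have "\<dots> \<le> real (card ?Y)"
      proof (intro of_nat_mono card_mono finY subsetI CollectI)
        fix j assume j: "j \<in> {j \<in> S - I. y \<in> cball (x j) r}"
        then have "x j \<in> mesh_cube r j" "x j \<in> cball y r" using x[of j] by (auto simp: dist_commute)
        then show "mesh_cube r j \<inter> cball y r \<noteq> {}" by blast
      qed
      finally show "(\<Sum>j\<in>S - I. indicator (cball (x j) r) y) \<le> K2" using cY by linarith
    qed simp
    also have "(\<integral>y. K2 \<partial>\<nu>) = K2" by (simp add: prob_space)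
    finally have "(\<Sum>j\<in>S - I. ?a j) \<le> r powr e * K2" by (simp add: mult_left_mono)
    then have \<eta>: "(\<Sum>j\<in>S. ?a j) \<le> \<eta> r"
      using sum.subset_diff[OF SI(2) finS, of ?a] I by (simp add: \<eta>_def mult.commute)
    define c where "c = real (card (cubes r))"
    have "cubes r \<noteq> {}" using sum_prob_cubes[OF r(1)] by force
    then have c: "c \<ge> 1" unfolding c_def using fin by (simp add: Suc_leI card_gt_0_iff)
    have "c \<le> K / r ^ CARD('n)"
      using card_cubes(2)[of r] r by (simp add: c_def K_def field_simps)
    then have "ln c \<le> ln (K / r ^ CARD('n))" using c by simp
    also have "\<dots> = ln K + ?N * - ln r"
      using K r by (simp add: ln_div ln_realpow)
    finally have lnc: "ln c \<le> ln K + ?N * - ln r" .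
    have "(\<Sum>j\<in>S. - (?a j * ln (?a j))) \<le> (\<Sum>j\<in>S. ?a j * ln c + 1 / c)"
      using c by (intro sum_mono neg_mult_ln_le) auto
    also have "\<dots> = (\<Sum>j\<in>S. ?a j) * ln c + real (card S) / c"
      by (simp add: sum.distrib sum_distrib_right)
    also have "\<dots> \<le> \<eta> r * (ln K + ?N * - ln r) + 1"
    proof (intro add_mono mult_mono \<eta> lnc)
      show "real (card S) / c \<le> 1" unfolding c_def using card_mono[OF fin SI(1)] c c_def by simp
      show "0 \<le> ln c" using c by simp
      show "0 \<le> \<eta> r" by (rule order_trans[OF sum_nonneg \<eta>]) simp
    qed
    finally have 1: "(\<Sum>j\<in>S. - (?a j * ln (?a j))) \<le> \<eta> r * (ln K + ?N * - ln r) + 1" .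
    have "(\<Sum>j\<in>cubes r - S. - (?a j * ln (?a j))) \<le> (\<Sum>j\<in>cubes r - S. ?a j * ((d + 2 * e) * - ln r))"
    proof (rule sum_mono)
      fix j assume "j \<in> cubes r - S"
      then have a: "r powr (d + 2 * e) \<le> ?a j" by (auto simp: S_def)
      moreover have "0 < r powr (d + 2 * e)" using r by simp
      ultimately have "ln (r powr (d + 2 * e)) \<le> ln (?a j)" by (intro ln_mono) auto
      then have "- ln (?a j) \<le> (d + 2 * e) * - ln r" using r by (simp add: ln_powr)
      then have "?a j * - ln (?a j) \<le> ?a j * ((d + 2 * e) * - ln r)" by (intro mult_left_mono) auto
      then show "- (?a j * ln (?a j)) \<le> ?a j * ((d + 2 * e) * - ln r)" by simp
    qed
    also have "\<dots> = (\<Sum>j\<in>cubes r - S. ?a j) * ((d + 2 * e) * - ln r)" by (simp only: sum_distrib_right)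
    also have "\<dots> \<le> 1 * ((d + 2 * e) * - ln r)"
    proof (rule mult_right_mono)
      have "(\<Sum>j\<in>cubes r - S. ?a j) \<le> (\<Sum>j\<in>cubes r. ?a j)" using fin by (intro sum_mono2) auto
      then show "(\<Sum>j\<in>cubes r - S. ?a j) \<le> 1" using sum_prob_cubes[OF r(1)] by simp
      show "0 \<le> (d + 2 * e) * - ln r" using d e ln by (intro mult_nonneg_nonneg) auto
    qed
    finally have 2: "(\<Sum>j\<in>cubes r - S. - (?a j * ln (?a j))) \<le> (d + 2 * e) * - ln r" by simp
    have "- entropy_sum r = (\<Sum>j\<in>cubes r - S. - (?a j * ln (?a j))) + (\<Sum>j\<in>S. - (?a j * ln (?a j)))"
      unfolding entropy_sum_def sum_negf[symmetric] by (rule sum.subset_diff[OF SI(1) fin])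
    also have "\<dots> \<le> (d + 2 * e) * - ln r + (\<eta> r * (ln K + ?N * - ln r) + 1)" using 1 2 by linarith
    finally have "- entropy_sum r / - ln r \<le> ((d + 2 * e) * - ln r + (\<eta> r * (ln K + ?N * - ln r) + 1)) / - ln r"
      using ln by (intro divide_right_mono) auto
    also have "\<dots> = d + 2 * e + \<eta> r * ((ln K + ?N * - ln r) / - ln r) + 1 / - ln r"
    proof -
      have "(a * x + (h * b + 1)) / x = a + h * (b / x) + 1 / x" if "x \<noteq> 0" for a b h x :: real
        using that by (simp add: add_divide_distrib)
      from this[of "- ln r"] show ?thesis using ln by (simp only: neg_equal_0_iff_equal less_imp_neq not_False_eq_True)
    qed
    finally show ?case using elim(1) by simp
  qed
qed

theorem has_information_dimension: "has_information_dimension \<nu> d"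
  unfolding has_information_dimension_def
proof (intro conjI allI impI)
  show "(\<lambda>C. measure \<nu> C * ln (measure \<nu> C)) summable_on charged_mesh_cubes \<nu> r" if "r > 0" for r
    using charged_cubes(1)[OF that] by (rule summable_on_finite)
  have "((\<lambda>r. entropy_sum r / ln r) \<longlongrightarrow> d) (at_right 0)"
  proof (rule tendstoI)
    fix \<epsilon> :: real assume "\<epsilon> > 0"
    define e where "e = min (\<epsilon> / 4) (d / 2)"
    have e: "0 < e" "e < d" "4 * e \<le> \<epsilon>" using \<open>\<epsilon> > 0\<close> d by (auto simp: e_def)
    show "\<forall>\<^sub>F r in at_right 0. dist (entropy_sum r / ln r) d < \<epsilon>"
      using entropy_lower[OF e(1,2)] entropy_upper[OF e(1)]
      by eventually_elim (use e in \<open>auto simp: dist_real_def abs_less_iff\<close>)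
  qed
  moreover have "\<forall>\<^sub>F r in at_right 0. entropy_sum r / ln r
      = (\<Sum>\<^sub>\<infinity>C\<in>charged_mesh_cubes \<nu> r. measure \<nu> C * ln (measure \<nu> C)) / ln r"
    using eventually_at_right_less[of 0] by eventually_elim (simp add: charged_cubes(2))
  ultimately show "((\<lambda>r. (\<Sum>\<^sub>\<infinity>C\<in>charged_mesh_cubes \<nu> r. measure \<nu> C * ln (measure \<nu> C)) / ln r) \<longlongrightarrow> d) (at_right 0)"
    by (rule Lim_transform_eventually)
qed

end

subsection \<open>Upper bound for the local dimension\<close>

text \<open>At level k the labels whose class is lighter than its weight have total probability at
  most the sum of the weights, which is summable in k; Borel-Cantelli then excludes them from some
  level on.\<close>

lemma (in prob_space) AE_label_prob_ge:
  fixes f :: "nat \<Rightarrow> 'a \<Rightarrow> 'b" and w :: "nat \<Rightarrow> 'b \<Rightarrow> real"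
  assumes f: "\<And>k b. {x \<in> space M. f k x = b} \<in> events"
    and L: "\<And>k. finite (L k)" "\<And>k x. x \<in> space M \<Longrightarrow> f k x \<in> L k"
    and w: "\<And>k. (\<Sum>b\<in>L k. w k b) \<le> 1 / (real (Suc k))\<^sup>2" "\<And>k b. b \<in> L k \<Longrightarrow> 0 \<le> w k b"
  shows "AE x in M. \<forall>\<^sub>F k in sequentially. w k (f k x) \<le> prob {y \<in> space M. f k y = f k x}"
proof -
  define Bad where "Bad k = (\<Union>b\<in>{b \<in> L k. prob {x \<in> space M. f k x = b} < w k b}. {x \<in> space M. f k x = b})" for k
  have Bm: "Bad k \<in> events" for k
    unfolding Bad_def using L(1)[of k] f by (intro sets.finite_UN) auto
  have "prob (Bad k) \<le> 1 / (real (Suc k))\<^sup>2" for k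
  proof -
    let ?S = "{b \<in> L k. prob {x \<in> space M. f k x = b} < w k b}"
    have "prob (Bad k) \<le> (\<Sum>b\<in>?S. prob {x \<in> space M. f k x = b})"
      unfolding Bad_def using L(1)[of k] f by (intro finite_measure_subadditive_finite) auto
    also have "\<dots> \<le> (\<Sum>b\<in>?S. w k b)" by (intro sum_mono) auto
    also have "\<dots> \<le> (\<Sum>b\<in>L k. w k b)" using L(1)[of k] w(2) by (intro sum_mono2) auto
    also note w(1)[of k]
    finally show ?thesis .
  qed
  moreover have "summable (\<lambda>k. 1 / (real (Suc k))\<^sup>2)"
    using inverse_power_summable[of 2, where 'a = real] unfolding summable_Suc_iff[symmetric, of "\<lambda>n. inverse (of_nat n ^ 2)"]
    by (simp add: inverse_eq_divide)
  ultimately have "summable (\<lambda>k. prob (Bad k))"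
    by (intro summable_comparison_test[OF _ \<open>summable (\<lambda>k. 1 / (real (Suc k))\<^sup>2)\<close>]) auto
  then have "AE x in M. \<forall>\<^sub>F k in sequentially. x \<in> space M - Bad k"
    using Bm by (intro borel_cantelli_AE1) (auto simp: emeasure_eq_measure)
  then show ?thesis
  proof (rule AE_mp, intro AE_I2 impI)
    fix x assume x: "x \<in> space M" and ev: "\<forall>\<^sub>F k in sequentially. x \<in> space M - Bad k"
    show "\<forall>\<^sub>F k in sequentially. w k (f k x) \<le> prob {y \<in> space M. f k y = f k x}"
      using ev by eventually_elim (use L(2)[OF x] x in \<open>force simp: Bad_def not_less\<close>)
  qed
qed

text \<open>For a given r, let k be the first index from k0 on with N \<rho> k \<le> r. Its
  predecessor exceeds r / N, so \<rho> k is at least c r / N, and the gap t - s in the exponents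
  absorbs the constant. Taking the first index makes monotone scales dispensable.\<close>

lemma eventually_powr_le_from_scales:
  fixes F \<rho> :: "_ \<Rightarrow> real"
  assumes F: "mono F" and N: "N \<ge> 1" and c: "0 < c" "c \<le> 1" and s: "0 \<le> s" "s < t"
    and r: "\<And>k. 0 < \<rho> k" "\<rho> \<longlonglongrightarrow> 0" "\<And>k. c * \<rho> k \<le> \<rho> (Suc k)"
    and ev: "\<forall>\<^sub>F k in sequentially. \<rho> k powr s \<le> F (N * \<rho> k)"
  shows "\<forall>\<^sub>F r in at_right 0. r powr t \<le> F r"
proof -
  obtain k0 where k0: "\<And>k. k \<ge> k0 \<Longrightarrow> \<rho> k powr s \<le> F (N * \<rho> k)"
    using ev by (auto simp: eventually_sequentially)
  have "((\<lambda>r. r powr (t - s)) \<longlongrightarrow> 0) (at_right (0::real))" using s by real_asymp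
  then have "\<forall>\<^sub>F r in at_right 0. r powr (t - s) < (c / N) powr s"
    by (rule order_tendstoD(2)) (use c N in auto)
  moreover have "\<forall>\<^sub>F r in at_right 0. r < N * \<rho> k0"
    using N r(1)[of k0] by (intro eventually_at_rightI[of 0 "N * \<rho> k0"]) auto
  ultimately show ?thesis using eventually_at_right_less[of 0]
  proof eventually_elim
    case (elim r)
    have dec: "\<exists>k\<ge>k0. N * \<rho> k \<le> r"
    proof -
      have "\<forall>\<^sub>F k in sequentially. \<rho> k < r / N"
        by (rule order_tendstoD(2)[OF r(2)]) (use elim N in auto)
      then have "\<forall>\<^sub>F k in sequentially. \<rho> k < r / N \<and> k \<ge> k0"
        using eventually_ge_at_top by eventually_elim auto
      then obtain k where "\<rho> k < r / N" "k \<ge> k0" by (auto simp: eventually_sequentially)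
      then show ?thesis using N by (intro exI[of _ k]) (auto simp: field_simps)
    qed
    define k where "k = (LEAST k. k \<ge> k0 \<and> N * \<rho> k \<le> r)"
    have k: "k \<ge> k0" "N * \<rho> k \<le> r" using LeastI_ex[OF dec[unfolded Bex_def]] dec
      by (auto simp: k_def intro: LeastI2_ex)
    have "k \<noteq> k0" using k(2) elim(2) by auto
    then obtain k' where k': "k = Suc k'" "k' \<ge> k0" using k(1) by (cases k) auto
    have "\<not> N * \<rho> k' \<le> r"
      using not_less_Least[of k' "\<lambda>k. k \<ge> k0 \<and> N * \<rho> k \<le> r"] k' by (simp add: k_def)
    then have "r / N \<le> \<rho> k'" using N by (simp add: field_simps)
    then have "c * (r / N) \<le> c * \<rho> k'" using c by (intro mult_left_mono) auto
    also have "\<dots> \<le> \<rho> k" using r(3) k' by simp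
    finally have rk: "c / N * r \<le> \<rho> k" by simp
    have "r powr t = r powr (t - s) * r powr s" by (simp flip: powr_add)
    also have "\<dots> \<le> (c / N) powr s * r powr s" using elim by (intro mult_right_mono) auto
    also have "\<dots> = (c / N * r) powr s" using c N elim by (subst powr_mult) auto
    also have "\<dots> \<le> \<rho> k powr s" using rk c N elim s by (intro powr_mono2) auto
    also have "\<dots> \<le> F (N * \<rho> k)" using k by (intro k0)
    also have "\<dots> \<le> F r" by (rule monoD[OF F k(2)])
    finally show ?case .
  qed
qed

text \<open>The common initial part of all \<open>x\<^sup>\<omega>(i)\<close> with \<open>i\<close> in the cylinder of \<open>w\<close>.\<close>

definition word_point :: "(nat \<Rightarrow> real^'n \<Rightarrow> real^'n) \<Rightarrow> (nat list \<Rightarrow> real^'n) \<Rightarrow> nat list \<Rightarrow> real^'n" where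
  "word_point T \<omega> w = (\<Sum>j<length w. word_map T (take j w) (\<omega> (take (Suc j) w)))"

lemma take_prefix_word: "j \<le> k \<Longrightarrow> take j (prefix_word x k) = prefix_word x j"
  by (simp add: prefix_word_def take_map)

locale bounded_family = self_affine m p T \<kappa> \<Lambda> q Q
  for m :: nat and p :: "nat \<Rightarrow> real" and T :: "nat \<Rightarrow> real^'n \<Rightarrow> real^'n" and \<kappa> \<Lambda> q Q +
  fixes \<omega> :: "nat list \<Rightarrow> real^'n" and R :: real
  assumes R: "0 \<le> R" and \<omega>_bound: "\<And>w. w \<in> words m \<Longrightarrow> norm (\<omega> w) \<le> R"
begin

section \<open>Code points and cylinder pieces of one bounded family\<close>

abbreviation pt :: "(nat \<Rightarrow> nat) \<Rightarrow> real^'n" where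
  "pt \<equiv> code_point T \<omega>"

definition radius :: real where
  "radius = R / (1 - \<Lambda>)"

lemma radius_nonneg: "0 \<le> radius"
  using R Lam by (simp add: radius_def)

lemma term_bound:
  assumes "x \<in> code_space m"
  shows "norm (word_map T (prefix_word x k) (\<omega> (prefix_word x (Suc k)))) \<le> R * \<Lambda> ^ k"
proof -
  have "norm (word_map T (prefix_word x k) (\<omega> (prefix_word x (Suc k)))) \<le> \<Lambda> ^ k * norm (\<omega> (prefix_word x (Suc k)))"
    using word_map_bounds(2)[OF prefix_word_in_words'[OF assms, of k]] by simp
  also have "\<dots> \<le> \<Lambda> ^ k * R"
    using \<omega>_bound[OF prefix_word_in_words'[OF assms]] Lam by (intro mult_left_mono) auto
  finally show ?thesis by (simp add: mult.commute)
qed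

lemma summable_geometric_bound: "summable (\<lambda>k. R * \<Lambda> ^ k)"
  using Lam by (intro summable_mult summable_geometric) auto

lemma summable_terms:
  assumes "x \<in> code_space m"
  shows "summable (\<lambda>k. word_map T (prefix_word x k) (\<omega> (prefix_word x (Suc k))))"
  by (rule summable_comparison_test[OF _ summable_geometric_bound]) (use term_bound[OF assms] in auto)

lemma norm_pt_le:
  assumes x: "x \<in> code_space m"
  shows "norm (pt x) \<le> radius"
proof -
  have "norm (pt x) \<le> (\<Sum>k. R * \<Lambda> ^ k)"
    unfolding code_point_def by (rule norm_suminf_le[OF term_bound[OF x] summable_geometric_bound])
  also have "\<dots> = radius"
    using Lam by (simp add: radius_def suminf_mult suminf_geometric)
  finally show ?thesis .
qed

text \<open>After level k the series is the map of the prefix applied to the code point of the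
  shifted sequence, for the family of vectors indexed by extensions of the prefix. That family
  satisfies the same bounds, so its code points stay in the same ball.\<close>

lemma pt_in_image:
  assumes x: "x \<in> code_space m"
  shows "pt x \<in> (\<lambda>z. word_map T (prefix_word x k) z + word_point T \<omega> (prefix_word x k)) ` cball 0 radius"
proof -
  let ?w = "prefix_word x k"
  let ?y = "shift k x"
  have y: "?y \<in> code_space m" by (rule shift_in_code_space[OF x])
  have w: "?w \<in> words m" by (rule prefix_word_in_words'[OF x])
  interpret tail: bounded_family m p T \<kappa> \<Lambda> q Q "\<lambda>v. \<omega> (?w @ v)" R
    by unfold_locales (use R \<omega>_bound w words_append in auto)
  define z where "z = code_point T (\<lambda>v. \<omega> (?w @ v)) ?y"
  have "z \<in> cball 0 radius"
    using tail.norm_pt_le[OF y] by (simp add: z_def radius_def tail.radius_def)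
  moreover have "pt x = word_map T ?w z + word_point T \<omega> ?w"
  proof -
    have bl: "bounded_linear (word_map T ?w)"
      using word_map_linear_bij(1)[OF w] by (simp add: linear_conv_bounded_linear)
    have "pt x = (\<Sum>n. word_map T (prefix_word x (n + k)) (\<omega> (prefix_word x (Suc (n + k)))))
        + (\<Sum>j<k. word_map T (prefix_word x j) (\<omega> (prefix_word x (Suc j))))"
      unfolding code_point_def by (rule suminf_split_initial_segment[OF summable_terms[OF x]])
    also have "(\<Sum>j<k. word_map T (prefix_word x j) (\<omega> (prefix_word x (Suc j)))) = word_point T \<omega> ?w"
      unfolding word_point_def length_prefix_word by (intro sum.cong refl) (simp add: take_prefix_word)
    also have "(\<Sum>n. word_map T (prefix_word x (n + k)) (\<omega> (prefix_word x (Suc (n + k)))))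
        = (\<Sum>n. word_map T ?w (word_map T (prefix_word ?y n) (\<omega> (?w @ prefix_word ?y (Suc n)))))"
    proof (rule arg_cong[where f = suminf], rule ext)
      fix n
      have 1: "prefix_word x (n + k) = ?w @ prefix_word ?y n" by (simp add: add.commute prefix_word_add)
      have 2: "prefix_word x (Suc (n + k)) = ?w @ prefix_word ?y (Suc n)"
        using prefix_word_add[of x k "Suc n"] by (simp add: add.commute)
      show "word_map T (prefix_word x (n + k)) (\<omega> (prefix_word x (Suc (n + k))))
        = word_map T ?w (word_map T (prefix_word ?y n) (\<omega> (?w @ prefix_word ?y (Suc n))))"
        unfolding 1 2 word_map_append o_apply ..
    qed
    also have "\<dots> = word_map T ?w z"
      unfolding z_def code_point_def by (rule bounded_linear.suminf[OF bl tail.summable_terms[OF y], symmetric])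
    finally show ?thesis .
  qed
  ultimately show ?thesis by blast
qed

lemma measurable_pt [measurable]: "pt \<in> borel_measurable bm"
proof -
  have "(\<lambda>x. word_map T (prefix_word x k) (\<omega> (prefix_word x (Suc k)))) \<in> borel_measurable bm" for k
  proof -
    have "(\<lambda>w. word_map T (take k w) (\<omega> w)) \<in> count_space UNIV \<rightarrow>\<^sub>M borel" by simp
    from measurable_compose[OF measurable_prefix_word[of "Suc k"] this] show ?thesis
      by (simp add: take_prefix_word)
  qed
  then show ?thesis unfolding code_point_def[abs_def] by measurable
qed

definition ball_prob :: "(nat \<Rightarrow> nat) \<Rightarrow> real \<Rightarrow> real" where
  "ball_prob x r = measure bm {y \<in> space bm. dist (pt x) (pt y) \<le> r}"

lemma mono_ball_prob: "mono (ball_prob x)"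
proof (rule monoI)
  fix r r' :: real assume "r \<le> r'"
  moreover have "{y \<in> space bm. dist (pt x) (pt y) \<le> r'} \<in> sets bm" by measurable
  ultimately show "ball_prob x r \<le> ball_prob x r'"
    unfolding ball_prob_def by (intro bm.finite_measure_mono) auto
qed

lemma mesh_label_measurable:
  assumes "r > 0"
  shows "{y \<in> space bm. (\<chi> i. \<lfloor>pt y $ i / r\<rfloor>) = j} \<in> sets bm"
proof -
  have "{y \<in> space bm. (\<chi> i. \<lfloor>pt y $ i / r\<rfloor>) = j} = {y \<in> space bm. pt y \<in> mesh_cube r j}"
    using mesh_cube_iff[OF assms] by auto
  also have "\<dots> \<in> sets bm" by measurable
  finally show ?thesis .
qed

lemma mesh_label_le_ball_prob:
  assumes r: "r > 0"
  shows "measure bm {y \<in> space bm. (\<chi> i. \<lfloor>pt y $ i / r\<rfloor>) = (\<chi> i. \<lfloor>pt x $ i / r\<rfloor>)} \<le> ball_prob x (real CARD('n) * r)"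
  unfolding ball_prob_def
proof (rule bm.finite_measure_mono)
  show "{y \<in> space bm. dist (pt x) (pt y) \<le> real CARD('n) * r} \<in> sets bm" by measurable
  show "{y \<in> space bm. (\<chi> i. \<lfloor>pt y $ i / r\<rfloor>) = (\<chi> i. \<lfloor>pt x $ i / r\<rfloor>)} \<subseteq> {y \<in> space bm. dist (pt x) (pt y) \<le> real CARD('n) * r}"
  proof safe
    fix y assume eq: "(\<chi> i. \<lfloor>pt y $ i / r\<rfloor>) = (\<chi> i. \<lfloor>pt x $ i / r\<rfloor>)"
    have "pt x \<in> mesh_cube r (\<chi> i. \<lfloor>pt x $ i / r\<rfloor>)" "pt y \<in> mesh_cube r (\<chi> i. \<lfloor>pt x $ i / r\<rfloor>)"
      unfolding mesh_cube_iff[OF r] using eq by auto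
    from mesh_cube_diameter[OF r this] show "dist (pt x) (pt y) \<le> real CARD('n) * r" by (simp add: dist_norm)
  qed
qed

text \<open>At the critical singular value \<open>sv_prod\<close> is exactly phi^s r^(N-s), which
  gives the cube count \<open>n_le\<close>. As s > d_1, phi^s is smaller than the probability of the
  word by a factor exp (- c k), and this pays for K and for the (k + 1)^2 of the Borel-Cantelli
  argument.\<close>

lemma AE_ball_prob_ge_below_dim:
  assumes s: "d1 m p T < s" "s \<le> real CARD('n)" "s < t"
  shows "AE x in bm. \<forall>\<^sub>F r in at_right 0. r powr t \<le> ball_prob x r"
proof -
  let ?N = "CARD('n)"
  have s0: "0 < s" using s d1_properties by simp
  define l where "l = nat \<lceil>s\<rceil>"
  have l: "l \<in> {1..?N}" using s0 s unfolding l_def by (auto simp: le_nat_iff ceiling_le_iff nat_le_iff)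
  define r where "r w = singular_value (word_map T w) l" for w
  have rpos: "0 < r w" if "w \<in> words m" for w
    unfolding r_def by (rule singular_value_pos[OF word_map_linear_bij[OF that] l])
  define J where "J w = {j. mesh_cube (r w) j \<inter> (\<lambda>z. word_map T w z + word_point T \<omega> w) ` cball 0 radius \<noteq> {}}" for w
  define n where "n w = real (card (J w))" for w
  define K where "K = (2 * (radius + real ?N)) ^ ?N"
  have K: "K > 0" unfolding K_def using radius_nonneg by (simp add: add_nonneg_pos)
  have finJ: "finite (J w)" if "w \<in> words m" for w
    unfolding J_def by (rule card_mesh_cubes_ball_image_le(1)[OF word_map_linear_bij[OF that] rpos[OF that] radius_nonneg])
  have n_le: "n w \<le> K * \<phi> s w * r w powr - s" if w: "w \<in> words m" for w
  proof -
    have "n w * r w ^ ?N \<le> K * sv_prod (word_map T w) (r w)"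
      unfolding n_def J_def K_def
      by (rule card_mesh_cubes_ball_image_le(2)[OF word_map_linear_bij[OF w] rpos[OF w] radius_nonneg])
    also have "sv_prod (word_map T w) (r w) = \<phi> s w * r w powr (real ?N - s)"
      unfolding \<phi>_def using s0 s
      by (intro sv_function_le_sv_prod(2)[OF word_map_linear_bij[OF w] _ _ rpos[OF w]]) (auto simp: r_def l_def)
    finally have "n w * r w ^ ?N \<le> (K * \<phi> s w * r w powr - s) * r w ^ ?N"
      using rpos[OF w] by (simp add: powr_diff powr_realpow powr_minus divide_simps)
    then show ?thesis using rpos[OF w] by simp
  qed
  define f where "f k x = (prefix_word x k, (\<chi> i. \<lfloor>pt x $ i / r (prefix_word x k)\<rfloor>) :: int^'n)" for k x
  define L where "L k = (SIGMA w:words_of_length m k. J w)" for k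
  \<comment> \<open>The probability of a word is divided equally among the cubes that its piece may
    meet, so that the weights of level k add up to at most 1 / (k + 1)^2.\<close>
  define wt where "wt k b = word_prob p (fst b) / (n (fst b) * (real (Suc k))\<^sup>2)" for k and b :: "nat list \<times> (int^'n)"
  have ww: "w \<in> words m" if "w \<in> words_of_length m k" for w k using that by (simp add: words_of_length_def)
  have fL: "f k x \<in> L k" if x: "x \<in> code_space m" for k x
  proof -
    have "pt x \<in> mesh_cube (r (prefix_word x k)) (snd (f k x))"
      unfolding mesh_cube_iff[OF rpos[OF prefix_word_in_words'[OF x]]] by (simp add: f_def)
    then have "snd (f k x) \<in> J (prefix_word x k)" using pt_in_image[OF x, of k] unfolding J_def by blast
    then show ?thesis using prefix_word_in_words[OF x] by (auto simp: L_def f_def)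
  qed
  have "AE x in bm. \<forall>\<^sub>F k in sequentially. wt k (f k x) \<le> measure bm {y \<in> space bm. f k y = f k x}"
  proof (rule bm.AE_label_prob_ge)
    fix k
    show "finite (L k)" unfolding L_def using finite_words_of_length finJ ww by (intro finite_SigmaI) blast+
    show "f k x \<in> L k" if "x \<in> space bm" for x using fL that by simp
    show "0 \<le> wt k b" if "b \<in> L k" for b
    proof -
      have "fst b \<in> words m" using that ww by (auto simp: L_def)
      then show ?thesis using word_prob_pos[of "fst b"] by (simp add: wt_def n_def)
    qed
    have "(\<Sum>b\<in>L k. wt k b) = (\<Sum>w\<in>words_of_length m k. \<Sum>j\<in>J w. wt k (w, j))"
      unfolding L_def using finite_words_of_length finJ ww by (subst sum.Sigma) auto
    also have "\<dots> \<le> (\<Sum>w\<in>words_of_length m k. word_prob p w / (real (Suc k))\<^sup>2)"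
    proof (rule sum_mono)
      fix w assume "w \<in> words_of_length m k"
      then have "0 < word_prob p w" using ww word_prob_pos by blast
      then show "(\<Sum>j\<in>J w. wt k (w, j)) \<le> word_prob p w / (real (Suc k))\<^sup>2"
        by (cases "card (J w) = 0") (auto simp: wt_def n_def divide_simps)
    qed
    also have "\<dots> = 1 / (real (Suc k))\<^sup>2"
      by (simp add: sum_word_prob flip: sum_divide_distrib)
    finally show "(\<Sum>b\<in>L k. wt k b) \<le> 1 / (real (Suc k))\<^sup>2" .
    fix b :: "nat list \<times> (int^'n)"
    show "{x \<in> space bm. f k x = b} \<in> sets bm"
    proof (cases "fst b \<in> words m")
      case True
      have "{x \<in> space bm. f k x = b}
          = {x \<in> space bm. prefix_word x k = fst b} \<inter> {y \<in> space bm. (\<chi> i. \<lfloor>pt y $ i / r (fst b)\<rfloor>) = snd b}"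
        by (auto simp: f_def)
      also have "\<dots> \<in> sets bm"
        by (intro sets.Int mesh_label_measurable rpos True) measurable
      finally show ?thesis .
    next
      case False
      then have e: "{x \<in> space bm. f k x = b} = {}" using prefix_word_in_words' by (auto simp: f_def)
      show ?thesis unfolding e by simp
    qed
  qed
  moreover obtain c where c: "c > 0" "AE x in bm. \<forall>\<^sub>F n in sequentially. energy s (prefix_word x n) \<le> - c * real n"
    using AE_energy_upper[OF s(1)] by blast
  moreover have "\<forall>\<^sub>F k in sequentially. K * (real (Suc k))\<^sup>2 \<le> exp (c * real k)"
    using c(1) by real_asymp
  ultimately show ?thesis
    using c(2)
  proof (elim AE_mp, intro AE_I2 impI)
    fix x assume "x \<in> space bm"
    then have x: "x \<in> code_space m" by simp
    note w = prefix_word_in_words'[OF x]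
    assume ev: "\<forall>\<^sub>F k in sequentially. wt k (f k x) \<le> measure bm {y \<in> space bm. f k y = f k x}"
      and en: "\<forall>\<^sub>F n in sequentially. energy s (prefix_word x n) \<le> - c * real n"
      and ex: "\<forall>\<^sub>F k in sequentially. K * (real (Suc k))\<^sup>2 \<le> exp (c * real k)"
    define \<rho> where "\<rho> k = r (prefix_word x k)" for k
    have \<rho>: "0 < \<rho> k" for k unfolding \<rho>_def by (rule rpos[OF w])
    have ev: "\<forall>\<^sub>F k in sequentially. \<rho> k powr s \<le> ball_prob x (real ?N * \<rho> k)"
      using ev en ex
    proof eventually_elim
      case (elim k)
      let ?w = "prefix_word x k"
      have pp: "0 < word_prob p ?w" "0 < \<phi> s ?w" using word_prob_pos[OF w] phi_pos[OF w] s0 by auto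
      have "snd (f k x) \<in> J ?w" using fL[OF x, of k] by (auto simp: L_def f_def)
      then have n1: "0 < n ?w" using finJ[OF w] by (auto simp: n_def card_gt_0_iff)
      have "\<phi> s ?w = exp (energy s ?w) * word_prob p ?w"
        using pp by (simp add: energy_def exp_diff)
      also have "\<dots> \<le> exp (- c * real k) * word_prob p ?w"
        using elim pp by (intro mult_right_mono) auto
      finally have ph: "\<phi> s ?w * exp (c * real k) \<le> word_prob p ?w"
        by (simp add: exp_minus field_simps)
      have "\<rho> k powr s * (n ?w * (real (Suc k))\<^sup>2) \<le> \<rho> k powr s * ((K * \<phi> s ?w * \<rho> k powr - s) * (real (Suc k))\<^sup>2)"
        using n_le[OF w] by (intro mult_left_mono mult_right_mono) (auto simp: \<rho>_def)
      also have "\<dots> = \<phi> s ?w * (K * (real (Suc k))\<^sup>2)"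
        using \<rho>[of k] by (simp add: powr_minus field_simps)
      also have "\<dots> \<le> \<phi> s ?w * exp (c * real k)"
        using elim pp by (intro mult_left_mono) auto
      also note ph
      finally have "\<rho> k powr s \<le> wt k (f k x)"
        using n1 by (simp add: wt_def f_def field_simps)
      also have "\<dots> \<le> measure bm {y \<in> space bm. f k y = f k x}" by (rule elim(1))
      also have "\<dots> \<le> measure bm {y \<in> space bm. (\<chi> i. \<lfloor>pt y $ i / \<rho> k\<rfloor>) = (\<chi> i. \<lfloor>pt x $ i / \<rho> k\<rfloor>)}"
      proof (rule bm.finite_measure_mono)
        show "{y \<in> space bm. f k y = f k x} \<subseteq> {y \<in> space bm. (\<chi> i. \<lfloor>pt y $ i / \<rho> k\<rfloor>) = (\<chi> i. \<lfloor>pt x $ i / \<rho> k\<rfloor>)}"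
          unfolding f_def \<rho>_def by auto
      qed (rule mesh_label_measurable[OF \<rho>])
      also have "\<dots> \<le> ball_prob x (real ?N * \<rho> k)" by (rule mesh_label_le_ball_prob[OF \<rho>])
      finally show ?case .
    qed
    show "\<forall>\<^sub>F r in at_right 0. r powr t \<le> ball_prob x r"
    proof (rule eventually_powr_le_from_scales[OF mono_ball_prob _ _ _ _ s(3) \<rho> _ _ ev])
      let ?c = "\<kappa> ^ ?N / (sv_const ?N)\<^sup>2"
      have C: "1 \<le> sv_const ?N" by (intro sv_const_ge_1) (simp add: Suc_leI)
      show "0 < ?c" using lam C by simp
      have "\<kappa> ^ ?N \<le> 1" using lam Lam lam_le_Lam by (intro power_le_one) auto
      then have "\<kappa> ^ ?N \<le> (sv_const ?N)\<^sup>2" using one_le_power[OF C, of 2] by linarith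
      then show "?c \<le> 1" using C by simp
      show "?c * \<rho> k \<le> \<rho> (Suc k)" for k
      proof -
        have a: "x k \<in> {1..m}" using x by (simp only: in_code_space_iff)
        \<comment> \<open>The new letter acts first, so the next scale is a singular value of a
          composition with one fixed map on the right.\<close>
        have eq: "word_map T (prefix_word x (Suc k)) = word_map T (prefix_word x k) \<circ> T (x k)"
          by (simp add: prefix_word_Suc word_map_append)
        show ?thesis unfolding \<rho>_def r_def eq
        proof (rule singular_value_comp_ge[OF word_map_linear_bij[OF w] T_linear[OF a] T_bij[OF a] l _ lam(1) lam(2)[OF a]])
          fix v :: "real^'n"
          have "\<Lambda> * norm v \<le> 1 * norm v" using Lam by (intro mult_right_mono) auto
          then show "norm (T (x k) v) \<le> norm v" using Lam(3)[OF a, of v] by linarith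
        qed
      qed
      have le: "\<rho> k \<le> \<Lambda> ^ k" for k
        unfolding \<rho>_def r_def
        using singular_value_bounds(2)[OF word_map_linear_bij(1)[OF w] l word_map_bounds(2)[OF w]] by simp
      have lim: "(\<lambda>k. \<Lambda> ^ k) \<longlonglongrightarrow> 0" using Lam by (intro LIMSEQ_realpow_zero) auto
      show "\<rho> \<longlonglongrightarrow> 0"
      proof (rule tendsto_sandwich[OF _ _ tendsto_const lim])
        show "\<forall>\<^sub>F k in sequentially. 0 \<le> \<rho> k" using \<rho> by (simp add: less_imp_le)
        show "\<forall>\<^sub>F k in sequentially. \<rho> k \<le> \<Lambda> ^ k" using le by simp
      qed
      show "1 \<le> real ?N" by (simp add: Suc_leI)
      show "0 \<le> s" using s0 by simp
    qed
  qed
qed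

text \<open>This serves the case d_1 \<ge> N. Almost everywhere a measure on a bounded set has upper
  local dimension at most N: at scale 2^-k there are at most K 2^(k N) cubes, and a typical point
  avoids those much lighter than the average.\<close>

lemma AE_ball_prob_ge_full_dim:
  assumes t: "real CARD('n) < t"
  shows "AE x in bm. \<forall>\<^sub>F r in at_right 0. r powr t \<le> ball_prob x r"
proof -
  let ?N = "CARD('n)"
  define s where "s = (real ?N + t) / 2"
  have s: "real ?N < s" "s < t" using t by (auto simp: s_def)
  define \<rho> :: "nat \<Rightarrow> real" where "\<rho> k = (1 / 2) ^ k" for k
  have \<rho>: "0 < \<rho> k" "\<rho> k \<le> 1" for k by (auto simp: \<rho>_def power_le_one)
  define J :: "nat \<Rightarrow> (int^'n) set" where "J k = {j. mesh_cube (\<rho> k) j \<inter> cball 0 radius \<noteq> {}}" for k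
  define n where "n k = real (card (J k))" for k
  define K where "K = measure lborel (cball (0::real^'n) (radius + real ?N))"
  have V: "cball (0::real^'n) (radius + real ?N) \<in> fmeasurable lborel" by (rule fmeasurable_compact) simp
  have sub: "y \<in> cball 0 (radius + real ?N)" if "x \<in> cball 0 radius" "norm (y - x) \<le> real ?N * \<rho> k" for x y :: "real^'n" and k
  proof -
    have "real ?N * \<rho> k \<le> real ?N" using \<rho>[of k] by (simp add: mult_left_le)
    then show ?thesis using that norm_triangle_sub[of y x] unfolding mem_cball_0 by linarith
  qed
  have finJ: "finite (J k)" for k
    unfolding J_def by (rule card_mesh_cubes_le(1)[OF \<rho>(1) V sub])
  have n_le: "n k * \<rho> k ^ ?N \<le> K" for k
    unfolding J_def n_def K_def by (rule card_mesh_cubes_le(2)[OF \<rho>(1) V sub])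
  define f where "f k x = ((\<chi> i. \<lfloor>pt x $ i / \<rho> k\<rfloor>) :: int^'n)" for k x
  have fJ: "f k x \<in> J k" if x: "x \<in> code_space m" for k x
  proof -
    have "pt x \<in> mesh_cube (\<rho> k) (f k x)" unfolding mesh_cube_iff[OF \<rho>(1)] by (simp add: f_def)
    then show ?thesis using norm_pt_le[OF x] unfolding J_def by (auto simp: mem_cball_0)
  qed
  have "AE x in bm. \<forall>\<^sub>F k in sequentially. 1 / (n k * (real (Suc k))\<^sup>2) \<le> measure bm {y \<in> space bm. f k y = f k x}"
  proof (rule bm.AE_label_prob_ge[OF _ finJ])
    show "{x \<in> space bm. f k x = b} \<in> sets bm" for k b
      unfolding f_def by (rule mesh_label_measurable[OF \<rho>(1)])
    show "f k x \<in> J k" if "x \<in> space bm" for k x using fJ that by simp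
    show "(\<Sum>b\<in>J k. 1 / (n k * (real (Suc k))\<^sup>2)) \<le> 1 / (real (Suc k))\<^sup>2" for k
      by (cases "card (J k) = 0") (auto simp: n_def divide_simps)
  qed (simp add: n_def)
  moreover have "\<forall>\<^sub>F k in sequentially. K * (real (Suc k))\<^sup>2 \<le> 2 powr ((s - real ?N) * real k)"
    using s by real_asymp
  ultimately show ?thesis
  proof (elim AE_mp, intro AE_I2 impI)
    fix x assume "x \<in> space bm"
    then have x: "x \<in> code_space m" by simp
    assume ev: "\<forall>\<^sub>F k in sequentially. 1 / (n k * (real (Suc k))\<^sup>2) \<le> measure bm {y \<in> space bm. f k y = f k x}"
      and ex: "\<forall>\<^sub>F k in sequentially. K * (real (Suc k))\<^sup>2 \<le> 2 powr ((s - real ?N) * real k)"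
    have ev: "\<forall>\<^sub>F k in sequentially. \<rho> k powr s \<le> ball_prob x (real ?N * \<rho> k)"
      using ev ex
    proof eventually_elim
      case (elim k)
      have n1: "0 < n k" using fJ[OF x, of k] finJ[of k] by (auto simp: n_def card_gt_0_iff)
      have rho: "\<rho> k = 2 powr - real k" by (simp add: \<rho>_def powr_minus powr_realpow power_one_over inverse_eq_divide)
      have "\<rho> k powr s * (n k * (real (Suc k))\<^sup>2) = \<rho> k powr (s - real ?N) * ((n k * \<rho> k ^ ?N) * (real (Suc k))\<^sup>2)"
        using \<rho>(1)[of k] by (simp add: powr_diff powr_realpow)
      also have "\<dots> \<le> \<rho> k powr (s - real ?N) * (K * (real (Suc k))\<^sup>2)"
        using n_le by (intro mult_left_mono mult_right_mono) auto
      also have "\<dots> \<le> \<rho> k powr (s - real ?N) * 2 powr ((s - real ?N) * real k)"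
        using elim by (intro mult_left_mono) auto
      also have "\<dots> = 1" by (simp add: rho powr_powr mult.commute flip: powr_add)
      finally have "\<rho> k powr s \<le> 1 / (n k * (real (Suc k))\<^sup>2)"
        using n1 by (simp add: field_simps)
      also have "\<dots> \<le> measure bm {y \<in> space bm. f k y = f k x}" by (rule elim(1))
      also have "\<dots> \<le> ball_prob x (real ?N * \<rho> k)"
        unfolding f_def by (rule mesh_label_le_ball_prob[OF \<rho>(1)])
      finally show ?case .
    qed
    show "\<forall>\<^sub>F r in at_right 0. r powr t \<le> ball_prob x r"
    proof (rule eventually_powr_le_from_scales[OF mono_ball_prob _ _ _ _ s(2) \<rho>(1) _ _ ev])
      show "\<rho> \<longlonglongrightarrow> 0" unfolding \<rho>_def[abs_def] by (intro LIMSEQ_realpow_zero) auto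
      show "1 / 2 * \<rho> k \<le> \<rho> (Suc k)" for k by (simp add: \<rho>_def)
    qed (use s in \<open>auto simp: Suc_leI intro: order_trans[of 0 "real CARD('n)"]\<close>)
  qed
qed

theorem AE_ball_prob_ge:
  assumes t: "min (d1 m p T) (real CARD('n)) < t"
  shows "AE x in bm. \<forall>\<^sub>F r in at_right 0. r powr t \<le> ball_prob x r"
proof (cases "d1 m p T < real CARD('n)")
  case True
  show ?thesis
    by (rule AE_ball_prob_ge_below_dim[of "min ((d1 m p T + t) / 2) (real CARD('n))"]) (use True t in \<open>auto simp: min_less_iff_disj\<close>)
next
  case False
  then show ?thesis using t by (intro AE_ball_prob_ge_full_dim) auto
qed

end

subsection \<open>Lower bound for the local dimension\<close>

text \<open>The bound on X holds at every sample point, not only almost surely, so each sample gives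
  a \<open>bounded_family\<close>. On G the vectors have density at most M, and \<delta> bounds the
  probability of missing G.\<close>

locale random_family = self_affine m p T \<kappa> \<Lambda> q Q + P: prob_space P
  for m :: nat and p :: "nat \<Rightarrow> real" and T :: "nat \<Rightarrow> real^'n \<Rightarrow> real^'n" and \<kappa> \<Lambda> q Q
    and P :: "'w measure" +
  fixes X :: "nat list \<Rightarrow> 'w \<Rightarrow> real^'n" and R M \<delta> :: real and G :: "(real^'n) set"
  assumes X_bound: "\<And>w \<omega>. w \<in> words m \<Longrightarrow> norm (X w \<omega>) \<le> R" and R: "1 \<le> R"
    and X_indep: "P.indep_vars (\<lambda>_. borel) X (words m)"
    and G [measurable]: "G \<in> sets borel"
    and good: "\<And>w A. w \<in> words m \<Longrightarrow> A \<in> sets borel \<Longrightarrow>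
      emeasure P {\<omega> \<in> space P. X w \<omega> \<in> A \<inter> G} \<le> ennreal M * emeasure lborel A"
    and M: "0 \<le> M"
    and bad: "\<And>w. w \<in> words m \<Longrightarrow> P.prob {\<omega> \<in> space P. X w \<omega> \<notin> G} \<le> \<delta>"
    and \<delta>: "2 * \<delta> \<le> q"
begin

section \<open>Joint measurability, and conditioning on all vectors but one\<close>

lemma X_measurable: "w \<in> words m \<Longrightarrow> X w \<in> borel_measurable P"
  using X_indep unfolding P.indep_vars_def by blast

definition cp :: "'w \<Rightarrow> (nat \<Rightarrow> nat) \<Rightarrow> real^'n" where
  "cp \<omega> x = code_point T (\<lambda>w. X w \<omega>) x"

lemma bounded_family: "bounded_family m p T \<kappa> \<Lambda> q Q (\<lambda>w. X w \<omega>) R"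
  by unfold_locales (use X_bound R in auto)

lemma delta_nonneg: "0 \<le> \<delta>"
proof -
  have "[] \<in> words m" by (simp add: words_def)
  from bad[OF this] show ?thesis using measure_nonneg order_trans by blast
qed

lemma countable_words: "countable (words m)"
  by (rule countableI_type)

lemma word_map_measurable: "w \<in> words m \<Longrightarrow> word_map T w \<in> borel_measurable borel"
  using word_map_linear_bij(1)[of w]
  by (intro borel_measurable_continuous_onI linear_continuous_on) (simp add: linear_conv_bounded_linear)

lemma measurable_prefix_word_words: "(\<lambda>x. prefix_word x k) \<in> bm \<rightarrow>\<^sub>M count_space (words m)"
proof (subst measurable_count_space_eq2_countable, intro conjI ballI)
  show "(\<lambda>x. prefix_word x k) \<in> space bm \<rightarrow> words m" using prefix_word_in_words' by auto
  fix w
  show "(\<lambda>x. prefix_word x k) -` {w} \<inter> space bm \<in> sets bm"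
    by (rule measurable_sets[OF measurable_prefix_word]) simp
qed

lemma measurable_cp [measurable]: "(\<lambda>z. cp (fst z) (snd z)) \<in> borel_measurable (P \<Otimes>\<^sub>M bm)"
proof -
  have "(\<lambda>z. word_map T (prefix_word (snd z) k) (X (prefix_word (snd z) (Suc k)) (fst z))) \<in> borel_measurable (P \<Otimes>\<^sub>M bm)" for k
  proof -
    have "(\<lambda>z. (\<lambda>w z. word_map T (take k w) (X w (fst z))) (prefix_word (snd z) (Suc k)) z) \<in> borel_measurable (P \<Otimes>\<^sub>M bm)"
    proof (rule measurable_compose_countable'[OF _ _ countable_words])
      show "(\<lambda>z. word_map T (take k w) (X w (fst z))) \<in> borel_measurable (P \<Otimes>\<^sub>M bm)" if w: "w \<in> words m" for w
      proof -
        have "take k w \<in> words m" using w set_take_subset[of k w] by (auto simp: words_def)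
        then show ?thesis
          by (intro measurable_compose[OF measurable_compose[OF measurable_fst X_measurable[OF w]] word_map_measurable])
      qed
      show "(\<lambda>z. prefix_word (snd z) (Suc k)) \<in> P \<Otimes>\<^sub>M bm \<rightarrow>\<^sub>M count_space (words m)"
        by (rule measurable_compose[OF measurable_snd measurable_prefix_word_words])
    qed
    then show ?thesis by (simp add: take_prefix_word)
  qed
  then show ?thesis unfolding cp_def code_point_def by measurable
qed

lemma measurable_cp1: "x \<in> code_space m \<Longrightarrow> (\<lambda>\<omega>. cp \<omega> x) \<in> borel_measurable P"
  using measurable_compose[OF measurable_Pair2'[of x bm P] measurable_cp] by simp

text \<open>Conditionally on all other vectors, \<open>X w\<^sub>0\<close> keeps its distribution.\<close>

lemma conditional_bound:
  fixes h :: "(nat list \<Rightarrow> real^'n) \<Rightarrow> real^'n" and A :: "real^'n \<Rightarrow> real^'n"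
  assumes w0: "w0 \<in> words m" and h[measurable]: "h \<in> borel_measurable (PiM (words m - {w0}) (\<lambda>_. borel))"
    and U[measurable]: "U \<in> sets (PiM (words m - {w0}) (\<lambda>_. borel))"
    and A[measurable]: "A \<in> borel_measurable borel"
    and b: "\<And>y. emeasure P {\<omega> \<in> space P. X w0 \<omega> \<in> G \<and> norm (y + A (X w0 \<omega>)) \<le> r} \<le> b"
  defines "rest \<equiv> \<lambda>\<omega>. restrict (\<lambda>w. X w \<omega>) (words m - {w0})"
  shows "emeasure P {\<omega> \<in> space P. rest \<omega> \<in> U \<and> X w0 \<omega> \<in> G \<and> norm (h (rest \<omega>) + A (X w0 \<omega>)) \<le> r}
    \<le> b * emeasure P {\<omega> \<in> space P. rest \<omega> \<in> U}"
proof -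
  let ?K = "words m - {w0}"
  let ?\<Pi> = "PiM ?K (\<lambda>_. borel :: (real^'n) measure)"
  let ?\<Pi>1 = "PiM {w0} (\<lambda>_. borel :: (real^'n) measure)"
  define first where "first \<omega> = restrict (\<lambda>w. X w \<omega>) {w0}" for \<omega>
  have iv: "P.indep_var ?\<Pi>1 first ?\<Pi> rest"
    unfolding rest_def first_def by (rule P.indep_var_restrict[OF X_indep]) (use w0 in auto)
  then have rv[measurable]: "first \<in> P \<rightarrow>\<^sub>M ?\<Pi>1" "rest \<in> P \<rightarrow>\<^sub>M ?\<Pi>"
    by (rule P.indep_var_rv1, rule P.indep_var_rv2)
  have first: "first \<omega> w0 = X w0 \<omega>" for \<omega> by (simp add: first_def)
  let ?D1 = "distr P ?\<Pi>1 first" and ?D2 = "distr P ?\<Pi> rest"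
  have D: "?D1 \<Otimes>\<^sub>M ?D2 = distr P (?\<Pi>1 \<Otimes>\<^sub>M ?\<Pi>) (\<lambda>\<omega>. (first \<omega>, rest \<omega>))"
    using iv unfolding P.indep_var_distribution_eq by blast
  interpret D1: prob_space ?D1 by (rule P.prob_space_distr) simp
  interpret D2: prob_space ?D2 by (rule P.prob_space_distr) simp
  interpret D12: pair_sigma_finite ?D1 ?D2 ..
  have [measurable]: "(\<lambda>u. u w0) \<in> borel_measurable ?\<Pi>1" by (rule measurable_component_singleton) simp
  define S where "S = {z \<in> space (?\<Pi>1 \<Otimes>\<^sub>M ?\<Pi>). snd z \<in> U \<and> fst z w0 \<in> G \<and> norm (h (snd z) + A (fst z w0)) \<le> r}"
  have S: "S \<in> sets (?\<Pi>1 \<Otimes>\<^sub>M ?\<Pi>)" unfolding S_def by measurable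
  have "{\<omega> \<in> space P. rest \<omega> \<in> U \<and> X w0 \<omega> \<in> G \<and> norm (h (rest \<omega>) + A (X w0 \<omega>)) \<le> r}
      = (\<lambda>\<omega>. (first \<omega>, rest \<omega>)) -` S \<inter> space P"
    using measurable_space[OF rv(1)] measurable_space[OF rv(2)] by (auto simp: S_def space_pair_measure first)
  then have "emeasure P {\<omega> \<in> space P. rest \<omega> \<in> U \<and> X w0 \<omega> \<in> G \<and> norm (h (rest \<omega>) + A (X w0 \<omega>)) \<le> r}
      = emeasure (?D1 \<Otimes>\<^sub>M ?D2) S"
    unfolding D using S by (simp add: emeasure_distr)
  also have "\<dots> = (\<integral>\<^sup>+v. emeasure ?D1 ((\<lambda>x. (x, v)) -` S) \<partial>?D2)"
    by (rule D12.emeasure_pair_measure_alt2) (use S in simp)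
  also have "\<dots> \<le> (\<integral>\<^sup>+v. b * indicator U v \<partial>?D2)"
  proof (rule nn_integral_mono)
    fix v assume "v \<in> space ?D2"
    then have v: "v \<in> space ?\<Pi>" by simp
    show "emeasure ?D1 ((\<lambda>x. (x, v)) -` S) \<le> b * indicator U v"
    proof (cases "v \<in> U")
      case True
      let ?B = "{u \<in> space ?\<Pi>1. u w0 \<in> G \<and> norm (h v + A (u w0)) \<le> r}"
      have "(\<lambda>x. (x, v)) -` S = ?B"
        using True v by (auto simp: S_def space_pair_measure)
      moreover have "?B \<in> sets ?\<Pi>1" by measurable
      ultimately have "emeasure ?D1 ((\<lambda>x. (x, v)) -` S) = emeasure P (first -` ?B \<inter> space P)"
        by (simp add: emeasure_distr)
      also have "first -` ?B \<inter> space P = {\<omega> \<in> space P. X w0 \<omega> \<in> G \<and> norm (h v + A (X w0 \<omega>)) \<le> r}"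
        using measurable_space[OF rv(1)] by (auto simp: first)
      finally show ?thesis using b[of "h v"] True by simp
    next
      case False
      then have "(\<lambda>x. (x, v)) -` S = {}" by (auto simp: S_def)
      then show ?thesis by simp
    qed
  qed
  also have "\<dots> = b * emeasure ?D2 U"
    by (simp add: nn_integral_cmult)
  also have "emeasure ?D2 U = emeasure P {\<omega> \<in> space P. rest \<omega> \<in> U}"
    by (simp add: emeasure_distr vimage_def Int_def conj_commute)
  finally show ?thesis .
qed

lemma slab_bound:
  assumes w0: "w0 \<in> words m" and w: "w \<in> words m" and s: "0 \<le> s" "s \<le> real CARD('n)" and r: "0 < r"
  shows "emeasure P {\<omega> \<in> space P. X w0 \<omega> \<in> G \<and> norm (y + word_map T w (X w0 \<omega>)) \<le> r}
    \<le> ennreal (M * (2 * R) ^ CARD('n) * r powr s / \<phi> s w)"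
proof -
  note [measurable] = word_map_measurable[OF w]
  let ?A = "{v. norm v \<le> R \<and> norm (word_map T w v + y) \<le> r}"
  have "{v \<in> space borel. norm v \<le> R \<and> norm (word_map T w v + y) \<le> r} \<in> sets borel" by measurable
  then have A: "?A \<in> sets borel" by simp
  have "{\<omega> \<in> space P. X w0 \<omega> \<in> G \<and> norm (y + word_map T w (X w0 \<omega>)) \<le> r} = {\<omega> \<in> space P. X w0 \<omega> \<in> ?A \<inter> G}"
    using X_bound[OF w0] by (auto simp: add.commute)
  then have "emeasure P {\<omega> \<in> space P. X w0 \<omega> \<in> G \<and> norm (y + word_map T w (X w0 \<omega>)) \<le> r} \<le> ennreal M * emeasure lborel ?A"
    using good[OF w0 A] by simp
  also have "\<dots> \<le> ennreal M * ennreal ((2 * R) ^ CARD('n) * r powr s / \<phi> s w)"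
    unfolding \<phi>_def by (intro mult_left_mono emeasure_slab_le_sv_function word_map_linear_bij w s R r) simp
  also have "\<dots> = ennreal (M * (2 * R) ^ CARD('n) * r powr s / \<phi> s w)"
    using M phi_pos[OF w s(1)] R by (simp flip: ennreal_mult')
  finally show ?thesis .
qed

lemma all_bad_prob:
  assumes x: "x \<in> code_space m"
  shows "P.prob {\<omega> \<in> space P. \<forall>j\<in>{k..<k + n}. X (prefix_word x (Suc j)) \<omega> \<notin> G} \<le> \<delta> ^ n"
proof (cases "n = 0")
  case False
  let ?J = "(\<lambda>j. prefix_word x (Suc j)) ` {k..<k + n}"
  have J: "?J \<noteq> {}" "finite ?J" "?J \<subseteq> words m" using False prefix_word_in_words'[OF x] by auto
  \<comment> \<open>Prefixes of different lengths are different words, so their vectors are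
    independent and the probabilities multiply.\<close>
  have inj: "inj_on (\<lambda>j. prefix_word x (Suc j)) {k..<k + n}"
    by (rule inj_onI) (metis Suc_inject length_prefix_word)
  have "{\<omega> \<in> space P. \<forall>j\<in>{k..<k + n}. X (prefix_word x (Suc j)) \<omega> \<notin> G} = (\<Inter>w\<in>?J. X w -` (- G) \<inter> space P)"
    using J(1) by auto
  then have "P.prob {\<omega> \<in> space P. \<forall>j\<in>{k..<k + n}. X (prefix_word x (Suc j)) \<omega> \<notin> G}
      = (\<Prod>w\<in>?J. P.prob (X w -` (- G) \<inter> space P))"
    using P.indep_varsD[OF X_indep J, of "\<lambda>_. - G"] G by simp
  also have "\<dots> \<le> (\<Prod>w\<in>?J. \<delta>)"
  proof (intro prod_mono conjI)
    fix w assume "w \<in> ?J"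
    then have "w \<in> words m" using J by blast
    moreover have "X w -` (- G) \<inter> space P = {\<omega> \<in> space P. X w \<omega> \<notin> G}" by auto
    ultimately show "P.prob (X w -` (- G) \<inter> space P) \<le> \<delta>" using bad by simp
  qed simp
  also have "\<dots> = \<delta> ^ n" by (simp add: card_image[OF inj])
  finally show ?thesis .
qed (use P.prob_le_1 in auto)

text \<open>The vector of w0, the prefix of x of length k + n + 1, enters the code point of x in a
  single term and that of y not at all, as y leaves x at position k. The difference of the code
  points is thus a function of the other vectors plus a linear image of this one, and the bad events
  concern shorter words, so \<open>conditional_bound\<close> applies.\<close>

lemma first_good_bound:
  assumes x: "x \<in> code_space m" and y: "y \<in> code_space m"
    and xy: "prefix_word x k = prefix_word y k" "x k \<noteq> y k"
    and s: "0 \<le> s" "s \<le> real CARD('n)" and r: "0 < r"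
  shows "emeasure P {\<omega> \<in> space P. (\<forall>j\<in>{k..<k + n}. X (prefix_word x (Suc j)) \<omega> \<notin> G) \<and>
      X (prefix_word x (Suc (k + n))) \<omega> \<in> G \<and> norm (cp \<omega> x - cp \<omega> y) \<le> r}
    \<le> ennreal (\<delta> ^ n * (M * (2 * R) ^ CARD('n) * r powr s / \<phi> s (prefix_word x (k + n))))"
proof -
  define l where "l = k + n"
  define w0 where "w0 = prefix_word x (Suc l)"
  define K where "K = words m - {w0}"
  let ?\<Pi> = "PiM K (\<lambda>_. borel :: (real^'n) measure)"
  note wx = prefix_word_in_words'[OF x] and wy = prefix_word_in_words'[OF y]
  have w0: "w0 \<in> words m" unfolding w0_def by (rule wx)
  have xK: "prefix_word x (Suc j) \<in> K" if "j \<noteq> l" for j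
    using that wx by (auto simp: K_def w0_def dest: arg_cong[where f = length])
  have yK: "prefix_word y (Suc j) \<in> K" for j
  proof -
    have "prefix_word y (Suc j) \<noteq> w0"
    proof
      assume eq: "prefix_word y (Suc j) = w0"
      then have "j = l" unfolding w0_def by (auto dest: arg_cong[where f = length])
      then have "prefix_word y (Suc l) ! k = prefix_word x (Suc l) ! k" using eq by (simp add: w0_def)
      moreover have "k < Suc l" by (simp add: l_def)
      ultimately show False using xy(2) unfolding prefix_word_def by (simp del: upt_Suc)
    qed
    then show ?thesis using wy by (simp add: K_def)
  qed
  \<comment> \<open>Putting 0 for the vector of w0 removes precisely the term of index l, by
    linearity.\<close>
  define h where "h v = (\<Sum>j. word_map T (prefix_word x j) (if j = l then 0 else v (prefix_word x (Suc j))))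
      - (\<Sum>j. word_map T (prefix_word y j) (v (prefix_word y (Suc j))))" for v :: "nat list \<Rightarrow> real^'n"
  have comp: "(\<lambda>v. v w) \<in> borel_measurable ?\<Pi>" if "w \<in> K" for w
    using that by (rule measurable_component_singleton)
  have hm: "h \<in> borel_measurable ?\<Pi>"
  proof -
    have 1: "(\<lambda>v. word_map T (prefix_word x j) (if j = l then 0 else v (prefix_word x (Suc j)))) \<in> borel_measurable ?\<Pi>" for j
      using measurable_compose[OF comp[OF xK] word_map_measurable[OF wx]] by (cases "j = l") auto
    have 2: "(\<lambda>v. word_map T (prefix_word y j) (v (prefix_word y (Suc j)))) \<in> borel_measurable ?\<Pi>" for j
      using measurable_compose[OF comp[OF yK] word_map_measurable[OF wy]] .
    show ?thesis unfolding h_def by (intro borel_measurable_diff borel_measurable_suminf 1 2)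
  qed
  define rest where "rest \<omega> = restrict (\<lambda>w. X w \<omega>) K" for \<omega>
  have diff: "cp \<omega> x - cp \<omega> y = h (rest \<omega>) + word_map T (prefix_word x l) (X w0 \<omega>)" for \<omega>
  proof -
    interpret bf: bounded_family m p T \<kappa> \<Lambda> q Q "\<lambda>w. X w \<omega>" R by (rule bounded_family)
    let ?a = "\<lambda>j. word_map T (prefix_word x j) (X (prefix_word x (Suc j)) \<omega>)"
    let ?b = "\<lambda>j. if j = l then ?a j else 0"
    have b: "?b sums ?a l" by (rule sums_single)
    have "(\<Sum>j. ?a j - ?b j) = (\<Sum>j. ?a j) - (\<Sum>j. ?b j)"
      by (rule suminf_diff[OF bf.summable_terms[OF x] sums_summable[OF b], symmetric])
    moreover have "?a j - ?b j = word_map T (prefix_word x j) (if j = l then 0 else rest \<omega> (prefix_word x (Suc j)))" for j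
      using xK[of j] linear_0[OF word_map_linear_bij(1)[OF wx[of l]]] by (auto simp: rest_def)
    ultimately have "cp \<omega> x = (\<Sum>j. word_map T (prefix_word x j) (if j = l then 0 else rest \<omega> (prefix_word x (Suc j)))) + ?a l"
      using sums_unique[OF b] by (simp add: cp_def code_point_def)
    moreover have "cp \<omega> y = (\<Sum>j. word_map T (prefix_word y j) (rest \<omega> (prefix_word y (Suc j))))"
      using yK by (simp add: cp_def code_point_def rest_def)
    ultimately show ?thesis by (simp add: h_def w0_def)
  qed
  define U where "U = {v \<in> space ?\<Pi>. \<forall>j\<in>{k..<l}. v (prefix_word x (Suc j)) \<notin> G}"
  have Um: "U \<in> sets ?\<Pi>"
  proof -
    have "{v \<in> space ?\<Pi>. v (prefix_word x (Suc j)) \<notin> G} \<in> sets ?\<Pi>" if "j \<in> {k..<l}" for j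
    proof -
      have [measurable]: "(\<lambda>v. v (prefix_word x (Suc j))) \<in> borel_measurable ?\<Pi>" using that by (intro comp xK) auto
      show ?thesis by measurable
    qed
    then show ?thesis unfolding U_def by (intro sets.sets_Collect_finite_All) auto
  qed
  have restU: "rest \<omega> \<in> U \<longleftrightarrow> (\<forall>j\<in>{k..<l}. X (prefix_word x (Suc j)) \<omega> \<notin> G)" for \<omega>
  proof -
    have "rest \<omega> \<in> space ?\<Pi>" by (simp add: rest_def space_PiM)
    moreover have "rest \<omega> (prefix_word x (Suc j)) = X (prefix_word x (Suc j)) \<omega>" if "j \<in> {k..<l}" for j
      using xK[of j] that by (simp add: rest_def)
    ultimately show ?thesis by (simp add: U_def)
  qed
  let ?b = "M * (2 * R) ^ CARD('n) * r powr s / \<phi> s (prefix_word x l)"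
  have b0: "0 \<le> ?b" using M R phi_pos[OF wx s(1)] by (intro divide_nonneg_pos mult_nonneg_nonneg) auto
  have "emeasure P {\<omega> \<in> space P. rest \<omega> \<in> U \<and> X w0 \<omega> \<in> G \<and> norm (h (rest \<omega>) + word_map T (prefix_word x l) (X w0 \<omega>)) \<le> r}
      \<le> ennreal ?b * emeasure P {\<omega> \<in> space P. rest \<omega> \<in> U}"
    unfolding rest_def K_def
    by (rule conditional_bound[OF w0 hm[unfolded K_def] Um[unfolded K_def] word_map_measurable[OF wx] slab_bound[OF w0 wx s r]])
  also have "\<dots> \<le> ennreal ?b * ennreal (\<delta> ^ n)"
    using all_bad_prob[OF x, of k n] unfolding restU l_def
    by (intro mult_left_mono) (auto simp: P.emeasure_eq_measure intro!: ennreal_leI)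
  also have "\<dots> = ennreal (\<delta> ^ n * ?b)"
    by (subst mult.commute[of "\<delta> ^ n"]) (rule ennreal_mult[OF b0 zero_le_power[OF delta_nonneg], symmetric])
  finally show ?thesis
    unfolding restU diff w0_def l_def by simp
qed

lemma pair_bound:
  assumes x: "x \<in> code_space m" and y: "y \<in> code_space m"
    and xy: "prefix_word x k = prefix_word y k" "x k \<noteq> y k"
    and s: "0 \<le> s" "s \<le> real CARD('n)" and r: "0 < r"
  shows "emeasure P {\<omega> \<in> space P. norm (cp \<omega> x - cp \<omega> y) \<le> r}
    \<le> (\<Sum>n. ennreal (\<delta> ^ n * (M * (2 * R) ^ CARD('n) * r powr s / \<phi> s (prefix_word x (k + n)))))"
proof -
  note [measurable] = X_measurable[OF prefix_word_in_words'[OF x]] measurable_cp1[OF x] measurable_cp1[OF y]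
  define bd where "bd n = {\<omega> \<in> space P. \<forall>j\<in>{k..<k + n}. X (prefix_word x (Suc j)) \<omega> \<notin> G}" for n
  define E where "E n = {\<omega> \<in> space P. (\<forall>j\<in>{k..<k + n}. X (prefix_word x (Suc j)) \<omega> \<notin> G) \<and>
      X (prefix_word x (Suc (k + n))) \<omega> \<in> G \<and> norm (cp \<omega> x - cp \<omega> y) \<le> r}" for n
  have Em: "E n \<in> sets P" for n unfolding E_def by measurable
  have bdm: "bd n \<in> sets P" for n unfolding bd_def by measurable
  have null: "(\<Inter>n. bd n) \<in> null_sets P"
  proof (rule null_setsI)
    have "P.prob (\<Inter>n. bd n) \<le> 0"
    proof (rule LIMSEQ_le_const)
      show "(\<lambda>n. \<delta> ^ n) \<longlonglongrightarrow> 0"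
        using delta_nonneg \<delta> q_le_Q Q by (intro LIMSEQ_realpow_zero) auto
      show "\<exists>N. \<forall>n\<ge>N. P.prob (\<Inter>n. bd n) \<le> \<delta> ^ n"
      proof (intro exI allI impI)
        fix n
        have "P.prob (\<Inter>n. bd n) \<le> P.prob (bd n)" using bdm by (intro P.finite_measure_mono) auto
        also have "\<dots> \<le> \<delta> ^ n" unfolding bd_def by (rule all_bad_prob[OF x])
        finally show "P.prob (\<Inter>n. bd n) \<le> \<delta> ^ n" .
      qed
    qed
    then show "emeasure P (\<Inter>n. bd n) = 0" by (simp add: P.emeasure_eq_measure measure_le_0_iff)
  qed (use bdm in auto)
  have sub: "{\<omega> \<in> space P. norm (cp \<omega> x - cp \<omega> y) \<le> r} \<subseteq> (\<Union>n. E n) \<union> (\<Inter>n. bd n)"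
  proof
    fix \<omega> assume \<omega>: "\<omega> \<in> {\<omega> \<in> space P. norm (cp \<omega> x - cp \<omega> y) \<le> r}"
    show "\<omega> \<in> (\<Union>n. E n) \<union> (\<Inter>n. bd n)"
    proof (cases "\<exists>n. X (prefix_word x (Suc (k + n))) \<omega> \<in> G")
      case True
      define n where "n = (LEAST n. X (prefix_word x (Suc (k + n))) \<omega> \<in> G)"
      have n: "X (prefix_word x (Suc (k + n))) \<omega> \<in> G" using LeastI_ex[OF True] by (simp add: n_def)
      have "X (prefix_word x (Suc j)) \<omega> \<notin> G" if "j \<in> {k..<k + n}" for j
      proof -
        have "j - k < n" using that by auto
        then show ?thesis using not_less_Least[of "j - k" "\<lambda>n. X (prefix_word x (Suc (k + n))) \<omega> \<in> G"] that
          by (auto simp: n_def)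
      qed
      then have "\<omega> \<in> E n" using n \<omega> by (simp add: E_def)
      then show ?thesis by blast
    next
      case False
      then have "X (prefix_word x (Suc j)) \<omega> \<notin> G" if "j \<ge> k" for j
        using that by (metis le_Suc_ex)
      then show ?thesis using \<omega> by (auto simp: bd_def)
    qed
  qed
  have "emeasure P {\<omega> \<in> space P. norm (cp \<omega> x - cp \<omega> y) \<le> r} \<le> emeasure P ((\<Union>n. E n) \<union> (\<Inter>n. bd n))"
    using Em bdm by (intro emeasure_mono sub) auto
  also have "\<dots> = emeasure P (\<Union>n. E n)"
    using Em null by (intro emeasure_Un_null_set) auto
  also have "\<dots> \<le> (\<Sum>n. emeasure P (E n))"
    using Em by (intro emeasure_subadditive_countably) auto
  also have "\<dots> \<le> (\<Sum>n. ennreal (\<delta> ^ n * (M * (2 * R) ^ CARD('n) * r powr s / \<phi> s (prefix_word x (k + n)))))"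
    unfolding E_def by (intro suminf_le first_good_bound assms) auto
  finally show ?thesis .
qed

text \<open>The integrand is dominated by the sum over all levels k of the pair bound times the
  indicator of the cylinder of the prefix of length k; at each y the summand at the branching level
  already suffices. Integration leaves a double series in k and the delay n.\<close>

lemma pair_integral_bound:
  assumes x: "x \<in> code_space m" and s: "0 \<le> s" "s \<le> real CARD('n)"
    and A0: "0 \<le> A0" and c: "0 < c" and en: "\<And>l. exp (- energy s (prefix_word x l)) \<le> A0 * exp (- c * real l)"
  obtains C where "0 \<le> C" "\<And>r. 0 < r \<Longrightarrow> (\<integral>\<^sup>+y. emeasure P {\<omega> \<in> space P. norm (cp \<omega> x - cp \<omega> y) \<le> r} \<partial>bm) \<le> ennreal (C * r powr s)"
proof -
  note wx = prefix_word_in_words'[OF x]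
  define M' where "M' = M * (2 * R) ^ CARD('n)"
  have M': "0 \<le> M'" unfolding M'_def using M R by simp
  \<comment> \<open>2 is the sum of 2^-n over the delays, and 1 / (1 - exp (- c)) is the sum of exp
    (- c k) over the levels.\<close>
  define C where "C = M' * A0 * 2 * (1 / (1 - exp (- c)))"
  have e1: "exp (- c) < 1" using c by simp
  have C: "0 \<le> C" unfolding C_def using M' A0 e1 by simp
  have "(\<integral>\<^sup>+y. emeasure P {\<omega> \<in> space P. norm (cp \<omega> x - cp \<omega> y) \<le> r} \<partial>bm) \<le> ennreal (C * r powr s)" if r: "0 < r" for r
  proof -
    define a where "a k n = ennreal (\<delta> ^ n * (M' * r powr s / \<phi> s (prefix_word x (k + n))))" for k n
    \<comment> \<open>Only y = x has no branching level; this point is null because the cylinders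
      around it have mass at most Q^k.\<close>
    have "AE y in bm. y \<notin> (\<Inter>k. cylinder m (prefix_word x k))"
    proof (rule AE_not_in, rule null_setsI)
      have "measure bm (\<Inter>k. cylinder m (prefix_word x k)) \<le> 0"
      proof (rule LIMSEQ_le_const)
        show "(\<lambda>k. Q ^ k) \<longlonglongrightarrow> 0" using Q by (intro LIMSEQ_realpow_zero) auto
        show "\<exists>N. \<forall>k\<ge>N. measure bm (\<Inter>k. cylinder m (prefix_word x k)) \<le> Q ^ k"
        proof (intro exI allI impI)
          fix k
          have "measure bm (\<Inter>k. cylinder m (prefix_word x k)) \<le> measure bm (cylinder m (prefix_word x k))"
            by (intro bm.finite_measure_mono) auto
          also have "\<dots> \<le> Q ^ k"
            using word_prob_bounds(2)[OF wx, of k] by (simp add: measure_cylinder[OF wx])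
          finally show "measure bm (\<Inter>k. cylinder m (prefix_word x k)) \<le> Q ^ k" .
        qed
      qed
      then show "emeasure bm (\<Inter>k. cylinder m (prefix_word x k)) = 0"
        by (simp add: bm.emeasure_eq_measure measure_le_0_iff)
    qed auto
    then have "(\<integral>\<^sup>+y. emeasure P {\<omega> \<in> space P. norm (cp \<omega> x - cp \<omega> y) \<le> r} \<partial>bm)
        \<le> (\<integral>\<^sup>+y. (\<Sum>k. (\<Sum>n. a k n) * indicator (cylinder m (prefix_word x k)) y) \<partial>bm)"
    proof (intro nn_integral_mono_AE, elim AE_mp, intro AE_I2 impI)
      fix y assume "y \<in> space bm" and ny: "y \<notin> (\<Inter>k. cylinder m (prefix_word x k))"
      then have y: "y \<in> code_space m" by simp
      have "\<exists>k. x k \<noteq> y k"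
      proof (rule ccontr)
        assume "\<not> ?thesis"
        then have "x = y" by (simp add: fun_eq_iff)
        then show False using ny y by (auto simp: cylinder_def)
      qed
      define k where "k = (LEAST k. x k \<noteq> y k)"
      have k: "x k \<noteq> y k" using LeastI_ex[OF \<open>\<exists>k. x k \<noteq> y k\<close>] by (simp add: k_def)
      have "x j = y j" if "j < k" for j using not_less_Least[of j "\<lambda>k. x k \<noteq> y k"] that by (auto simp: k_def)
      then have pk: "prefix_word x k = prefix_word y k" by (simp add: prefix_word_def)
      have "emeasure P {\<omega> \<in> space P. norm (cp \<omega> x - cp \<omega> y) \<le> r} \<le> (\<Sum>n. a k n)"
        unfolding a_def M'_def by (rule pair_bound[OF x y pk k s r])
      also have "\<dots> = (\<Sum>n. a k n) * indicator (cylinder m (prefix_word x k)) y"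
        using y pk by (simp add: cylinder_def)
      also have "\<dots> \<le> (\<Sum>j. (\<Sum>n. a j n) * indicator (cylinder m (prefix_word x j)) y)"
      proof -
        have "f k \<le> (\<Sum>j. f j)" for f :: "nat \<Rightarrow> ennreal"
          using sum_le_suminf[of f "{k}"] by simp
        then show ?thesis .
      qed
      finally show "emeasure P {\<omega> \<in> space P. norm (cp \<omega> x - cp \<omega> y) \<le> r}
        \<le> (\<Sum>j. (\<Sum>n. a j n) * indicator (cylinder m (prefix_word x j)) y)" .
    qed
    also have "\<dots> = (\<Sum>k. \<integral>\<^sup>+y. (\<Sum>n. a k n) * indicator (cylinder m (prefix_word x k)) y \<partial>bm)"
      by (rule nn_integral_suminf) measurable
    also have "\<dots> = (\<Sum>k. \<Sum>n. a k n * ennreal (word_prob p (prefix_word x k)))"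
      by (simp add: nn_integral_cmult bm.emeasure_eq_measure measure_cylinder[OF wx])
    also have "\<dots> \<le> (\<Sum>k. \<Sum>n. ennreal (M' * r powr s * A0 * exp (- c) ^ k * (1 / 2) ^ n))"
    proof (intro suminf_le)
      fix k n
      let ?w = "prefix_word x (k + n)"
      have ph: "0 < \<phi> s ?w" "0 < word_prob p ?w" "0 < word_prob p (prefix_word x k)"
        using phi_pos[OF wx s(1)] word_prob_pos[OF wx] by auto
      have 1: "word_prob p (prefix_word x k) * q ^ n \<le> word_prob p ?w"
        unfolding prefix_word_add word_prob_append
        using word_prob_bounds(1)[OF prefix_word_in_words'[OF shift_in_code_space[OF x]], of k n] ph(3)
        by (intro mult_left_mono) auto
      have "word_prob p ?w / \<phi> s ?w = exp (- energy s ?w)"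
        using ph by (simp add: energy_def exp_diff)
      also have "\<dots> \<le> A0 * exp (- c * real (k + n))" by (rule en)
      \<comment> \<open>The decay exp (- c n) is given up here; summability in n comes from the
        factor 2^-n.\<close>
      also have "\<dots> \<le> A0 * exp (- c) ^ k"
        using A0 c by (intro mult_left_mono) (auto simp: exp_of_nat_mult[symmetric] mult.commute)
      finally have 2: "word_prob p ?w / \<phi> s ?w \<le> A0 * exp (- c) ^ k" .
      have "\<delta> ^ n \<le> (q / 2) ^ n" using delta_nonneg \<delta> by (intro power_mono) auto
      then have "\<delta> ^ n * word_prob p (prefix_word x k) \<le> (q / 2) ^ n * word_prob p (prefix_word x k)"
        using ph by (intro mult_right_mono) auto
      also have "\<dots> = (1 / 2) ^ n * (word_prob p (prefix_word x k) * q ^ n)" by (simp add: power_divide)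
      also have "\<dots> \<le> (1 / 2) ^ n * word_prob p ?w" using 1 by (intro mult_left_mono) auto
      finally have 3: "\<delta> ^ n * word_prob p (prefix_word x k) \<le> (1 / 2) ^ n * word_prob p ?w" .
      have "(\<delta> ^ n * word_prob p (prefix_word x k)) * (M' * r powr s / \<phi> s ?w)
          \<le> ((1 / 2) ^ n * word_prob p ?w) * (M' * r powr s / \<phi> s ?w)"
        using M' ph by (intro mult_right_mono 3) auto
      also have "\<dots> = (1 / 2) ^ n * (M' * r powr s) * (word_prob p ?w / \<phi> s ?w)" by simp
      also have "\<dots> \<le> (1 / 2) ^ n * (M' * r powr s) * (A0 * exp (- c) ^ k)"
        using M' by (intro mult_left_mono 2) auto
      finally have "\<delta> ^ n * (M' * r powr s / \<phi> s ?w) * word_prob p (prefix_word x k)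
          \<le> M' * r powr s * A0 * exp (- c) ^ k * (1 / 2) ^ n" by (simp add: mult_ac)
      then have "ennreal (\<delta> ^ n * (M' * r powr s / \<phi> s ?w) * word_prob p (prefix_word x k))
          \<le> ennreal (M' * r powr s * A0 * exp (- c) ^ k * (1 / 2) ^ n)" by (rule ennreal_leI)
      then show "a k n * ennreal (word_prob p (prefix_word x k)) \<le> ennreal (M' * r powr s * A0 * exp (- c) ^ k * (1 / 2) ^ n)"
        unfolding a_def using ph delta_nonneg M' by (subst ennreal_mult''[symmetric]) auto
    qed auto
    also have "(\<lambda>k. \<Sum>n. ennreal (M' * r powr s * A0 * exp (- c) ^ k * (1 / 2) ^ n))
        = (\<lambda>k. ennreal (M' * r powr s * A0 * exp (- c) ^ k * 2))"
    proof
      fix k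
      have "(\<lambda>n. (1 / 2 :: real) ^ n) sums 2" using geometric_sums[of "1 / 2 :: real"] by simp
      from sums_mult[OF this, of "M' * r powr s * A0 * exp (- c) ^ k"]
      show "(\<Sum>n. ennreal (M' * r powr s * A0 * exp (- c) ^ k * (1 / 2) ^ n)) = ennreal (M' * r powr s * A0 * exp (- c) ^ k * 2)"
        using M' A0 by (intro suminf_ennreal_eq) auto
    qed
    also have "(\<Sum>k. ennreal (M' * r powr s * A0 * exp (- c) ^ k * 2)) = ennreal (C * r powr s)"
    proof (rule suminf_ennreal_eq)
      have "(\<lambda>k. exp (- c) ^ k) sums (1 / (1 - exp (- c)))" using geometric_sums[of "exp (- c)"] e1 by simp
      from sums_mult[OF this, of "M' * r powr s * A0 * 2"]
      show "(\<lambda>k. M' * r powr s * A0 * exp (- c) ^ k * 2) sums (C * r powr s)"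
        by (simp add: C_def mult_ac)
    qed (use M' A0 in simp)
    finally show ?thesis .
  qed
  then show thesis using that C by blast
qed

text \<open>The quantity \<open>ball_prob\<close> with the sample as an argument: the locale of
  \<open>ball_prob\<close> fixes the family, whereas Fubini's theorem needs measurability in family
  and code jointly.\<close>

definition fam_ball_prob :: "'w \<Rightarrow> (nat \<Rightarrow> nat) \<Rightarrow> real \<Rightarrow> real" where
  "fam_ball_prob \<omega> x r = measure bm {y \<in> space bm. dist (cp \<omega> x) (cp \<omega> y) \<le> r}"

section \<open>Expected ball measures and almost every family\<close>

sublocale pair: pair_sigma_finite P bm ..

lemma measurable_fam_ball_prob [measurable]:
  "(\<lambda>z. fam_ball_prob (fst z) (snd z) r) \<in> borel_measurable (P \<Otimes>\<^sub>M bm)"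
proof -
  have 1: "(\<lambda>z. cp (fst (fst z)) (snd (fst z))) \<in> borel_measurable ((P \<Otimes>\<^sub>M bm) \<Otimes>\<^sub>M bm)"
    by (rule measurable_compose[OF measurable_fst measurable_cp])
  have "(\<lambda>z. (fst (fst z), snd z)) \<in> (P \<Otimes>\<^sub>M bm) \<Otimes>\<^sub>M bm \<rightarrow>\<^sub>M P \<Otimes>\<^sub>M bm" by measurable
  from measurable_compose[OF this measurable_cp]
  have 2: "(\<lambda>z. cp (fst (fst z)) (snd z)) \<in> borel_measurable ((P \<Otimes>\<^sub>M bm) \<Otimes>\<^sub>M bm)" by simp
  let ?S = "{z \<in> space ((P \<Otimes>\<^sub>M bm) \<Otimes>\<^sub>M bm). dist (cp (fst (fst z)) (snd (fst z))) (cp (fst (fst z)) (snd z)) \<le> r}"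
  have "?S \<in> sets ((P \<Otimes>\<^sub>M bm) \<Otimes>\<^sub>M bm)" using 1 2 by measurable
  then have "(\<lambda>z. emeasure bm (Pair z -` ?S)) \<in> borel_measurable (P \<Otimes>\<^sub>M bm)"
    by (rule bm.measurable_emeasure_Pair)
  then have "(\<lambda>z. measure bm (Pair z -` ?S)) \<in> borel_measurable (P \<Otimes>\<^sub>M bm)"
    unfolding measure_def by measurable
  then show ?thesis
  proof (rule measurable_cong[THEN iffD1, rotated])
    fix z assume "z \<in> space (P \<Otimes>\<^sub>M bm)"
    then have "Pair z -` ?S = {y \<in> space bm. dist (cp (fst z) (snd z)) (cp (fst z) y) \<le> r}"
      by (auto simp: space_pair_measure)
    then show "measure bm (Pair z -` ?S) = fam_ball_prob (fst z) (snd z) r" by (simp add: fam_ball_prob_def)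
  qed
qed

lemma expected_ball_prob:
  assumes x: "x \<in> code_space m"
  shows "(\<integral>\<^sup>+\<omega>. ennreal (fam_ball_prob \<omega> x r) \<partial>P)
    = (\<integral>\<^sup>+y. emeasure P {\<omega> \<in> space P. norm (cp \<omega> x - cp \<omega> y) \<le> r} \<partial>bm)"
proof -
  have 1: "(\<lambda>z. cp (fst z) x) \<in> borel_measurable (P \<Otimes>\<^sub>M bm)"
    by (rule measurable_compose[OF measurable_fst measurable_cp1[OF x]])
  let ?S = "{z \<in> space (P \<Otimes>\<^sub>M bm). dist (cp (fst z) x) (cp (fst z) (snd z)) \<le> r}"
  have S: "?S \<in> sets (P \<Otimes>\<^sub>M bm)" using 1 by measurable
  have "(\<integral>\<^sup>+\<omega>. ennreal (fam_ball_prob \<omega> x r) \<partial>P) = (\<integral>\<^sup>+\<omega>. emeasure bm (Pair \<omega> -` ?S) \<partial>P)"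
  proof (rule nn_integral_cong)
    fix \<omega> assume "\<omega> \<in> space P"
    then have "Pair \<omega> -` ?S = {y \<in> space bm. dist (cp \<omega> x) (cp \<omega> y) \<le> r}"
      by (auto simp: space_pair_measure)
    then show "ennreal (fam_ball_prob \<omega> x r) = emeasure bm (Pair \<omega> -` ?S)"
      by (simp add: fam_ball_prob_def bm.emeasure_eq_measure)
  qed
  also have "\<dots> = emeasure (P \<Otimes>\<^sub>M bm) ?S"
    by (rule bm.emeasure_pair_measure_alt[OF S, symmetric])
  also have "\<dots> = (\<integral>\<^sup>+y. emeasure P ((\<lambda>\<omega>. (\<omega>, y)) -` ?S) \<partial>bm)"
    by (rule pair.emeasure_pair_measure_alt2[OF S])
  also have "\<dots> = (\<integral>\<^sup>+y. emeasure P {\<omega> \<in> space P. norm (cp \<omega> x - cp \<omega> y) \<le> r} \<partial>bm)"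
  proof (rule nn_integral_cong)
    fix y assume "y \<in> space bm"
    then have "(\<lambda>\<omega>. (\<omega>, y)) -` ?S = {\<omega> \<in> space P. norm (cp \<omega> x - cp \<omega> y) \<le> r}"
      by (auto simp: space_pair_measure dist_norm)
    then show "emeasure P ((\<lambda>\<omega>. (\<omega>, y)) -` ?S) = emeasure P {\<omega> \<in> space P. norm (cp \<omega> x - cp \<omega> y) \<le> r}" by simp
  qed
  finally show ?thesis .
qed

text \<open>For a fixed x, Markov's inequality turns the expectation O(r^s) into a probability
  O(r^(s-s')) of exceeding r^s'. This is summable along r = 2^-n, so Borel-Cantelli applies.\<close>

lemma AE_fam_ball_prob_le_pointwise:
  assumes x: "x \<in> code_space m" and s: "0 \<le> s" "s \<le> real CARD('n)" "s' < s"
    and c: "0 < c" and en: "\<forall>\<^sub>F l in sequentially. c * real l \<le> energy s (prefix_word x l)"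
  shows "AE \<omega> in P. \<forall>\<^sub>F n in sequentially. fam_ball_prob \<omega> x ((1 / 2) ^ n) \<le> ((1 / 2) ^ n) powr s'"
proof -
  obtain l0 where l0: "\<And>l. l \<ge> l0 \<Longrightarrow> c * real l \<le> energy s (prefix_word x l)"
    using en by (auto simp: eventually_sequentially)
  \<comment> \<open>The energy bound starts only at l0; the finitely many earlier levels are put
    into the constant. It may depend on x, which is fixed here.\<close>
  define A0 where "A0 = 1 + (\<Sum>l<l0. exp (- energy s (prefix_word x l)) * exp (c * real l))"
  have A0: "0 \<le> A0" unfolding A0_def by (intro add_nonneg_nonneg sum_nonneg) auto
  have en': "exp (- energy s (prefix_word x l)) \<le> A0 * exp (- c * real l)" for l
  proof -
    have "exp (- energy s (prefix_word x l)) * exp (c * real l) \<le> A0"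
    proof (cases "l < l0")
      case True
      then have "exp (- energy s (prefix_word x l)) * exp (c * real l)
          \<le> (\<Sum>l<l0. exp (- energy s (prefix_word x l)) * exp (c * real l))"
        by (intro member_le_sum) auto
      then show ?thesis by (simp add: A0_def)
    next
      case False
      then have "exp (- energy s (prefix_word x l) + c * real l) \<le> 1" using l0[of l] by simp
      also have "1 \<le> A0" unfolding A0_def by (auto intro!: sum_nonneg)
      finally show ?thesis by (simp only: exp_add)
    qed
    then show ?thesis by (simp add: exp_minus field_simps)
  qed
  obtain C where C: "0 \<le> C" "\<And>r. 0 < r \<Longrightarrow> (\<integral>\<^sup>+y. emeasure P {\<omega> \<in> space P. norm (cp \<omega> x - cp \<omega> y) \<le> r} \<partial>bm) \<le> ennreal (C * r powr s)"
    using pair_integral_bound[OF x s(1,2) A0 c en'] by blast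
  have meas[measurable]: "(\<lambda>\<omega>. fam_ball_prob \<omega> x r) \<in> borel_measurable P" for r
    using measurable_compose[OF measurable_Pair2'[of x bm P] measurable_fam_ball_prob] x by simp
  define \<rho> :: "nat \<Rightarrow> real" where "\<rho> n = (1 / 2) ^ n" for n
  have \<rho>: "0 < \<rho> n" for n by (simp add: \<rho>_def)
  define B where "B n = {\<omega> \<in> space P. \<rho> n powr s' \<le> fam_ball_prob \<omega> x (\<rho> n)}" for n
  have Bm: "B n \<in> sets P" for n unfolding B_def by measurable
  have B: "P.prob (B n) \<le> C * \<rho> n powr (s - s')" for n
  proof -
    have "emeasure P (B n) = emeasure P {\<omega> \<in> space P. 1 \<le> ennreal (1 / \<rho> n powr s') * ennreal (fam_ball_prob \<omega> x (\<rho> n))}"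
    proof (rule arg_cong[where f = "emeasure P"], unfold B_def, intro Collect_cong conj_cong refl)
      fix \<omega>
      have "ennreal (1 / \<rho> n powr s') * ennreal (fam_ball_prob \<omega> x (\<rho> n)) = ennreal (fam_ball_prob \<omega> x (\<rho> n) / \<rho> n powr s')"
        by (simp add: fam_ball_prob_def flip: ennreal_mult')
      then show "(\<rho> n powr s' \<le> fam_ball_prob \<omega> x (\<rho> n)) = (1 \<le> ennreal (1 / \<rho> n powr s') * ennreal (fam_ball_prob \<omega> x (\<rho> n)))"
        using \<rho>[of n] by (simp add: fam_ball_prob_def le_divide_eq_1 flip: ennreal_1)
    qed
    also have "\<dots> \<le> ennreal (1 / \<rho> n powr s') * (\<integral>\<^sup>+\<omega>. ennreal (fam_ball_prob \<omega> x (\<rho> n)) * indicator (space P) \<omega> \<partial>P)"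
      by (rule nn_integral_Markov_inequality) measurable
    also have "(\<integral>\<^sup>+\<omega>. ennreal (fam_ball_prob \<omega> x (\<rho> n)) * indicator (space P) \<omega> \<partial>P) = (\<integral>\<^sup>+\<omega>. ennreal (fam_ball_prob \<omega> x (\<rho> n)) \<partial>P)"
      by (intro nn_integral_cong) simp
    also have "\<dots> \<le> ennreal (C * \<rho> n powr s)"
      unfolding expected_ball_prob[OF x] by (rule C(2)[OF \<rho>])
    finally have "emeasure P (B n) \<le> ennreal (1 / \<rho> n powr s') * ennreal (C * \<rho> n powr s)"
      by (simp add: mult_left_mono)
    also have "\<dots> = ennreal (C * \<rho> n powr (s - s'))"
      using C(1) by (simp add: powr_diff flip: ennreal_mult')
    finally show ?thesis
      using C(1) by (simp add: P.emeasure_eq_measure)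
  qed
  have "summable (\<lambda>n. C * \<rho> n powr (s - s'))"
  proof (rule summable_mult)
    have "\<rho> n powr (s - s') = ((1 / 2) powr (s - s')) ^ n" for n
      by (simp add: \<rho>_def powr_power powr_realpow[symmetric] powr_powr mult.commute)
    moreover have "(1 / 2 :: real) powr (s - s') < 1" using s(3) by (simp add: powr_def mult_pos_neg ln_div)
    ultimately show "summable (\<lambda>n. \<rho> n powr (s - s'))" by (simp add: summable_geometric)
  qed
  then have "summable (\<lambda>n. P.prob (B n))"
    by (rule summable_comparison_test[rotated]) (use B in auto)
  then have "AE \<omega> in P. \<forall>\<^sub>F n in sequentially. \<omega> \<in> space P - B n"
    using Bm by (intro borel_cantelli_AE1) (auto simp: P.emeasure_eq_measure)
  then show ?thesis
  proof (rule AE_mp, intro AE_I2 impI)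
    fix \<omega> assume "\<forall>\<^sub>F n in sequentially. \<omega> \<in> space P - B n"
    then show "\<forall>\<^sub>F n in sequentially. fam_ball_prob \<omega> x ((1 / 2) ^ n) \<le> ((1 / 2) ^ n) powr s'"
      by eventually_elim (auto simp: B_def \<rho>_def)
  qed
qed

text \<open>The energy bound selects almost every x before any family is drawn, and each such x has
  its own null set of families. Joint measurability of the event allows the two quantifiers to be
  exchanged.\<close>

theorem AE_fam_ball_prob_le:
  assumes s': "s' < min (d1 m p T) (real CARD('n))"
  shows "AE \<omega> in P. AE x in bm. \<forall>\<^sub>F n in sequentially. fam_ball_prob \<omega> x ((1 / 2) ^ n) \<le> ((1 / 2) ^ n) powr s'"
proof -
  obtain s where s: "0 \<le> s" "s < min (d1 m p T) (real CARD('n))" "s' < s"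
  proof -
    have "max 0 s' < min (d1 m p T) (real CARD('n))" using s' d1_properties by auto
    then obtain s where "max 0 s' < s" "s < min (d1 m p T) (real CARD('n))" using dense by blast
    then show thesis using that[of s] by auto
  qed
  obtain c where c: "c > 0" "AE x in bm. \<forall>\<^sub>F n in sequentially. c * real n \<le> energy s (prefix_word x n)"
    using AE_energy_lower[of s] s by auto
  have "AE x in bm. (\<forall>\<^sub>F n in sequentially. c * real n \<le> energy s (prefix_word x n)) \<longrightarrow>
      (AE \<omega> in P. \<forall>\<^sub>F n in sequentially. fam_ball_prob \<omega> x ((1 / 2) ^ n) \<le> ((1 / 2) ^ n) powr s')"
  proof (rule AE_I2, rule impI)
    fix x assume "x \<in> space bm" and en: "\<forall>\<^sub>F n in sequentially. c * real n \<le> energy s (prefix_word x n)"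
    then show "AE \<omega> in P. \<forall>\<^sub>F n in sequentially. fam_ball_prob \<omega> x ((1 / 2) ^ n) \<le> ((1 / 2) ^ n) powr s'"
      using s by (intro AE_fam_ball_prob_le_pointwise[OF _ s(1) _ s(3) c(1) en]) auto
  qed
  then have "AE x in bm. AE \<omega> in P. \<forall>\<^sub>F n in sequentially. fam_ball_prob \<omega> x ((1 / 2) ^ n) \<le> ((1 / 2) ^ n) powr s'"
    by (rule AE_mp[OF c(2)])
  moreover have "{z \<in> space (P \<Otimes>\<^sub>M bm). \<forall>\<^sub>F n in sequentially. fam_ball_prob (fst z) (snd z) ((1 / 2) ^ n) \<le> ((1 / 2) ^ n) powr s'} \<in> sets (P \<Otimes>\<^sub>M bm)"
    unfolding eventually_sequentially by measurable
  ultimately show ?thesis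
    by (subst pair.AE_commute) auto
qed

end

subsection \<open>From the code space to the measure\<close>

text \<open>Every small r lies between two consecutive powers of 1/2. Replacing it by one of them
  costs at most a factor 2^(d+e), which r^e absorbs; hence the doubled e.\<close>

lemma eventually_dyadic_to_at_right:
  fixes F :: "real \<Rightarrow> real"
  assumes F: "mono F" and e: "0 < e" "e \<le> d"
    and ev: "\<forall>\<^sub>F n in sequentially. ((1 / 2) ^ n) powr (d + e) \<le> F ((1 / 2) ^ n) \<and> F ((1 / 2) ^ n) \<le> ((1 / 2) ^ n) powr (d - e)"
  shows "\<forall>\<^sub>F r in at_right 0. r powr (d + 2 * e) \<le> F r \<and> F r \<le> r powr (d - 2 * e)"
proof -
  obtain n0 where n0: "\<And>n. n \<ge> n0 \<Longrightarrow> ((1 / 2) ^ n) powr (d + e) \<le> F ((1 / 2) ^ n) \<and> F ((1 / 2) ^ n) \<le> ((1 / 2) ^ n) powr (d - e)"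
    using ev by (auto simp: eventually_sequentially)
  have "((\<lambda>r. r powr e) \<longlongrightarrow> 0) (at_right (0::real))" using e by real_asymp
  then have "\<forall>\<^sub>F r in at_right 0. r powr e < 2 powr - (d + e)"
    by (rule order_tendstoD(2)) simp
  moreover have "\<forall>\<^sub>F r in at_right 0. r < (1 / 2 :: real) ^ n0"
    by (intro eventually_at_rightI[of 0 "(1 / 2) ^ n0"]) auto
  ultimately show ?thesis using eventually_at_right_less[of 0]
  proof eventually_elim
    case (elim r)
    have "\<exists>k. (1 / 2) ^ Suc k < r"
    proof -
      obtain k where k: "(1 / 2 :: real) ^ k < r" using real_arch_pow_inv[of r "1 / 2"] elim by auto
      have "(1 / 2 :: real) ^ Suc k \<le> (1 / 2) ^ k" by simp
      with k show ?thesis by (intro exI[of _ k]) linarith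
    qed
    define k where "k = (LEAST k. (1 / 2) ^ Suc k < r)"
    have k: "(1 / 2) ^ Suc k < r" using LeastI_ex[OF \<open>\<exists>k. (1 / 2) ^ Suc k < r\<close>] unfolding k_def .
    have "n0 \<le> k"
    proof (rule ccontr)
      assume "\<not> n0 \<le> k"
      then have "(1 / 2 :: real) ^ n0 \<le> (1 / 2) ^ Suc k" by (intro power_decreasing) auto
      then show False using k elim by linarith
    qed
    have rk: "r \<le> (1 / 2) ^ k"
    proof (cases k)
      case 0
      have "(1 / 2 :: real) ^ n0 \<le> 1" by (rule power_le_one) auto
      then show ?thesis using elim 0 by simp
    next
      case (Suc k')
      then show ?thesis using not_less_Least[of k' "\<lambda>k. (1 / 2) ^ Suc k < r"] by (simp add: k_def not_less)
    qed
    have "F r \<le> F ((1 / 2) ^ k)" by (rule monoD[OF F rk])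
    also have "\<dots> \<le> ((1 / 2) ^ k) powr (d - e)" using n0[OF \<open>n0 \<le> k\<close>] by simp
    \<comment> \<open>The hypothesis e \<le> d keeps the exponent nonnegative, so the power is
      increasing in its base.\<close>
    also have "\<dots> \<le> (2 * r) powr (d - e)" using k e by (intro powr_mono2) auto
    also have "\<dots> = 2 powr (d - e) * r powr e * r powr (d - 2 * e)"
      using elim by (simp add: powr_mult mult.assoc flip: powr_add)
    also have "\<dots> \<le> 1 * r powr (d - 2 * e)"
    proof (rule mult_right_mono)
      have "2 powr (d - e) * r powr e \<le> 2 powr (d + e) * 2 powr - (d + e)"
        using elim e by (intro mult_mono powr_mono) auto
      also have "2 powr (d + e) * 2 powr - (d + e) = (1::real)"
        unfolding powr_add[symmetric] by simp
      finally show "2 powr (d - e) * r powr e \<le> 1" .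
    qed simp
    finally have up: "F r \<le> r powr (d - 2 * e)" by simp
    have "r powr (d + 2 * e) = r powr e * r powr (d + e)" by (simp add: algebra_simps flip: powr_add)
    also have "\<dots> \<le> 2 powr - (d + e) * r powr (d + e)" using elim by (intro mult_right_mono) auto
    also have "\<dots> = (r / 2) powr (d + e)" using elim by (simp only: powr_divide powr_minus_divide) simp
    also have "\<dots> \<le> ((1 / 2) ^ Suc k) powr (d + e)" using rk e elim by (intro powr_mono2) auto
    also have "\<dots> \<le> F ((1 / 2) ^ Suc k)" using n0[of "Suc k"] \<open>n0 \<le> k\<close> by simp
    also have "\<dots> \<le> F r" using k by (intro monoD[OF F]) simp
    finally show ?case using up by simp
  qed
qed

lemma tendsto_ln_ratio:
  fixes F :: "real \<Rightarrow> real"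
  assumes "\<And>j::nat. \<forall>\<^sub>F r in at_right 0. r powr (d + 1 / real (Suc j)) \<le> F r \<and> F r \<le> r powr (d - 1 / real (Suc j))"
  shows "((\<lambda>r. ln (F r) / ln r) \<longlongrightarrow> d) (at_right 0)"
proof (rule tendstoI)
  fix \<epsilon> :: real assume "\<epsilon> > 0"
  then obtain j where j: "1 / real (Suc j) < \<epsilon>" using nat_approx_posE[of \<epsilon>] by auto
  define e where "e = 1 / real (Suc j)"
  have "\<forall>\<^sub>F r in at_right (0::real). r < 1"
    by (intro eventually_at_rightI[of 0 1]) auto
  with assms[of j] eventually_at_right_less[of 0]
  show "\<forall>\<^sub>F r in at_right 0. dist (ln (F r) / ln r) d < \<epsilon>"
  proof eventually_elim
    case (elim r)
    have ln: "ln r < 0" using elim by simp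
    have b: "r powr (d + e) \<le> F r" "F r \<le> r powr (d - e)" using elim unfolding e_def by auto
    have "0 < r powr (d + e)" using elim by simp
    then have "0 < F r" using b by linarith
    have "ln (r powr (d + e)) \<le> ln (F r)" "ln (F r) \<le> ln (r powr (d - e))"
      by (rule ln_mono[OF b(1) \<open>0 < r powr (d + e)\<close>], rule ln_mono[OF b(2) \<open>0 < F r\<close>])
    then have "(d + e) * ln r \<le> ln (F r)" "ln (F r) \<le> (d - e) * ln r"
      using elim by (auto simp: ln_powr)
    then have "ln (F r) / ln r \<le> d + e" "d - e \<le> ln (F r) / ln r"
      using ln by (auto simp: neg_divide_le_eq neg_le_divide_eq)
    then show ?case using j unfolding e_def dist_real_def by linarith
  qed
qed

context bounded_family
begin

lemma measure_distr_cball: "measure (distr bm borel pt) (cball (pt x) r) = ball_prob x r"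
proof -
  have "pt -` cball (pt x) r \<inter> space bm = {y \<in> space bm. dist (pt x) (pt y) \<le> r}" by auto
  then show ?thesis by (simp add: measure_distr ball_prob_def)
qed

lemma dimension_of_distr:
  assumes d: "0 < d"
    and lower: "\<And>e. e > 0 \<Longrightarrow> AE x in bm. \<forall>\<^sub>F n in sequentially. ball_prob x ((1 / 2) ^ n) \<le> ((1 / 2) ^ n) powr (d - e)"
    and upper: "\<And>e. e > 0 \<Longrightarrow> AE x in bm. \<forall>\<^sub>F r in at_right 0. r powr (d + e) \<le> ball_prob x r"
  shows "exact_dimensional (distr bm borel pt) d \<and> has_information_dimension (distr bm borel pt) d"
proof -
  define \<nu> where "\<nu> = distr bm borel pt"
  have sets: "sets \<nu> = sets borel" by (simp add: \<nu>_def)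
  interpret \<nu>: prob_space \<nu> unfolding \<nu>_def by (rule bm.prob_space_distr) simp
  have [measurable]: "(\<lambda>y. \<nu>.prob (cball y r)) \<in> borel_measurable borel" for r
    by (rule measurable_measure_cball[OF \<nu>.prob_space_axioms sets])
  have dyadic: "filterlim (\<lambda>n. (1 / 2) ^ n) (at_right (0::real)) sequentially"
    by real_asymp
  have cballs: "mono (\<lambda>r. \<nu>.prob (cball y r))" for y
    by (intro monoI \<nu>.finite_measure_mono) (auto simp: sets)
  have local: "AE y in \<nu>. \<forall>\<^sub>F r in at_right 0. r powr (d + e) \<le> \<nu>.prob (cball y r) \<and> \<nu>.prob (cball y r) \<le> r powr (d - e)"
    if e: "e > 0" for e
  proof -
    define e' where "e' = min (e / 2) d"
    have e': "0 < e'" "e' \<le> d" "2 * e' \<le> e" using e d by (auto simp: e'_def)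
    let ?Q = "\<lambda>y. \<forall>\<^sub>F n in sequentially. ((1 / 2) ^ n) powr (d + e') \<le> \<nu>.prob (cball y ((1 / 2) ^ n)) \<and>
        \<nu>.prob (cball y ((1 / 2) ^ n)) \<le> ((1 / 2) ^ n) powr (d - e')"
    have "AE x in bm. ?Q (pt x)"
      using lower[OF e'(1)] upper[OF e'(1)]
    proof eventually_elim
      case (elim x)
      from filterlim_iff[THEN iffD1, OF dyadic, rule_format, OF elim(2)] elim(1)
      show ?case by eventually_elim (simp add: \<nu>_def measure_distr_cball)
    qed
    \<comment> \<open>Dyadic radii leave countably many conditions and hence a measurable set, as
      the transfer of an almost-everywhere statement to the image measure requires.\<close>
    moreover have "{y \<in> space borel. ?Q y} \<in> sets borel"
      unfolding eventually_sequentially by measurable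
    then have "(AE y in distr bm borel pt. ?Q y) \<longleftrightarrow> (AE x in bm. ?Q (pt x))"
      by (rule AE_distr_iff[OF measurable_pt])
    ultimately have "AE y in \<nu>. ?Q y"
      by (simp only: \<nu>_def[symmetric])
    then show ?thesis
    proof eventually_elim
      case (elim y)
      have "\<forall>\<^sub>F r in at_right (0::real). r < 1"
        by (intro eventually_at_rightI[of 0 1]) auto
      with eventually_dyadic_to_at_right[OF cballs e'(1,2) elim] eventually_at_right_less[of 0]
      show ?case
      proof eventually_elim
        case (elim r)
        have "r powr (d + e) \<le> r powr (d + 2 * e')" "r powr (d - 2 * e') \<le> r powr (d - e)"
          using elim e' by (auto intro!: powr_mono')
        then show ?case using elim by linarith
      qed
    qed
  qed
  have "\<nu>.prob (cball 0 radius) = 1"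
  proof -
    have "pt -` cball 0 radius \<inter> space bm = space bm" using norm_pt_le by auto
    then show ?thesis unfolding \<nu>_def by (simp add: measure_distr bm.prob_space)
  qed
  then interpret ld: local_dimension \<nu> d radius
    using local by unfold_locales (auto simp: sets d radius_nonneg)
  have "AE y in \<nu>. \<forall>j::nat. \<forall>\<^sub>F r in at_right 0. r powr (d + 1 / real (Suc j)) \<le> \<nu>.prob (cball y r) \<and> \<nu>.prob (cball y r) \<le> r powr (d - 1 / real (Suc j))"
    unfolding AE_all_countable using local by simp
  then have "AE y in \<nu>. ((\<lambda>r. ln (\<nu>.prob (cball y r)) / ln r) \<longlongrightarrow> d) (at_right 0)"
    by eventually_elim (intro tendsto_ln_ratio; blast)
  then have "exact_dimensional \<nu> d"
    unfolding exact_dimensional_def using \<nu>.prob_space_axioms sets by blast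
  then show ?thesis using ld.has_information_dimension unfolding \<nu>_def by blast
qed

end

subsection \<open>Uniform constants and bounded densities\<close>

lemma contraction_constants:
  fixes T :: "nat \<Rightarrow> 'a::euclidean_space \<Rightarrow> 'a"
  assumes "\<And>i. i \<in> {1..m} \<Longrightarrow> linear (T i)" "\<And>i. i \<in> {1..m} \<Longrightarrow> bij (T i)"
    "\<And>i. i \<in> {1..m} \<Longrightarrow> onorm (T i) < 1"
  obtains \<kappa> \<Lambda> where "0 < \<kappa>" "\<And>i x. i \<in> {1..m} \<Longrightarrow> \<kappa> * norm x \<le> norm (T i x)"
    "0 < \<Lambda>" "\<Lambda> < 1" "\<And>i x. i \<in> {1..m} \<Longrightarrow> norm (T i x) \<le> \<Lambda> * norm x"
proof -
  have "\<exists>a>0. \<forall>x. a * norm x \<le> norm (T i x)" if "i \<in> {1..m}" for i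
    using linear_bij_lower_bound[OF assms(1,2)[OF that]] by metis
  then obtain a where a: "\<And>i. i \<in> {1..m} \<Longrightarrow> a i > 0 \<and> (\<forall>x. a i * norm x \<le> norm (T i x))"
    by metis
  \<comment> \<open>Inserting 1 and 1/2 keeps the minimum and the maximum away from empty sets, and
    1/2 makes \<Lambda> positive.\<close>
  define \<kappa> where "\<kappa> = Min (insert 1 (a ` {1..m}))"
  define \<Lambda> where "\<Lambda> = Max (insert (1 / 2) ((\<lambda>i. onorm (T i)) ` {1..m}))"
  show thesis
  proof (rule that)
    show "0 < \<kappa>" unfolding \<kappa>_def using a by (subst Min_gr_iff) auto
    show "\<kappa> * norm x \<le> norm (T i x)" if i: "i \<in> {1..m}" for i x
    proof -
      have "\<kappa> \<le> a i" unfolding \<kappa>_def using i by (intro Min_le) auto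
      then have "\<kappa> * norm x \<le> a i * norm x" by (intro mult_right_mono) auto
      then show ?thesis using a[OF i] order_trans by blast
    qed
    have "1 / 2 \<le> \<Lambda>" unfolding \<Lambda>_def by (intro Max_ge) auto
    then show "0 < \<Lambda>" by simp
    show "\<Lambda> < 1" unfolding \<Lambda>_def using assms(3) by (subst Max_less_iff) auto
    show "norm (T i x) \<le> \<Lambda> * norm x" if i: "i \<in> {1..m}" for i x
    proof -
      have "onorm (T i) \<le> \<Lambda>" unfolding \<Lambda>_def using i by (intro Max_ge) auto
      then have "onorm (T i) * norm x \<le> \<Lambda> * norm x" by (intro mult_right_mono) auto
      moreover have "norm (T i x) \<le> onorm (T i) * norm x"
        using assms(1)[OF i] by (intro onorm) (simp add: linear_conv_bounded_linear)
      ultimately show ?thesis by linarith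
    qed
  qed
qed

lemma weight_constants:
  fixes p :: "nat \<Rightarrow> real"
  assumes m: "m \<ge> 2" and p: "\<And>i. i \<in> {1..m} \<Longrightarrow> p i > 0" "(\<Sum>i=1..m. p i) = 1"
  obtains q Q where "0 < q" "\<And>i. i \<in> {1..m} \<Longrightarrow> q \<le> p i" "0 < Q" "Q < 1" "\<And>i. i \<in> {1..m} \<Longrightarrow> p i \<le> Q"
proof -
  have ne: "{1..m} \<noteq> {}" using m by auto
  \<comment> \<open>As m \<ge> 2, some other letter takes a positive share of the total mass
    1.\<close>
  have p1: "p i < 1" if i: "i \<in> {1..m}" for i
  proof -
    obtain j where j: "j \<in> {1..m}" "j \<noteq> i"
      using m by (metis atLeastAtMost_iff le_trans one_le_numeral order_refl numeral_eq_one_iff semiring_norm(85))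
    have "(\<Sum>k\<in>{i, j}. p k) \<le> (\<Sum>k=1..m. p k)"
      using i j p by (intro sum_mono2) (auto intro: less_imp_le)
    then show ?thesis using p(1)[OF j(1)] p(2) j by simp
  qed
  show thesis
  proof (rule that)
    show "0 < Min (p ` {1..m})" using ne p by (subst Min_gr_iff) auto
    show "Min (p ` {1..m}) \<le> p i" if "i \<in> {1..m}" for i using that by (intro Min_le) auto
    show "Max (p ` {1..m}) < 1" using ne p1 by (subst Max_less_iff) auto
    show le: "p i \<le> Max (p ` {1..m})" if "i \<in> {1..m}" for i using that by (intro Max_ge) auto
    have "1 \<in> {1..m}" using m by auto
    from le[OF this] p(1)[OF this] show "0 < Max (p ` {1..m})" by linarith
  qed
qed

text \<open>The density of \<open>\<theta>\<close> need not be bounded. It is bounded on a set carrying most of \<open>\<theta>\<close>.\<close>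

lemma bounded_density_set:
  fixes \<theta> :: "'a::euclidean_space measure"
  assumes \<theta>: "prob_space \<theta>" "sets \<theta> = sets borel" and ac: "absolutely_continuous lborel \<theta>" and \<delta>: "0 < \<delta>"
  obtains G M where "G \<in> sets borel" "0 \<le> M" "measure \<theta> (- G) \<le> \<delta>"
    "\<And>A. A \<in> sets borel \<Longrightarrow> emeasure \<theta> (A \<inter> G) \<le> ennreal M * emeasure lborel A"
proof -
  interpret prob_space \<theta> by fact
  have sp: "space \<theta> = UNIV" using sets_eq_imp_space_eq[OF \<theta>(2)] by simp
  obtain f where f[measurable]: "f \<in> borel_measurable lborel" and dens: "density lborel f = \<theta>"
    using sigma_finite_measure.Radon_Nikodym[OF sigma_finite_lborel ac] \<theta>(2) by auto
  have fb[measurable]: "f \<in> borel_measurable borel" using f by simp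
  have "(\<integral>\<^sup>+x. f x \<partial>lborel) = emeasure \<theta> (space \<theta>)"
    unfolding dens[symmetric] by (subst emeasure_density) (auto intro!: nn_integral_cong)
  then have "(\<integral>\<^sup>+x. f x \<partial>lborel) \<noteq> \<infinity>" by (simp add: emeasure_space_1)
  then have fin: "AE x in lborel. f x \<noteq> \<infinity>" by (intro nn_integral_PInf_AE f)
  \<comment> \<open>The density is integrable and thus finite almost everywhere, so these sets
    decrease to a Lebesgue null set, which is also null for \<theta>.\<close>
  define B where "B K = {x. \<not> f x \<le> of_nat K}" for K :: nat
  have Bm: "B K \<in> sets borel" for K
  proof -
    have "{x \<in> space borel. \<not> f x \<le> of_nat K} \<in> sets borel" by measurable
    then show ?thesis by (simp add: B_def)
  qed
  have "decseq B" by (auto simp: decseq_def B_def) (meson of_nat_mono order_trans)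
  then have "(\<lambda>K. prob (B K)) \<longlonglongrightarrow> prob (\<Inter>K. B K)"
    using Bm by (intro finite_Lim_measure_decseq) (auto simp: \<theta>(2))
  moreover have "prob (\<Inter>K. B K) = 0"
  proof -
    have "(\<Inter>K. B K) \<in> null_sets lborel"
    proof (rule AE_iff_null_sets[THEN iffD2])
      show "(\<Inter>K. B K) \<in> sets lborel" using Bm by auto
      show "AE x in lborel. x \<notin> (\<Inter>K. B K)"
        using fin
      proof eventually_elim
        case (elim x)
        then obtain K where "f x < of_nat K" using ennreal_Ex_less_of_nat[of "f x"] by (auto simp: less_top)
        then have "x \<notin> B K" by (simp add: B_def less_imp_le)
        then show ?case by blast
      qed
    qed
    then have "(\<Inter>K. B K) \<in> null_sets \<theta>" using ac by (auto simp: absolutely_continuous_def)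
    then show ?thesis by (simp add: measure_def null_setsD1)
  qed
  ultimately have "\<forall>\<^sub>F K in sequentially. prob (B K) < \<delta>"
    using \<delta> by (intro order_tendstoD(2)) auto
  then obtain K where K: "prob (B K) < \<delta>" by (auto simp: eventually_sequentially)
  show thesis
  proof (rule that[of "- B K" "real K"])
    show "- B K \<in> sets borel" using Bm by auto
    show "measure \<theta> (- (- B K)) \<le> \<delta>" using K by simp
    fix A :: "'a set" assume A[measurable]: "A \<in> sets borel"
    note [measurable] = \<open>- B K \<in> sets borel\<close>
    have "emeasure \<theta> (A \<inter> - B K) = (\<integral>\<^sup>+x. f x * indicator (A \<inter> - B K) x \<partial>lborel)"
      unfolding dens[symmetric] by (rule emeasure_density) auto
    also have "\<dots> \<le> (\<integral>\<^sup>+x. of_nat K * indicator A x \<partial>lborel)"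
      by (intro nn_integral_mono) (auto simp: B_def indicator_def)
    also have "\<dots> = ennreal (real K) * emeasure lborel A"
      by (simp add: nn_integral_cmult ennreal_of_nat_eq_real_of_nat)
    finally show "emeasure \<theta> (A \<inter> - B K) \<le> ennreal (real K) * emeasure lborel A" .
  qed simp
qed

theorem theorem6p2:
  fixes m :: nat
    and T :: "nat \<Rightarrow> real^'n \<Rightarrow> real^'n"
    and p :: "nat \<Rightarrow> real"
    and D :: "(real^'n) set"
    and P :: "(nat list \<Rightarrow> real^'n) measure"
    and \<theta> :: "(real^'n) measure"
  assumes m: "m \<ge> 2"
    and T_linear: "\<And>i. i \<in> {1..m} \<Longrightarrow> linear (T i)"
    and T_nonsingular: "\<And>i. i \<in> {1..m} \<Longrightarrow> bij (T i)"
    and T_contraction: "\<And>i. i \<in> {1..m} \<Longrightarrow> onorm (T i) < 1"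
    and p_pos: "\<And>i. i \<in> {1..m} \<Longrightarrow> p i > 0"
    and p_sum: "(\<Sum>i=1..m. p i) = 1"
    and D_bounded: "bounded D"
    and P_prob: "prob_space P"
    and P_in_D: "\<And>w. w \<in> words m \<Longrightarrow> AE \<omega> in P. \<omega> w \<in> D"
    and P_indep: "prob_space.indep_vars P (\<lambda>w. borel) (\<lambda>w \<omega>. \<omega> w) (words m)"
    and P_ident: "\<And>w. w \<in> words m \<Longrightarrow> distr P borel (\<lambda>\<omega>. \<omega> w) = \<theta>"
    and \<theta>_ac: "absolutely_continuous lborel \<theta>"
  shows "AE \<omega> in P.
    exact_dimensional (almost_self_affine_measure m p T \<omega>) (min (d1 m p T) (real CARD('n))) \<and>
    has_information_dimension (almost_self_affine_measure m p T \<omega>) (min (d1 m p T) (real CARD('n)))"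
proof -
  interpret P: prob_space P by fact
  let ?d = "min (d1 m p T) (real CARD('n))"
  obtain \<kappa> \<Lambda> where cc: "0 < \<kappa>" "\<And>i x. i \<in> {1..m} \<Longrightarrow> \<kappa> * norm x \<le> norm (T i x)"
    "0 < \<Lambda>" "\<Lambda> < 1" "\<And>i x. i \<in> {1..m} \<Longrightarrow> norm (T i x) \<le> \<Lambda> * norm x"
    using contraction_constants[of m T] T_linear T_nonsingular T_contraction by metis
  obtain q Q where qq: "0 < q" "\<And>i. i \<in> {1..m} \<Longrightarrow> q \<le> p i" "0 < Q" "Q < 1" "\<And>i. i \<in> {1..m} \<Longrightarrow> p i \<le> Q"
    using weight_constants[OF m p_pos p_sum] by metis
  interpret sa: self_affine m p T \<kappa> \<Lambda> q Q
    by (intro self_affine.intro bernoulli_shift.intro self_affine_axioms.intro)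
      (fact p_pos p_sum T_linear T_nonsingular cc qq)+
  obtain R0 where R0: "\<And>x. x \<in> D \<Longrightarrow> norm x \<le> R0" using D_bounded by (auto simp: bounded_iff)
  define R where "R = max 1 R0"
  have R: "1 \<le> R" "\<And>x. x \<in> D \<Longrightarrow> norm x \<le> R" using R0 by (auto simp: R_def max.coboundedI2)
  \<comment> \<open>The vectors are bounded only almost surely. Clipping bounds them everywhere and
    preserves independence; as there are countably many words, almost every family is left
    unchanged.\<close>
  define clip where "clip x = (if norm x \<le> R then x else 0)" for x :: "real^'n"
  have clip_m[measurable]: "clip \<in> borel_measurable borel" unfolding clip_def by measurable
  define X where "X w \<omega> = clip (\<omega> w)" for w and \<omega> :: "nat list \<Rightarrow> real^'n"
  have rv[measurable]: "(\<lambda>\<omega>. \<omega> w) \<in> borel_measurable P" if "w \<in> words m" for w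
    using P_indep that unfolding P.indep_vars_def by blast
  have X_eq: "AE \<omega> in P. X w \<omega> = \<omega> w" if "w \<in> words m" for w
    using P_in_D[OF that] by eventually_elim (simp add: X_def clip_def R)
  have empty: "[] \<in> words m" by (simp add: words_def)
  have \<theta>: "prob_space \<theta>" "sets \<theta> = sets borel"
    using P.prob_space_distr[OF rv[OF empty]] P_ident[OF empty] by auto
  obtain G M where GM: "G \<in> sets borel" "0 \<le> M" "measure \<theta> (- G) \<le> q / 2"
    "\<And>A. A \<in> sets borel \<Longrightarrow> emeasure \<theta> (A \<inter> G) \<le> ennreal M * emeasure lborel A"
    using bounded_density_set[OF \<theta> \<theta>_ac, of "q / 2"] qq(1) by auto
  have X_distr: "emeasure P {\<omega> \<in> space P. X w \<omega> \<in> A} = emeasure \<theta> A" if w: "w \<in> words m" and A: "A \<in> sets borel" for w A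
  proof -
    note [measurable] = rv[OF w] A
    have "emeasure P {\<omega> \<in> space P. X w \<omega> \<in> A} = emeasure P {\<omega> \<in> space P. \<omega> w \<in> A}"
    proof (rule emeasure_eq_AE)
      show "AE \<omega> in P. (\<omega> \<in> {\<omega> \<in> space P. X w \<omega> \<in> A}) = (\<omega> \<in> {\<omega> \<in> space P. \<omega> w \<in> A})"
        using X_eq[OF w] by eventually_elim simp
      show "{\<omega> \<in> space P. X w \<omega> \<in> A} \<in> sets P" unfolding X_def by measurable
      show "{\<omega> \<in> space P. \<omega> w \<in> A} \<in> sets P" by measurable
    qed
    also have "\<dots> = emeasure \<theta> A"
      unfolding P_ident[OF w, symmetric] using rv[OF w] A
      by (subst emeasure_distr) (auto intro!: arg_cong[where f = "emeasure P"])
    finally show ?thesis .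
  qed
  interpret rf: random_family m p T \<kappa> \<Lambda> q Q P X R M "q / 2" G
  proof unfold_locales
    show "norm (X w \<omega>) \<le> R" for w \<omega> using R(1) by (simp add: X_def clip_def)
    show "1 \<le> R" by (rule R)
    show "P.indep_vars (\<lambda>_. borel) X (words m)"
      using P.indep_vars_compose2[OF P_indep, of "\<lambda>_. clip" "\<lambda>_. borel"] clip_m by (simp add: X_def[abs_def])
    show "emeasure P {\<omega> \<in> space P. X w \<omega> \<in> A \<inter> G} \<le> ennreal M * emeasure lborel A" if "w \<in> words m" "A \<in> sets borel" for w A
      using GM(4)[OF that(2)] X_distr[OF that(1), of "A \<inter> G"] that GM(1) by simp
    show "P.prob {\<omega> \<in> space P. X w \<omega> \<notin> G} \<le> q / 2" if "w \<in> words m" for w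
      using GM(1,3) X_distr[OF that, of "- G"] by (simp add: measure_def)
  qed (use GM in auto)
  have d: "0 < ?d" using sa.d1_properties by simp
  have less: "c - 1 / real (Suc j) < c" for c :: real and j by simp
  have "AE \<omega> in P. \<forall>w\<in>words m. X w \<omega> = \<omega> w"
    by (subst AE_ball_countable) (use X_eq rf.countable_words in auto)
  \<comment> \<open>The exponents run through a sequence tending to the dimension, so that a single
    null set of families serves for all of them.\<close>
  moreover have "AE \<omega> in P. \<forall>j::nat. AE x in bernoulli_measure m p. \<forall>\<^sub>F n in sequentially.
      rf.fam_ball_prob \<omega> x ((1 / 2) ^ n) \<le> ((1 / 2) ^ n) powr (?d - 1 / real (Suc j))"
    unfolding AE_all_countable by (intro allI rf.AE_fam_ball_prob_le less)
  ultimately show ?thesis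
  proof eventually_elim
    case (elim \<omega>)
    interpret bf: bounded_family m p T \<kappa> \<Lambda> q Q "\<lambda>w. X w \<omega>" R by (rule rf.bounded_family)
    have fam: "rf.fam_ball_prob \<omega> x r = bf.ball_prob x r" for x r
      by (simp add: rf.fam_ball_prob_def bf.ball_prob_def rf.cp_def)
    have "code_point T \<omega> x = bf.pt x" if "x \<in> code_space m" for x
      unfolding code_point_def using elim(1) sa.prefix_word_in_words'[OF that] by simp
    then have \<nu>: "almost_self_affine_measure m p T \<omega> = distr (bernoulli_measure m p) borel bf.pt"
      unfolding almost_self_affine_measure_def by (intro distr_cong) auto
    show ?case
      unfolding \<nu>
    proof (rule bf.dimension_of_distr[OF d])
      fix e :: real assume e: "e > 0"
      then obtain j where j: "1 / real (Suc j) < e" using nat_approx_posE[of e] by auto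
      show "AE x in bernoulli_measure m p. \<forall>\<^sub>F n in sequentially. bf.ball_prob x ((1 / 2) ^ n) \<le> ((1 / 2) ^ n) powr (?d - e)"
        using elim(2)[rule_format, of j]
      proof eventually_elim
        case (elim x)
        then show ?case
        proof eventually_elim
          case (elim n)
          have "((1 / 2 :: real) ^ n) powr (?d - 1 / real (Suc j)) \<le> ((1 / 2) ^ n) powr (?d - e)"
            using j by (intro powr_mono') (auto simp: power_le_one)
          then show ?case using elim by (simp add: fam)
        qed
      qed
      show "AE x in bernoulli_measure m p. \<forall>\<^sub>F r in at_right 0. r powr (?d + e) \<le> bf.ball_prob x r"
        by (rule bf.AE_ball_prob_ge) (use e in simp)
    qed
  qed
qed

end
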